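(* Let $f:\Sigma\to M^3$ be a mixed type surface in a Lorentzian $3$-manifold $M^3$ and let $p\in\Sigma$ be a lightlike point of the admissible second kind. If $p$ is not an $L_3$-point, then the lightlike geodesic torsion $\kappa_G$ is unbounded at $p$.
   Context: All objects are smooth. $(M^3,\bar g)$, $\bar g=\langle\ ,\ \rangle$, is a Lorentzian $3$-manifold (signature $(+,+,-)$) with Levi-Civita connection $\nabla$. A surface is an immersion $f:\Sigma\to M^3$ of a connected $2$-manifold; its first fundamental form is $ds^2=f^*\bar g$. A point is spacelike, timelike or lightlike if $ds^2$ there is positive definite, (non-degenerate) indefinite, or degenerate. $LD$ is the set of lightlike points. The surface is of mixed type if both the spacelike and the timelike point sets are non-empty. In local coordinates $ds^2=E\,du^2+2F\,du\,dv+G\,dv^2$, $\lambda=EG-F^2$. A lightlike point $p$ is non-degenerate if $d\lambda(p)\ne0$; then near $p$ the set $LD$ is the image of a regular curve $\gamma(t)$, $\gamma(0)=p$ (characteristic curve). At a lightlike point the null space $\{\boldsymbol v: ds^2(\boldsymbol v,\cdot)=0\}$ is one-dimensional; its nonzero elements are null vectors. A null vector field is a smooth vector field $\eta$ on an open set $U$ with $\eta_q$ a null vector for each $q\in LD\cap U$; $\eta(t)=\eta_{\gamma(t)}$. A non-degenerate lightlike point $p=\gamma(0)$ is of the first kind (resp. second kind) if $\gamma'(0),\eta(0)$ are linearly independent (resp. dependent). A point $p$ of the second kind is admissible if every neighborhood of $p$ contains a lightlike point of the first kind. With $\delta(t)=\det(\gamma'(t),\eta(t))$, $p=\gamma(0)$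 is an $L_3$-point if $\delta(0)=0$ and $\delta'(0)\ne0$. At a lightlike point $q$ of the first kind: let $\hat\gamma=f\circ\gamma$, $\gamma(0)=q$, with $|\hat\gamma'|=1$, and $\boldsymbol e=\hat\gamma'$. Let $\eta$ be a normalized null vector field, i.e. $\eta\langle df(\eta),df(\eta)\rangle=1$ along $LD$ (it exists, unique along $LD$). Put $L(t)=df(\eta(t))$ and let $N(t)$ be the unique field along $\hat\gamma$ with $\langle N,\boldsymbol e\rangle=\langle N,N\rangle=0$, $\langle N,L\rangle=1$. The lightlike geodesic torsion is $\kappa_G(q)=\langle L,\nabla_tN\rangle|_{t=0}$. "Unbounded at $p$" means that $\kappa_G$ is unbounded on the set of lightlike points of the first kind in every neighborhood of $p$. *)

theory Defs
  imports "HOL-Analysis.Analysis"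
begin

section \<open>Smooth maps between Euclidean spaces\<close>

text \<open>Only used on open sets \<open>S\<close>; \<open>C_k_on k f S\<close> says that \<open>f\<close> is of class \<open>C^k\<close> on \<open>S\<close>.\<close>

primrec C_k_on ::
  "nat \<Rightarrow> ('a::euclidean_space \<Rightarrow> 'b::euclidean_space) \<Rightarrow> 'a set \<Rightarrow> bool" where
  "C_k_on 0 f S \<longleftrightarrow> continuous_on S f"
| "C_k_on (Suc k) f S \<longleftrightarrow>
     (\<forall>x\<in>S. f differentiable (at x)) \<and>
     (\<forall>v. C_k_on k (\<lambda>x. frechet_derivative f (at x) v) S)"

definition smooth_on ::
  "'a set \<Rightarrow> ('a::euclidean_space \<Rightarrow> 'b::euclidean_space) \<Rightarrow> bool" where
  "smooth_on S f \<longleftrightarrow> (\<forall>k. C_k_on k f S)"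


lemma frechet_derivative_cong_open:
  fixes F G :: "'a::euclidean_space \<Rightarrow> 'b::euclidean_space"
  assumes "open T" "x \<in> T" "\<And>y. y \<in> T \<Longrightarrow> F y = G y"
  shows "frechet_derivative F (at x) = frechet_derivative G (at x)"
proof -
  have "(F has_derivative D) (at x) \<longleftrightarrow> (G has_derivative D) (at x)" for D
    using assms has_derivative_transform_within_open[of F D x UNIV T G]
      has_derivative_transform_within_open[of G D x UNIV T F] by auto
  then show ?thesis by (simp add: frechet_derivative_def)
qed

lemma C1_differentiable: "smooth_on T F \<Longrightarrow> x \<in> T \<Longrightarrow> F differentiable (at x)"
  unfolding smooth_on_def by (metis C_k_on.simps(2))


section \<open>Smooth manifolds\<close>

type_synonym ('a, 'n) chart = "'a set \<times> ('a \<Rightarrow> real ^ 'n)"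

record ('a, 'n) mfd =
  top_of :: "'a topology"
  atlas :: "('a, 'n) chart set"

abbreviation dom_of :: "('a, 'n::finite) chart \<Rightarrow> 'a set" where
  "dom_of c \<equiv> fst c"

abbreviation coord :: "('a, 'n::finite) chart \<Rightarrow> 'a \<Rightarrow> real ^ 'n" where
  "coord c \<equiv> snd c"

definition param :: "('a, 'n::finite) chart \<Rightarrow> real ^ 'n \<Rightarrow> 'a" where
  "param c = inv_into (dom_of c) (coord c)"

text \<open>The atlas is any smooth atlas; it need not be maximal.\<close>

definition smooth_manifold :: "('a, 'n::finite) mfd \<Rightarrow> bool" where
  "smooth_manifold X \<longleftrightarrow>
     Hausdorff_space (top_of X) \<and> second_countable (top_of X) \<and>
     topspace (top_of X) = (\<Union>c\<in>atlas X. dom_of c) \<and>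
     (\<forall>c\<in>atlas X.
        openin (top_of X) (dom_of c) \<and> open (coord c ` dom_of c) \<and>
        homeomorphic_map (subtopology (top_of X) (dom_of c))
          (top_of_set (coord c ` dom_of c)) (coord c)) \<and>
     (\<forall>c\<in>atlas X. \<forall>c'\<in>atlas X.
        smooth_on (coord c ` (dom_of c \<inter> dom_of c')) (coord c' \<circ> param c))"

definition chart_at :: "('a, 'n::finite) mfd \<Rightarrow> 'a \<Rightarrow> ('a, 'n) chart \<Rightarrow> bool" where
  "chart_at X q c \<longleftrightarrow> c \<in> atlas X \<and> q \<in> dom_of c"


section \<open>Lorentzian metrics on 3-manifolds\<close>

text \<open>A \<open>(0,2)\<close>-tensor field \<open>g\<close> is given by its matrices of components: \<open>g d m\<close> is the matrix
  at the point \<open>m\<close> with respect to the chart \<open>d\<close>. The last clause below is the transformation law.\<close>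

type_synonym 'm tensor2 = "('m, 3) chart \<Rightarrow> 'm \<Rightarrow> real ^ 3 ^ 3"

definition lorentzian_metric :: "('m, 3) mfd \<Rightarrow> 'm tensor2 \<Rightarrow> bool" where
  "lorentzian_metric M g \<longleftrightarrow>
     (\<forall>d\<in>atlas M.
        smooth_on (coord d ` dom_of d) (g d \<circ> param d) \<and>
        (\<forall>m\<in>dom_of d.
           transpose (g d m) = g d m \<and>
           (\<exists>P :: real ^ 3 ^ 3. invertible P \<and>
              transpose P ** g d m ** P =
                (\<chi> i j. if i \<noteq> j then 0 else if i = 3 then -1 else 1)))) \<and>
     (\<forall>d\<in>atlas M. \<forall>d'\<in>atlas M. \<forall>m \<in> dom_of d \<inter> dom_of d'.
        g d m =
          (let J = matrix (frechet_derivative (coord d' \<circ> param d) (at (coord d m)))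
           in transpose J ** g d' m ** J))"

definition lorentzian_3_manifold :: "('m, 3) mfd \<Rightarrow> 'm tensor2 \<Rightarrow> bool" where
  "lorentzian_3_manifold M g \<longleftrightarrow> smooth_manifold M \<and> lorentzian_metric M g"

text \<open>The pairing of two tangent vectors at \<open>m\<close>, given by their components in the chart \<open>d\<close>.\<close>

definition pairing ::
  "'m tensor2 \<Rightarrow> ('m, 3) chart \<Rightarrow> 'm \<Rightarrow> real ^ 3 \<Rightarrow> real ^ 3 \<Rightarrow> real" where
  "pairing g d m v w = v \<bullet> (g d m *v w)"

definition metric_deriv ::
  "'m tensor2 \<Rightarrow> ('m, 3) chart \<Rightarrow> 'm \<Rightarrow> 3 \<Rightarrow> 3 \<Rightarrow> 3 \<Rightarrow> real" where
  "metric_deriv g d m l i j =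
     frechet_derivative (\<lambda>x. g d (param d x) $ i $ j) (at (coord d m)) (axis l 1)"

text \<open>Christoffel symbols of the Levi-Civita connection: \<open>\<nabla>\<^bsub>\<partial>i\<^esub> \<partial>j = (\<Sum>k. christoffel g d m k i j \<cdot> \<partial>k)\<close>.\<close>

definition christoffel ::
  "'m tensor2 \<Rightarrow> ('m, 3) chart \<Rightarrow> 'm \<Rightarrow> 3 \<Rightarrow> 3 \<Rightarrow> 3 \<Rightarrow> real" where
  "christoffel g d m k i j =
     (\<Sum>l\<in>UNIV. matrix_inv (g d m) $ k $ l *
        (metric_deriv g d m i j l + metric_deriv g d m j i l - metric_deriv g d m l i j)) / 2"

text \<open>The connection defined by these symbols is torsion-free (\<open>christoffel_torsion_free\<close>) and
  compatible with the metric (\<open>christoffel_metric\<close>).\<close>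

lemma metric_deriv_sym:
  assumes "lorentzian_3_manifold M g" "d \<in> atlas M" "m \<in> dom_of d"
  shows "metric_deriv g d m l i j = metric_deriv g d m l j i"
proof -
  have o: "open (coord d ` dom_of d)"
    using assms by (auto simp: lorentzian_3_manifold_def smooth_manifold_def)
  have "g d n $ i $ j = g d n $ j $ i" if "n \<in> dom_of d" for n
  proof -
    have "transpose (g d n) = g d n"
      using assms(1,2) that unfolding lorentzian_3_manifold_def lorentzian_metric_def by blast
    then have "transpose (g d n) $ i $ j = g d n $ i $ j" by (rule arg_cong)
    then show ?thesis by (simp only: transpose_def vec_lambda_beta)
  qed
  moreover have "param d x \<in> dom_of d" if "x \<in> coord d ` dom_of d" for x
    using that by (simp add: param_def inv_into_into)
  ultimately have "frechet_derivative (\<lambda>x. g d (param d x) $ i $ j) (at (coord d m)) =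
      frechet_derivative (\<lambda>x. g d (param d x) $ j $ i) (at (coord d m))"
    by (intro frechet_derivative_cong_open[OF o]) (use assms(3) in blast)+
  then show ?thesis unfolding metric_deriv_def by (rule fun_cong)
qed

lemma christoffel_torsion_free:
  assumes "lorentzian_3_manifold M g" "d \<in> atlas M" "m \<in> dom_of d"
  shows "christoffel g d m k i j = christoffel g d m k j i"
  unfolding christoffel_def
  by (simp add: metric_deriv_sym[OF assms, of _ i j] add.commute)

lemma christoffel_lower:
  assumes "lorentzian_3_manifold M g" "d \<in> atlas M" "m \<in> dom_of d"
  shows "(\<Sum>k\<in>UNIV. g d m $ r $ k * christoffel g d m k i j) =
     (metric_deriv g d m i j r + metric_deriv g d m j i r - metric_deriv g d m r i j) / 2"
proof -
  let ?D = "(\<chi> i j. if i \<noteq> j then 0 else if i = 3 then -1 else 1) :: real ^ 3 ^ 3"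
  obtain P :: "real ^ 3 ^ 3" where P: "transpose P ** g d m ** P = ?D"
    using assms unfolding lorentzian_3_manifold_def lorentzian_metric_def by blast
  have "det ?D \<noteq> 0"
    by (subst det_diagonal) (auto)
  then have "det (g d m) \<noteq> 0"
    unfolding P[symmetric] det_mul by simp
  then have "invertible (g d m)" by (simp add: invertible_det_nz)
  then have I: "g d m ** matrix_inv (g d m) = mat 1" unfolding invertible_def matrix_inv_def by (rule someI2_ex) blast
  define w where "w = (\<chi> l. (metric_deriv g d m i j l + metric_deriv g d m j i l
      - metric_deriv g d m l i j) / 2)"
  have c: "christoffel g d m k i j = (matrix_inv (g d m) *v w) $ k" for k
    by (simp add: christoffel_def w_def matrix_vector_mult_def sum_divide_distrib)
  have "(\<Sum>k\<in>UNIV. g d m $ r $ k * christoffel g d m k i j) = (g d m *v (matrix_inv (g d m) *v w)) $ r"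
    unfolding c by (simp add: matrix_vector_mult_def)
  also have "\<dots> = w $ r" using I by (simp add: matrix_vector_mul_assoc)
  finally show ?thesis by (simp add: w_def)
qed

lemma christoffel_metric:
  assumes "lorentzian_3_manifold M g" "d \<in> atlas M" "m \<in> dom_of d"
  shows "metric_deriv g d m l i j =
    (\<Sum>k\<in>UNIV. g d m $ j $ k * christoffel g d m k l i) +
    (\<Sum>k\<in>UNIV. g d m $ i $ k * christoffel g d m k l j)"
  unfolding christoffel_lower[OF assms]
  using metric_deriv_sym[OF assms, of l i j] metric_deriv_sym[OF assms, of j i l]
    metric_deriv_sym[OF assms, of i j l] metric_deriv_sym[OF assms, of j l i]
  metric_deriv_sym[OF assms, of i l j] by (simp add: field_simps)

text \<open>Levi-Civita covariant derivative along the curve \<open>\<sigma>\<close> of the vector field along \<open>\<sigma>\<close> whose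
  components in the chart \<open>d\<close> are \<open>V\<close>.\<close>

definition cov_deriv ::
  "'m tensor2 \<Rightarrow> ('m, 3) chart \<Rightarrow> (real \<Rightarrow> 'm) \<Rightarrow> (real \<Rightarrow> real ^ 3) \<Rightarrow> real \<Rightarrow> real ^ 3" where
  "cov_deriv g d \<sigma> V t =
     (\<chi> k. vector_derivative V (at t) $ k +
        (\<Sum>i\<in>UNIV. \<Sum>j\<in>UNIV. christoffel g d (\<sigma> t) k i j *
           vector_derivative (coord d \<circ> \<sigma>) (at t) $ i * V t $ j))"


section \<open>Surfaces and their lightlike points\<close>

definition differential ::
  "('s \<Rightarrow> 'm) \<Rightarrow> ('s, 2) chart \<Rightarrow> ('m, 3) chart \<Rightarrow> 's \<Rightarrow> real ^ 2 \<Rightarrow> real ^ 3" where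
  "differential f c d q = frechet_derivative (coord d \<circ> f \<circ> param c) (at (coord c q))"

definition smooth_immersion :: "('s, 2) mfd \<Rightarrow> ('m, 3) mfd \<Rightarrow> ('s \<Rightarrow> 'm) \<Rightarrow> bool" where
  "smooth_immersion S M f \<longleftrightarrow>
     continuous_map (top_of S) (top_of M) f \<and>
     (\<forall>c\<in>atlas S. \<forall>d\<in>atlas M.
        smooth_on (coord c ` {q \<in> dom_of c. f q \<in> dom_of d}) (coord d \<circ> f \<circ> param c) \<and>
        (\<forall>q\<in>dom_of c. f q \<in> dom_of d \<longrightarrow> inj (differential f c d q)))"

definition surface :: "('s, 2) mfd \<Rightarrow> ('m, 3) mfd \<Rightarrow> ('s \<Rightarrow> 'm) \<Rightarrow> bool" where
  "surface S M f \<longleftrightarrow>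
     smooth_manifold S \<and> connected_space (top_of S) \<and> smooth_immersion S M f"

text \<open>The first fundamental form in the chart \<open>c\<close> of the surface. By the transformation law of the
  metric the chart of the ambient manifold used to compute it is immaterial
  (\<open>ds2_chart_independent\<close>).\<close>

definition ds2 ::
  "('m, 3) mfd \<Rightarrow> 'm tensor2 \<Rightarrow> ('s \<Rightarrow> 'm) \<Rightarrow> ('s, 2) chart \<Rightarrow> 's \<Rightarrow> real ^ 2 \<Rightarrow> real ^ 2 \<Rightarrow> real" where
  "ds2 M g f c q v w =
     (let d = (SOME d. chart_at M (f q) d)
      in pairing g d (f q) (differential f c d q v) (differential f c d q w))"

lemma pairing_change:
  assumes "transpose J ** A ** J = (B :: real ^ 3 ^ 3)"
  shows "v \<bullet> (B *v w) = (J *v v) \<bullet> (A *v (J *v w))"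
proof -
  have "v \<bullet> (B *v w) = v \<bullet> (transpose J *v (A *v (J *v w)))"
    by (simp add: assms[symmetric] matrix_vector_mul_assoc matrix_mul_assoc)
  also have "\<dots> = (J *v v) \<bullet> (A *v (J *v w))"
    by (metis dot_lmul_matrix vector_transpose_matrix transpose_transpose)
  finally show ?thesis .
qed

lemma ds2_chart_independent:
  assumes "lorentzian_3_manifold M g" "surface S M f" "chart_at S q c" "chart_at M (f q) d"
  shows "ds2 M g f c q v w = pairing g d (f q) (differential f c d q v) (differential f c d q w)"
proof -
  have main: "pairing g d (f q) (differential f c d q v) (differential f c d q w) =
    pairing g d' (f q) (differential f c d' q v) (differential f c d' q w)"
    if d: "chart_at M (f q) d" and d': "chart_at M (f q) d'" for d d'
  proof -
    have dA: "d \<in> atlas M" "d' \<in> atlas M" "c \<in> atlas S" "f q \<in> dom_of d" "f q \<in> dom_of d'" "q \<in> dom_of c"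
      using d d' assms(3) by (auto simp: chart_at_def)
    let ?x = "coord c q"
    let ?T = "coord c ` {q \<in> dom_of c. f q \<in> dom_of d \<inter> dom_of d'}"
    have S: "smooth_manifold S" and M: "smooth_manifold M" and F: "smooth_immersion S M f"
      using assms by (auto simp: surface_def lorentzian_3_manifold_def)
    have injd: "inj_on (coord e) (dom_of e)" if "e \<in> atlas M" for e
    proof -
      have h: "homeomorphic_map (subtopology (top_of M) (dom_of e)) (top_of_set (coord e ` dom_of e)) (coord e)"
        and o: "openin (top_of M) (dom_of e)"
        using M that by (auto simp: smooth_manifold_def)
      show ?thesis using homeomorphic_imp_injective_map[OF h] openin_subset[OF o]
        by (simp add: inf.absorb2)
    qed
    have homc: "homeomorphic_map (subtopology (top_of S) (dom_of c)) (top_of_set (coord c ` dom_of c)) (coord c)"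
      and oc: "openin (top_of S) (dom_of c)" and oi: "open (coord c ` dom_of c)"
      using S dA by (auto simp: smooth_manifold_def)
    have injc: "inj_on (coord c) (dom_of c)"
      using homeomorphic_imp_injective_map[OF homc] openin_subset[OF oc] by (simp add: inf.absorb2)
    have pc: "param c (coord c r) = r" if "r \<in> dom_of c" for r
      using injc that by (simp add: param_def)
    have pd: "param d (coord d r) = r" if "r \<in> dom_of d" for r
      using injd[OF dA(1)] that by (simp add: param_def)
    have "openin (top_of M) (dom_of d \<inter> dom_of d')"
      using M dA by (auto simp: smooth_manifold_def intro: openin_Int)
    then have "openin (top_of S) {q \<in> topspace (top_of S). f q \<in> dom_of d \<inter> dom_of d'}"
      using F unfolding smooth_immersion_def by (blast intro: openin_continuous_map_preimage)
    then have "openin (subtopology (top_of S) (dom_of c)) {q \<in> dom_of c. f q \<in> dom_of d \<inter> dom_of d'}"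
      unfolding openin_subtopology using openin_subset[OF oc] by blast
    then have "openin (top_of_set (coord c ` dom_of c)) ?T"
      using homc homeomorphic_map_openness_eq by blast
    then have oT: "open ?T" using oi openin_open_trans by blast
    have xT: "?x \<in> ?T" using dA by auto
    have D: "(coord d \<circ> f \<circ> param c) differentiable (at ?x)"
      using F dA by (auto simp: smooth_immersion_def intro!: C1_differentiable)
    have "(coord d' \<circ> param d) differentiable (at (coord d (f q)))"
      using M dA by (auto simp: smooth_manifold_def intro!: C1_differentiable)
    then have E: "(coord d' \<circ> param d) differentiable (at ((coord d \<circ> f \<circ> param c) ?x))"
      using dA by (simp add: pc)
    let ?J = "frechet_derivative (coord d' \<circ> param d) (at (coord d (f q)))"
    have "differential f c d' q = frechet_derivative ((coord d' \<circ> param d) \<circ> (coord d \<circ> f \<circ> param c)) (at ?x)"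
      unfolding differential_def
      by (rule frechet_derivative_cong_open[OF oT xT]) (auto simp: pc pd)
    also have "\<dots> = ?J \<circ> differential f c d q"
      using frechet_derivative_compose[OF D E] dA by (simp add: differential_def pc comp_def)
    finally have chain: "differential f c d' q = ?J \<circ> differential f c d q" .
    have lin: "linear ?J" using E dA by (simp add: pc linear_frechet_derivative)
    have "g d (f q) = transpose (matrix ?J) ** g d' (f q) ** matrix ?J"
      using assms(1) dA unfolding lorentzian_3_manifold_def lorentzian_metric_def Let_def by blast
    from pairing_change[OF this[symmetric]] show ?thesis
      unfolding pairing_def chain using lin by (simp add: matrix_works)
  qed
  show ?thesis unfolding ds2_def Let_def
    using main[OF assms(4) someI[of "chart_at M (f q)", OF assms(4)]] by simp
qed

definition spacelike_points ::
  "('s, 2) mfd \<Rightarrow> ('m, 3) mfd \<Rightarrow> 'm tensor2 \<Rightarrow> ('s \<Rightarrow> 'm) \<Rightarrow> 's set" where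
  "spacelike_points S M g f =
     {q. \<exists>c. chart_at S q c \<and> (\<forall>v. v \<noteq> 0 \<longrightarrow> ds2 M g f c q v v > 0)}"

definition null_vector ::
  "('m, 3) mfd \<Rightarrow> 'm tensor2 \<Rightarrow> ('s \<Rightarrow> 'm) \<Rightarrow> ('s, 2) chart \<Rightarrow> 's \<Rightarrow> real ^ 2 \<Rightarrow> bool" where
  "null_vector M g f c q v \<longleftrightarrow> v \<noteq> 0 \<and> (\<forall>w. ds2 M g f c q v w = 0)"

definition timelike_points ::
  "('s, 2) mfd \<Rightarrow> ('m, 3) mfd \<Rightarrow> 'm tensor2 \<Rightarrow> ('s \<Rightarrow> 'm) \<Rightarrow> 's set" where
  "timelike_points S M g f =
     {q. \<exists>c. chart_at S q c \<and> \<not> (\<exists>v. null_vector M g f c q v) \<and>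
        (\<exists>v. ds2 M g f c q v v > 0) \<and> (\<exists>v. ds2 M g f c q v v < 0)}"

definition lightlike_points ::
  "('s, 2) mfd \<Rightarrow> ('m, 3) mfd \<Rightarrow> 'm tensor2 \<Rightarrow> ('s \<Rightarrow> 'm) \<Rightarrow> 's set" where
  "lightlike_points S M g f = {q. \<exists>c. chart_at S q c \<and> (\<exists>v. null_vector M g f c q v)}"

definition mixed_type ::
  "('s, 2) mfd \<Rightarrow> ('m, 3) mfd \<Rightarrow> 'm tensor2 \<Rightarrow> ('s \<Rightarrow> 'm) \<Rightarrow> bool" where
  "mixed_type S M g f \<longleftrightarrow> spacelike_points S M g f \<noteq> {} \<and> timelike_points S M g f \<noteq> {}"

definition discriminant ::
  "('m, 3) mfd \<Rightarrow> 'm tensor2 \<Rightarrow> ('s \<Rightarrow> 'm) \<Rightarrow> ('s, 2) chart \<Rightarrow> 's \<Rightarrow> real" where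
  "discriminant M g f c q =
     (let E = ds2 M g f c q (axis 1 1) (axis 1 1);
          F = ds2 M g f c q (axis 1 1) (axis 2 1);
          G = ds2 M g f c q (axis 2 1) (axis 2 1)
      in E * G - F\<^sup>2)"

definition nondegenerate_lightlike_point ::
  "('s, 2) mfd \<Rightarrow> ('m, 3) mfd \<Rightarrow> 'm tensor2 \<Rightarrow> ('s \<Rightarrow> 'm) \<Rightarrow> 's \<Rightarrow> bool" where
  "nondegenerate_lightlike_point S M g f p \<longleftrightarrow>
     p \<in> lightlike_points S M g f \<and>
     (\<exists>c. chart_at S p c \<and>
        frechet_derivative (\<lambda>x. discriminant M g f c (param c x)) (at (coord c p)) \<noteq> (\<lambda>v. 0))"


section \<open>Points of the first and second kind\<close>

text \<open>All the objects below are local, and are described inside a chart \<open>c\<close> around the point. Vectors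
  tangent to the surface are given by their components in this chart, so the velocity of a curve
  \<open>\<gamma>\<close> is the derivative of \<open>coord c \<circ> \<gamma>\<close>.\<close>

definition characteristic_curve ::
  "('s, 2) mfd \<Rightarrow> ('m, 3) mfd \<Rightarrow> 'm tensor2 \<Rightarrow> ('s \<Rightarrow> 'm) \<Rightarrow> ('s, 2) chart \<Rightarrow> 's \<Rightarrow>
   real \<Rightarrow> real \<Rightarrow> (real \<Rightarrow> 's) \<Rightarrow> bool" where
  "characteristic_curve S M g f c p a b \<gamma> \<longleftrightarrow>
     a < 0 \<and> 0 < b \<and> \<gamma> 0 = p \<and> \<gamma> ` {a<..<b} \<subseteq> dom_of c \<and>
     smooth_on {a<..<b} (coord c \<circ> \<gamma>) \<and>
     (\<forall>t\<in>{a<..<b}. vector_derivative (coord c \<circ> \<gamma>) (at t) \<noteq> 0) \<and>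
     (\<exists>W. openin (top_of S) W \<and> p \<in> W \<and> lightlike_points S M g f \<inter> W = \<gamma> ` {a<..<b})"

definition null_vector_field ::
  "('s, 2) mfd \<Rightarrow> ('m, 3) mfd \<Rightarrow> 'm tensor2 \<Rightarrow> ('s \<Rightarrow> 'm) \<Rightarrow> ('s, 2) chart \<Rightarrow> 's set \<Rightarrow>
   ('s \<Rightarrow> real ^ 2) \<Rightarrow> bool" where
  "null_vector_field S M g f c U \<eta> \<longleftrightarrow>
     openin (top_of S) U \<and> U \<subseteq> dom_of c \<and> smooth_on (coord c ` U) (\<eta> \<circ> param c) \<and>
     (\<forall>q \<in> lightlike_points S M g f \<inter> U. null_vector M g f c q (\<eta> q))"

text \<open>\<open>char_data S M g f p c \<gamma> \<eta>\<close>: near \<open>p\<close>, \<open>\<gamma>\<close> is a characteristic curve with \<open>\<gamma> 0 = p\<close>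
  and \<open>\<eta>\<close> is a null vector field.\<close>

definition char_data ::
  "('s, 2) mfd \<Rightarrow> ('m, 3) mfd \<Rightarrow> 'm tensor2 \<Rightarrow> ('s \<Rightarrow> 'm) \<Rightarrow> 's \<Rightarrow> ('s, 2) chart \<Rightarrow>
   (real \<Rightarrow> 's) \<Rightarrow> ('s \<Rightarrow> real ^ 2) \<Rightarrow> bool" where
  "char_data S M g f p c \<gamma> \<eta> \<longleftrightarrow>
     chart_at S p c \<and> (\<exists>a b. characteristic_curve S M g f c p a b \<gamma>) \<and>
     (\<exists>U. p \<in> U \<and> null_vector_field S M g f c U \<eta>)"

definition lin_dependent :: "real ^ 2 \<Rightarrow> real ^ 2 \<Rightarrow> bool" where
  "lin_dependent v w \<longleftrightarrow> (\<exists>\<alpha> \<beta>. (\<alpha>, \<beta>) \<noteq> (0, 0) \<and> \<alpha> *\<^sub>R v + \<beta> *\<^sub>R w = 0)"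

definition first_kind ::
  "('s, 2) mfd \<Rightarrow> ('m, 3) mfd \<Rightarrow> 'm tensor2 \<Rightarrow> ('s \<Rightarrow> 'm) \<Rightarrow> 's \<Rightarrow> bool" where
  "first_kind S M g f p \<longleftrightarrow>
     nondegenerate_lightlike_point S M g f p \<and>
     (\<exists>c \<gamma> \<eta>. char_data S M g f p c \<gamma> \<eta> \<and>
        \<not> lin_dependent (vector_derivative (coord c \<circ> \<gamma>) (at 0)) (\<eta> p))"

definition second_kind ::
  "('s, 2) mfd \<Rightarrow> ('m, 3) mfd \<Rightarrow> 'm tensor2 \<Rightarrow> ('s \<Rightarrow> 'm) \<Rightarrow> 's \<Rightarrow> bool" where
  "second_kind S M g f p \<longleftrightarrow>
     nondegenerate_lightlike_point S M g f p \<and>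
     (\<exists>c \<gamma> \<eta>. char_data S M g f p c \<gamma> \<eta> \<and>
        lin_dependent (vector_derivative (coord c \<circ> \<gamma>) (at 0)) (\<eta> p))"

definition admissible_second_kind ::
  "('s, 2) mfd \<Rightarrow> ('m, 3) mfd \<Rightarrow> 'm tensor2 \<Rightarrow> ('s \<Rightarrow> 'm) \<Rightarrow> 's \<Rightarrow> bool" where
  "admissible_second_kind S M g f p \<longleftrightarrow>
     second_kind S M g f p \<and>
     (\<forall>W. openin (top_of S) W \<and> p \<in> W \<longrightarrow> (\<exists>q\<in>W. first_kind S M g f q))"

definition char_delta ::
  "('s, 2) chart \<Rightarrow> (real \<Rightarrow> 's) \<Rightarrow> ('s \<Rightarrow> real ^ 2) \<Rightarrow> real \<Rightarrow> real" where
  "char_delta c \<gamma> \<eta> t =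
     det (transpose (vector [vector_derivative (coord c \<circ> \<gamma>) (at t), \<eta> (\<gamma> t)] :: real ^ 2 ^ 2))"

definition L3_point ::
  "('s, 2) mfd \<Rightarrow> ('m, 3) mfd \<Rightarrow> 'm tensor2 \<Rightarrow> ('s \<Rightarrow> 'm) \<Rightarrow> 's \<Rightarrow> bool" where
  "L3_point S M g f p \<longleftrightarrow>
     nondegenerate_lightlike_point S M g f p \<and>
     (\<exists>c \<gamma> \<eta>. char_data S M g f p c \<gamma> \<eta> \<and>
        char_delta c \<gamma> \<eta> 0 = 0 \<and> deriv (char_delta c \<gamma> \<eta>) 0 \<noteq> 0)"


section \<open>Lightlike geodesic torsion\<close>

definition normalized_null_vector_field ::
  "('s, 2) mfd \<Rightarrow> ('m, 3) mfd \<Rightarrow> 'm tensor2 \<Rightarrow> ('s \<Rightarrow> 'm) \<Rightarrow> ('s, 2) chart \<Rightarrow> 's set \<Rightarrow>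
   ('s \<Rightarrow> real ^ 2) \<Rightarrow> bool" where
  "normalized_null_vector_field S M g f c U \<eta> \<longleftrightarrow>
     null_vector_field S M g f c U \<eta> \<and>
     (\<forall>q \<in> lightlike_points S M g f \<inter> U.
        frechet_derivative (\<lambda>x. ds2 M g f c (param c x) (\<eta> (param c x)) (\<eta> (param c x)))
          (at (coord c q)) (\<eta> q) = 1)"

text \<open>\<open>k\<close> is a value of the lightlike geodesic torsion at \<open>q\<close>. Since \<open>\<gamma>\<close> may be traversed in either
  direction, this value is only determined up to sign, which is why it is given as a relation.\<close>

definition lightlike_geodesic_torsion ::
  "('s, 2) mfd \<Rightarrow> ('m, 3) mfd \<Rightarrow> 'm tensor2 \<Rightarrow> ('s \<Rightarrow> 'm) \<Rightarrow> 's \<Rightarrow> real \<Rightarrow> bool" where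
  "lightlike_geodesic_torsion S M g f q k \<longleftrightarrow>
     first_kind S M g f q \<and>
     (\<exists>c d a b \<gamma> U \<eta> N.
        chart_at S q c \<and> chart_at M (f q) d \<and> f ` U \<subseteq> dom_of d \<and>
        characteristic_curve S M g f c q a b \<gamma> \<and> \<gamma> ` {a<..<b} \<subseteq> U \<and>
        normalized_null_vector_field S M g f c U \<eta> \<and>
        smooth_on {a<..<b} N \<and>
        (let e = (\<lambda>t. vector_derivative (coord d \<circ> (f \<circ> \<gamma>)) (at t));
             L = (\<lambda>t. differential f c d (\<gamma> t) (\<eta> (\<gamma> t)));
             ip = (\<lambda>t. pairing g d (f (\<gamma> t)))
         in (\<forall>t\<in>{a<..<b}.
               ip t (e t) (e t) = 1 \<and>
               ip t (N t) (e t) = 0 \<and> ip t (N t) (N t) = 0 \<and> ip t (N t) (L t) = 1) \<and>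
            k = ip 0 (L 0) (cov_deriv g d (f \<circ> \<gamma>) N 0)))"

definition torsion_unbounded_at ::
  "('s, 2) mfd \<Rightarrow> ('m, 3) mfd \<Rightarrow> 'm tensor2 \<Rightarrow> ('s \<Rightarrow> 'm) \<Rightarrow> 's \<Rightarrow> bool" where
  "torsion_unbounded_at S M g f p \<longleftrightarrow>
     (\<forall>W. openin (top_of S) W \<and> p \<in> W \<longrightarrow>
        \<not> bounded {k. \<exists>q\<in>W. first_kind S M g f q \<and> lightlike_geodesic_torsion S M g f q k})"

end

theory Submission
  imports Defs
begin

text \<open>
Write \<open>y\<close> for the characteristic curve \<open>\<gamma>\<close> in a chart, let \<open>\<zeta>\<close> be the null field \<open>\<eta>\<close> turned by a right angle,
let \<open>H\<close> and \<open>Z\<close> be the images of \<open>\<eta>\<close> and \<open>\<zeta>\<close> in the ambient manifold, and decompose the velocity as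
\<open>y' = ca \<zeta> + cb \<eta>\<close>. Up to a positive factor \<open>ca\<close> is the function \<open>\<delta>\<close> of the definition of \<open>L\<^sub>3\<close>-points, so the
points of the second kind on the curve are the zeros of \<open>ca\<close>, and the hypotheses on \<open>p\<close> say that \<open>ca\<close> vanishes
to at least second order at \<open>0\<close> but has nonzero values arbitrarily close to \<open>0\<close>.

Put \<open>\<mu> = <\<eta>,\<eta>>\<close>, \<open>\<theta> = \<zeta>\<mu>\<close>, \<open>\<beta> = \<eta>\<mu>\<close> and \<open>r = <Z,Z>\<close>. As \<open>\<mu>\<close> vanishes along the curve, \<open>ca \<theta> + cb \<beta> = 0\<close>. At \<open>p\<close>
both \<open>cb\<close> and \<open>\<theta>\<close> are nonzero, the latter by nondegeneracy. The normalized null vector is \<open>L = \<nu> H\<close> with \<open>\<nu>\<^sup>3 \<beta> = 1\<close>, the speed of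
\<open>f \<circ> \<gamma>\<close> is \<open>\<bar>ca\<bar> sqrt r\<close>, and differentiating \<open><N,L> = 1\<close> gives \<open>\<kappa> = <L, \<nabla>N> = - <\<nabla>L, N>\<close>. Since \<open><\<nabla>L, L> = 0\<close>, \<open>N\<close>
matters only up to multiples of \<open>L\<close>; with the unit tangent \<open>e\<close> and a constant vector \<open>K\<close> such that \<open><K,H> \<noteq> 0\<close> it is then
\<open>(K - <K,e> e) / <K,L>\<close>. At a point of the first kind with parameter \<open>t\<close> this yields
\<open>- \<kappa> \<cdot> ca \<cdot> \<bar>ca\<bar> sqrt r = Q t\<close>, where \<open>Q t\<close> is
\<open>ca <\<nabla>H,K> / <K,H> - (ca <K,Z> / <K,H> + cb) <\<nabla>H,Z> / r - ca' / 3 - ca \<theta>' / (3\<theta>) + ca cb' / (3 cb)\<close>;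
the last three terms come from the logarithmic derivative of \<open>\<nu>\<close> (\<open>torsion_at_first_kind\<close>).

The function \<open>Q\<close> is continuous at \<open>0\<close>. There \<open>ca = ca' = 0\<close>, so only the term with \<open><\<nabla>H,Z>\<close> survives, and
\<open><\<nabla>H,Z> = - cb \<theta> / 2\<close> where the velocity is proportional to \<open>\<eta>\<close> (\<open>P_Z_at_second_kind\<close>: the connection is metric and
torsion-free). Hence \<open>Q 0 = cb\<^sup>2 \<theta> / (2r) \<noteq> 0\<close> while the factor \<open>ca \<cdot> \<bar>ca\<bar> sqrt r\<close> of \<open>\<kappa>\<close> tends to \<open>0\<close>, and \<open>\<kappa>\<close> is unbounded
(\<open>torsion_unbounded\<close>). At an \<open>L\<^sub>3\<close>-point the term \<open>ca' / 3\<close> could cancel the other one.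

What remains is to relate the local objects at different points. Kinds, nondegeneracy and the torsion at a point
are defined through some chart, curve and null field there, whereas the computation uses those given at \<open>p\<close>.
The link is the Gram determinant of \<open>\<zeta>\<close> and \<open>\<eta>\<close>: it shows that at lightlike points \<open>d\<lambda>\<close>, in any chart, is a nonzero multiple
of \<open>d\<mu>\<close> (\<open>discriminant_derivative\<close>). Consequently \<open>d\<mu>\<close> does not vanish at \<open>p\<close>, the lightlike points near \<open>\<gamma> t\<close> form an arc of \<open>\<gamma>\<close> for all small \<open>t\<close>
(\<open>zero_set_locally_arc\<close>), and \<open>\<beta> \<noteq> 0\<close> at points of the first kind (\<open>first_kind_\<beta>\<close>).
\<close>


section \<open>Calculus of smooth maps\<close>

lemma C_k_on_cong:
  assumes "open S" "\<And>x. x \<in> S \<Longrightarrow> F x = G x"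
  shows "C_k_on k F S \<longleftrightarrow> C_k_on k G S"
  using assms(2)
proof (induction k arbitrary: F G)
  case 0
  then show ?case by (simp cong: continuous_on_cong)
next
  case (Suc k)
  have d: "F differentiable (at x) \<longleftrightarrow> G differentiable (at x)" if "x \<in> S" for x
    using that Suc.prems assms(1) unfolding differentiable_def
    by (metis has_derivative_transform_within_open)
  have e: "C_k_on k (\<lambda>x. frechet_derivative F (at x) v) S \<longleftrightarrow>
      C_k_on k (\<lambda>x. frechet_derivative G (at x) v) S" for v
    by (rule Suc.IH) (simp add: frechet_derivative_cong_open[OF assms(1) _ Suc.prems])
  show ?case using d e by simp
qed

lemma smooth_on_cong:
  assumes "open S" "\<And>x. x \<in> S \<Longrightarrow> F x = G x"
  shows "smooth_on S F \<longleftrightarrow> smooth_on S G"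
  unfolding smooth_on_def using C_k_on_cong[of S F G] assms by blast

lemma C_k_on_subset: "C_k_on k F S \<Longrightarrow> T \<subseteq> S \<Longrightarrow> C_k_on k F T"
  by (induction k arbitrary: F) (auto intro: continuous_on_subset)

lemma smooth_on_subset: "smooth_on S F \<Longrightarrow> T \<subseteq> S \<Longrightarrow> smooth_on T F"
  unfolding smooth_on_def using C_k_on_subset by blast

lemma C_k_on_SucD: "C_k_on (Suc k) F S \<Longrightarrow> C_k_on k F S"
proof (induction k arbitrary: F)
  case 0
  then show ?case
    by (auto intro!: differentiable_imp_continuous_on differentiable_at_imp_differentiable_on)
next
  case (Suc k)
  from Suc.prems have "\<forall>x\<in>S. F differentiable (at x)"
    and "\<And>v. C_k_on (Suc k) (\<lambda>x. frechet_derivative F (at x) v) S"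
    by simp_all
  then show ?case using Suc.IH by simp
qed

lemma C_k_on_const: "C_k_on k (\<lambda>x. c) S"
  by (induction k arbitrary: c) auto

lemma C_k_on_bounded_linear:
  assumes "bounded_linear L" "open S"
  shows "C_k_on k F S \<Longrightarrow> C_k_on k (\<lambda>x. L (F x)) S"
proof (induction k arbitrary: F)
  case 0
  then show ?case using assms(1)
    by (simp add: bounded_linear.continuous_on)
next
  case (Suc k)
  have d: "((\<lambda>x. L (F x)) has_derivative (\<lambda>v. L (frechet_derivative F (at x) v))) (at x)"
    if "x \<in> S" for x
    using Suc.prems that
    by (auto intro!: bounded_linear.has_derivative[OF assms(1)] simp: frechet_derivative_works[symmetric])
  have "frechet_derivative (\<lambda>x. L (F x)) (at x) = (\<lambda>v. L (frechet_derivative F (at x) v))"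
    if "x \<in> S" for x
    by (rule frechet_derivative_at[OF d, symmetric]) (rule that)
  moreover have "C_k_on k (\<lambda>x. L (frechet_derivative F (at x) v)) S" for v
    using Suc by simp
  ultimately have "C_k_on k (\<lambda>x. frechet_derivative (\<lambda>x. L (F x)) (at x) v) S" for v
    by (subst C_k_on_cong[OF assms(2)]) auto
  then show ?case using d by (auto simp: differentiable_def)
qed

lemma C_k_on_add:
  assumes "open S"
  shows "C_k_on k F S \<Longrightarrow> C_k_on k G S \<Longrightarrow> C_k_on k (\<lambda>x. F x + G x) S"
proof (induction k arbitrary: F G)
  case 0
  then show ?case by (simp add: continuous_on_add)
next
  case (Suc k)
  have d: "((\<lambda>x. F x + G x) has_derivative
      (\<lambda>v. frechet_derivative F (at x) v + frechet_derivative G (at x) v)) (at x)"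
    if "x \<in> S" for x
    using Suc.prems that
    by (auto intro!: has_derivative_add simp: frechet_derivative_works[symmetric])
  have "frechet_derivative (\<lambda>x. F x + G x) (at x) =
      (\<lambda>v. frechet_derivative F (at x) v + frechet_derivative G (at x) v)" if "x \<in> S" for x
    by (rule frechet_derivative_at[OF d, symmetric]) (rule that)
  moreover have "C_k_on k (\<lambda>x. frechet_derivative F (at x) v + frechet_derivative G (at x) v) S" for v
    using Suc by simp
  ultimately have "C_k_on k (\<lambda>x. frechet_derivative (\<lambda>x. F x + G x) (at x) v) S" for v
    by (subst C_k_on_cong[OF assms]) auto
  then show ?case using d by (auto simp: differentiable_def)
qed

lemma C_k_on_bilinear:
  assumes "bounded_bilinear B" "open S"
  shows "C_k_on k F S \<Longrightarrow> C_k_on k G S \<Longrightarrow> C_k_on k (\<lambda>x. B (F x) (G x)) S"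
proof (induction k arbitrary: F G)
  case 0
  then show ?case using assms(1) by (simp add: bounded_bilinear.continuous_on)
next
  case (Suc k)
  have d: "((\<lambda>x. B (F x) (G x)) has_derivative
      (\<lambda>v. B (F x) (frechet_derivative G (at x) v) + B (frechet_derivative F (at x) v) (G x))) (at x)"
    if "x \<in> S" for x
    using Suc.prems that
    by (auto intro!: bounded_bilinear.FDERIV[OF assms(1)] simp: frechet_derivative_works[symmetric])
  have "frechet_derivative (\<lambda>x. B (F x) (G x)) (at x) =
      (\<lambda>v. B (F x) (frechet_derivative G (at x) v) + B (frechet_derivative F (at x) v) (G x))"
    if "x \<in> S" for x
    by (rule frechet_derivative_at[OF d, symmetric]) (rule that)
  moreover have "C_k_on k (\<lambda>x. B (F x) (frechet_derivative G (at x) v)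
      + B (frechet_derivative F (at x) v) (G x)) S" for v
    using Suc.prems C_k_on_SucD[OF Suc.prems(1)] C_k_on_SucD[OF Suc.prems(2)]
    by (intro C_k_on_add[OF assms(2)] Suc.IH) auto
  ultimately have "C_k_on k (\<lambda>x. frechet_derivative (\<lambda>x. B (F x) (G x)) (at x) v) S" for v
    by (subst C_k_on_cong[OF assms(2)]) auto
  then show ?case using d by (auto simp: differentiable_def)
qed

lemma C_k_on_sum:
  assumes "open S" "finite I" "\<And>i. i \<in> I \<Longrightarrow> C_k_on k (F i) S"
  shows "C_k_on k (\<lambda>x. \<Sum>i\<in>I. F i x) S"
  using assms(2,3) by (induction I) (auto intro: C_k_on_const C_k_on_add[OF assms(1)])

text \<open>Expanding a directional derivative along a varying direction in a basis reduces it to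
  derivatives along constant directions, which are all that \<open>C_k_on\<close> speaks about.\<close>

lemma frechet_derivative_basis:
  assumes "F differentiable (at x)"
  shows "frechet_derivative F (at x) v = (\<Sum>b\<in>Basis. (v \<bullet> b) *\<^sub>R frechet_derivative F (at x) b)"
proof -
  have l: "linear (frechet_derivative F (at x))"
    using assms by (rule linear_frechet_derivative)
  have "frechet_derivative F (at x) v =
      frechet_derivative F (at x) (\<Sum>b\<in>Basis. (v \<bullet> b) *\<^sub>R b)"
    by (simp add: euclidean_representation)
  also have "\<dots> = (\<Sum>b\<in>Basis. (v \<bullet> b) *\<^sub>R frechet_derivative F (at x) b)"
    by (simp add: linear_sum[OF l] linear_cmul[OF l])
  finally show ?thesis .
qed

lemma C_k_on_frechet_derivative:
  assumes "open S" "C_k_on (Suc k) F S" "C_k_on k V S"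
  shows "C_k_on k (\<lambda>x. frechet_derivative F (at x) (V x)) S"
proof -
  have "C_k_on k (\<lambda>x. \<Sum>b\<in>Basis. (V x \<bullet> b) *\<^sub>R frechet_derivative F (at x) b) S"
    using assms
    by (intro C_k_on_sum C_k_on_bilinear[OF bounded_bilinear_scaleR]
        C_k_on_bounded_linear[OF bounded_linear_inner_left]) auto
  then show ?thesis
    using assms by (subst C_k_on_cong[OF assms(1)]) (auto intro: frechet_derivative_basis)
qed

lemma C_k_on_compose:
  assumes "open S" "open T" "G ` S \<subseteq> T"
  shows "C_k_on k F T \<Longrightarrow> C_k_on k G S \<Longrightarrow> C_k_on k (\<lambda>x. F (G x)) S"
proof (induction k arbitrary: F)
  case 0
  then show ?case using assms(3) by (auto intro: continuous_on_compose2)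
next
  case (Suc k)
  have F: "F differentiable (at (G x))" if "x \<in> S" for x
    using Suc.prems that assms(3) by auto
  have G: "G differentiable (at x)" if "x \<in> S" for x
    using Suc.prems that by auto
  have c: "frechet_derivative (\<lambda>x. F (G x)) (at x) =
      (\<lambda>v. frechet_derivative F (at (G x)) (frechet_derivative G (at x) v))" if "x \<in> S" for x
    using frechet_derivative_compose[OF G F, OF that that] by (simp add: comp_def)
  have "C_k_on k (\<lambda>x. \<Sum>b\<in>Basis.
      (frechet_derivative G (at x) v \<bullet> b) *\<^sub>R frechet_derivative F (at (G x)) b) S" for v
    using Suc.prems C_k_on_SucD[OF Suc.prems(2)]
    by (intro C_k_on_sum C_k_on_bilinear[OF bounded_bilinear_scaleR] assms(1)
        C_k_on_bounded_linear[OF bounded_linear_inner_left] Suc.IH) auto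
  moreover have "(\<Sum>b\<in>Basis.
      (frechet_derivative G (at x) v \<bullet> b) *\<^sub>R frechet_derivative F (at (G x)) b) =
      frechet_derivative (\<lambda>x. F (G x)) (at x) v" if "x \<in> S" for x v
    unfolding c[OF that] frechet_derivative_basis[OF F[OF that],
        of "frechet_derivative G (at x) v"] ..
  ultimately have "C_k_on k (\<lambda>x. frechet_derivative (\<lambda>x. F (G x)) (at x) v) S" for v
    by (rule iffD1[OF C_k_on_cong[OF assms(1)], rotated])
  moreover have "(\<lambda>x. F (G x)) differentiable (at x)" if "x \<in> S" for x
    using differentiable_chain_at[OF G F, OF that that] by (simp add: comp_def)
  ultimately show ?case by simp
qed

lemma smooth_on_const: "smooth_on S (\<lambda>x. c)"
  by (simp add: smooth_on_def C_k_on_const)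

lemma smooth_on_bounded_linear:
  "bounded_linear L \<Longrightarrow> open S \<Longrightarrow> smooth_on S F \<Longrightarrow> smooth_on S (\<lambda>x. L (F x))"
  by (simp add: smooth_on_def C_k_on_bounded_linear)

lemma smooth_on_add: "open S \<Longrightarrow> smooth_on S F \<Longrightarrow> smooth_on S G \<Longrightarrow> smooth_on S (\<lambda>x. F x + G x)"
  by (simp add: smooth_on_def C_k_on_add)

lemma smooth_on_bilinear:
  "bounded_bilinear B \<Longrightarrow> open S \<Longrightarrow> smooth_on S F \<Longrightarrow> smooth_on S G \<Longrightarrow>
    smooth_on S (\<lambda>x. B (F x) (G x))"
  by (simp add: smooth_on_def C_k_on_bilinear)

lemmas smooth_on_scaleR = smooth_on_bilinear[OF bounded_bilinear_scaleR]
lemmas smooth_on_mult = smooth_on_bilinear[OF bounded_bilinear_mult]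
lemmas smooth_on_inner = smooth_on_bilinear[OF bounded_bilinear_inner]

lemma smooth_on_minus: "open S \<Longrightarrow> smooth_on S F \<Longrightarrow> smooth_on S (\<lambda>x. - F x)"
  by (rule smooth_on_bounded_linear[OF bounded_linear_minus[OF bounded_linear_ident]])

lemma smooth_on_diff: "open S \<Longrightarrow> smooth_on S F \<Longrightarrow> smooth_on S G \<Longrightarrow> smooth_on S (\<lambda>x. F x - G x)"
  using smooth_on_add[of S F "\<lambda>x. - G x"] smooth_on_minus[of S G] by simp

lemma bounded_bilinear_matrix_vector:
  "bounded_bilinear ((*v) :: real ^ 'n ^ 'm \<Rightarrow> real ^ 'n \<Rightarrow> real ^ 'm)"
  by (simp add: bilinear_conv_bounded_bilinear[symmetric] bilinear_def linear_iff vec_eq_iff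
      matrix_vector_mult_def algebra_simps sum.distrib sum_distrib_left)

lemmas smooth_on_matrix_vector = smooth_on_bilinear[OF bounded_bilinear_matrix_vector]

lemma smooth_on_compose:
  "open S \<Longrightarrow> open T \<Longrightarrow> G ` S \<subseteq> T \<Longrightarrow> smooth_on T F \<Longrightarrow> smooth_on S G \<Longrightarrow>
    smooth_on S (\<lambda>x. F (G x))"
  by (simp add: smooth_on_def C_k_on_compose)

lemma smooth_on_frechet_derivative:
  "open S \<Longrightarrow> smooth_on S F \<Longrightarrow> smooth_on S V \<Longrightarrow>
    smooth_on S (\<lambda>x. frechet_derivative F (at x) (V x))"
  unfolding smooth_on_def using C_k_on_frechet_derivative by blast

lemma smooth_on_has_derivative:
  "smooth_on S F \<Longrightarrow> x \<in> S \<Longrightarrow> (F has_derivative frechet_derivative F (at x)) (at x)"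
  using C1_differentiable frechet_derivative_works by blast

lemma smooth_on_has_vector_derivative:
  "smooth_on S F \<Longrightarrow> t \<in> S \<Longrightarrow> (F has_vector_derivative vector_derivative F (at t)) (at t)"
  using C1_differentiable vector_derivative_works by blast

lemma smooth_on_continuous_on: "smooth_on S F \<Longrightarrow> continuous_on S F"
  by (metis C_k_on.simps(1) smooth_on_def)

lemma smooth_on_isCont: "smooth_on S F \<Longrightarrow> open S \<Longrightarrow> x \<in> S \<Longrightarrow> isCont F x"
  using smooth_on_continuous_on continuous_on_eq_continuous_at by blast

text \<open>On the line the only direction that matters is \<open>1\<close>, so \<open>C_k_on\<close> can be handled with ordinary
  vector derivatives.\<close>

lemma C_k_on_SucI_real:
  fixes F :: "real \<Rightarrow> 'b::euclidean_space"
  assumes "open S" "\<And>t. t \<in> S \<Longrightarrow> (F has_vector_derivative F' t) (at t)" "C_k_on k F' S"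
  shows "C_k_on (Suc k) F S"
proof -
  have "frechet_derivative F (at t) v = v *\<^sub>R F' t" if "t \<in> S" for t v
    using frechet_derivative_at[OF assms(2)[OF that, unfolded has_vector_derivative_def], symmetric]
    by simp
  moreover have "C_k_on k (\<lambda>t. v *\<^sub>R F' t) S" for v
    by (intro C_k_on_bounded_linear[OF bounded_linear_scaleR_right] assms)
  ultimately have "C_k_on k (\<lambda>t. frechet_derivative F (at t) v) S" for v
    by (subst C_k_on_cong[OF assms(1)]) auto
  then show ?thesis
    using assms(2) by (auto simp: differentiable_def has_vector_derivative_def)
qed

lemma smooth_on_vector_derivative:
  fixes F :: "real \<Rightarrow> 'b::euclidean_space"
  assumes "open S" "smooth_on S F"
  shows "smooth_on S (\<lambda>t. vector_derivative F (at t))"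
proof -
  have "frechet_derivative F (at t) 1 = vector_derivative F (at t)" if "t \<in> S" for t
    using C1_differentiable[OF assms(2) that] by (simp add: frechet_derivative_eq_vector_derivative)
  then show ?thesis
    using smooth_on_frechet_derivative[OF assms smooth_on_const[of S 1]]
    by (subst smooth_on_cong[OF assms(1)]) auto
qed

lemma smooth_on_powr: "smooth_on {0<..} (\<lambda>x::real. x powr r)"
  unfolding smooth_on_def
proof
  fix k
  show "C_k_on k (\<lambda>x::real. x powr r) {0<..}"
  proof (induction k arbitrary: r)
    case 0
    then show ?case by (auto intro!: continuous_intros)
  next
    case (Suc k)
    have "((\<lambda>x. x powr r) has_vector_derivative r * t powr (r - 1)) (at t)" if "t \<in> {0<..}" for t
      using has_real_derivative_powr[of t r] that
      by (simp add: has_real_derivative_iff_has_vector_derivative)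
    moreover have "C_k_on k (\<lambda>t. r * t powr (r - 1)) {0<..}"
      by (intro C_k_on_bounded_linear[OF bounded_linear_mult_right] Suc.IH) simp
    ultimately show ?case by (intro C_k_on_SucI_real) auto
  qed
qed

lemma smooth_on_powr_compose:
  fixes F :: "'a::euclidean_space \<Rightarrow> real"
  assumes "open S" "smooth_on S F" "\<And>x. x \<in> S \<Longrightarrow> F x > 0"
  shows "smooth_on S (\<lambda>x. F x powr r)"
  by (rule smooth_on_compose[OF assms(1) _ _ smooth_on_powr assms(2)]) (use assms(3) in auto)

text \<open>The sign of \<open>G\<close> is immaterial after writing \<open>F / G\<close> as \<open>F G / G\<^sup>2\<close>, a product with a power of a positive
function.\<close>

lemma smooth_on_divide:
  fixes F G :: "'a::euclidean_space \<Rightarrow> real"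
  assumes S: "open S" and F: "smooth_on S F" and G: "smooth_on S G" and nz: "\<And>x. x \<in> S \<Longrightarrow> G x \<noteq> 0"
  shows "smooth_on S (\<lambda>x. F x / G x)"
proof -
  have "smooth_on S (\<lambda>x. (F x * G x) * (G x * G x) powr (-1))"
    using nz by (intro smooth_on_mult smooth_on_powr_compose S F G) (auto simp: zero_less_mult_iff neq_iff)
  then show ?thesis
    using nz by (subst smooth_on_cong[OF S]) (auto simp: powr_minus field_simps)
qed

text \<open>A solution of the differential equation \<open>\<tau>' = \<rho> \<circ> \<tau>\<close> gains one derivative over the right-hand side,
  so it is as smooth as \<open>\<rho>\<close>. Arc length parameters arise in this way.\<close>

lemma smooth_on_autonomous_solution:
  fixes \<tau> \<rho> :: "real \<Rightarrow> real"
  assumes "open I" "open J" "\<tau> ` I \<subseteq> J" "smooth_on J \<rho>"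
    and ode: "\<And>s. s \<in> I \<Longrightarrow> (\<tau> has_vector_derivative \<rho> (\<tau> s)) (at s)"
  shows "smooth_on I \<tau>"
  unfolding smooth_on_def
proof
  fix k
  show "C_k_on k \<tau> I"
  proof (induction k)
    case 0
    show ?case using ode
      by (auto intro!: continuous_at_imp_continuous_on has_vector_derivative_continuous)
  next
    case (Suc k)
    have "C_k_on k (\<lambda>s. \<rho> (\<tau> s)) I"
      by (rule C_k_on_compose[OF assms(1-3)]) (use assms(4) Suc in \<open>simp_all only: smooth_on_def\<close>)
    with assms(1) ode show ?case by (rule C_k_on_SucI_real)
  qed
qed


lemma smooth_on_compose_has_vector_derivative:
  assumes "smooth_on S F" "c t \<in> S" "(c has_vector_derivative c') (at t)"
  shows "((\<lambda>t. F (c t)) has_vector_derivative frechet_derivative F (at (c t)) c') (at t)"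
  using vector_derivative_diff_chain_within[OF assms(3)
      has_derivative_at_withinI[OF smooth_on_has_derivative[OF assms(1,2)]]]
  by (simp add: comp_def)

lemma affine_has_vector_derivative: "((\<lambda>s. p + s *\<^sub>R v) has_vector_derivative v) (at s)"
  using has_derivative_add[OF has_derivative_const has_derivative_scaleR_left[OF has_derivative_ident]]
  by (simp add: has_vector_derivative_def)

abbreviation Dir :: "('a::euclidean_space \<Rightarrow> 'b::euclidean_space) \<Rightarrow> 'a \<Rightarrow> 'a \<Rightarrow> 'b" where
  "Dir F u v \<equiv> frechet_derivative F (at u) v"

lemma smooth_on_sum:
  "open S \<Longrightarrow> finite I \<Longrightarrow> (\<And>i. i \<in> I \<Longrightarrow> smooth_on S (F i)) \<Longrightarrow> smooth_on S (\<lambda>x. \<Sum>i\<in>I. F i x)"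
  by (simp add: smooth_on_def C_k_on_sum)

lemma smooth_on_frechet_derivative_compose:
  assumes "open S" "open T" "G ` S \<subseteq> T" "smooth_on T F" "smooth_on S G" "smooth_on S V"
  shows "smooth_on S (\<lambda>x. Dir F (G x) (V x))"
proof -
  have *: "smooth_on S (\<lambda>x. Dir F (G x) b)" for b
    by (rule smooth_on_compose[OF assms(1-3) _ assms(5)])
      (intro smooth_on_frechet_derivative assms smooth_on_const)
  have "smooth_on S (\<lambda>x. \<Sum>b\<in>Basis. (V x \<bullet> b) *\<^sub>R Dir F (G x) b)"
    by (intro smooth_on_sum smooth_on_scaleR smooth_on_bounded_linear[OF bounded_linear_inner_left]
        assms * finite_Basis)
  moreover have "(\<Sum>b\<in>Basis. (V x \<bullet> b) *\<^sub>R Dir F (G x) b) = Dir F (G x) (V x)" if "x \<in> S" for x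
    by (rule frechet_derivative_basis[symmetric])
      (use that assms(3) in \<open>auto intro: C1_differentiable[OF assms(4)]\<close>)
  ultimately show ?thesis
    using smooth_on_cong[OF assms(1)] by (metis (no_types, lifting))
qed

text \<open>A product rule: the field \<open>V\<close> is differentiated once, the derivative of \<open>F\<close> once more. Both sides are
compared after expanding \<open>V\<close> in the standard basis; the constant field \<open>V u\<close> serves to recognise the second
derivative of \<open>F\<close> in that expansion.\<close>

lemma has_derivative_directional:
  assumes S: "open S" and F: "smooth_on S F" and V: "smooth_on S V" and u: "u \<in> S"
  shows "((\<lambda>x. Dir F x (V x)) has_derivative
    (\<lambda>w. Dir (\<lambda>x. Dir F x (V u)) u w + Dir F u (Dir V u w))) (at u)"
proof -
  define S2 where "S2 c w = (\<Sum>b\<in>Basis. (c \<bullet> b) *\<^sub>R Dir (\<lambda>x. Dir F x b) u w)" for c w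
  have *: "((\<lambda>x. Dir F x (W x)) has_derivative (\<lambda>w. S2 (W u) w + Dir F u (Dir W u w))) (at u)"
    if W: "smooth_on S W" for W
  proof -
    have "((\<lambda>x. (W x \<bullet> b) *\<^sub>R Dir F x b) has_derivative
        (\<lambda>w. (W u \<bullet> b) *\<^sub>R Dir (\<lambda>x. Dir F x b) u w + (Dir W u w \<bullet> b) *\<^sub>R Dir F u b)) (at u)" for b
      by (intro has_derivative_scaleR has_derivative_inner_left smooth_on_has_derivative[OF _ u] W
          smooth_on_frechet_derivative S F smooth_on_const)
    then have "((\<lambda>x. \<Sum>b\<in>Basis. (W x \<bullet> b) *\<^sub>R Dir F x b) has_derivative
        (\<lambda>w. \<Sum>b\<in>Basis. (W u \<bullet> b) *\<^sub>R Dir (\<lambda>x. Dir F x b) u w + (Dir W u w \<bullet> b) *\<^sub>R Dir F u b)) (at u)"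
      by (rule has_derivative_sum)
    moreover have "(\<Sum>b\<in>Basis. (W u \<bullet> b) *\<^sub>R Dir (\<lambda>x. Dir F x b) u w + (Dir W u w \<bullet> b) *\<^sub>R Dir F u b) =
        S2 (W u) w + Dir F u (Dir W u w)" for w
      unfolding S2_def frechet_derivative_basis[OF C1_differentiable[OF F u], of "Dir W u w"]
      by (rule sum.distrib)
    ultimately have "((\<lambda>x. \<Sum>b\<in>Basis. (W x \<bullet> b) *\<^sub>R Dir F x b) has_derivative
        (\<lambda>w. S2 (W u) w + Dir F u (Dir W u w))) (at u)" by simp
    then show ?thesis
      by (rule has_derivative_transform_within_open[OF _ S u])
        (rule frechet_derivative_basis[OF C1_differentiable[OF F], symmetric])
  qed
  have "Dir (\<lambda>x. Dir F x (V u)) u w = S2 (V u) w" for w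
    using frechet_derivative_at[OF *[OF smooth_on_const[of S "V u"]]]
      linear_0[OF linear_frechet_derivative[OF C1_differentiable[OF F u]]] by simp
  then show ?thesis using *[OF V] by simp
qed

lemma locally_constant_has_vector_derivative:
  assumes "open S" "t \<in> S" "\<And>s. s \<in> S \<Longrightarrow> F s = c"
  shows "(F has_vector_derivative 0) (at t)"
  by (rule has_vector_derivative_transform_within_open[OF has_vector_derivative_const[of c] assms(1,2)])
    (simp add: assms(3))


section \<open>Symmetry of second derivatives\<close>

text \<open>The second difference in the directions \<open>v\<close> and \<open>w\<close>, divided by \<open>h\<^sup>2\<close>, tends to the second
  derivative taken first along \<open>v\<close> and then along \<open>w\<close>: two applications of the mean value theorem. As
  the second difference is symmetric in \<open>v\<close> and \<open>w\<close>, so is the second derivative.\<close>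

lemma second_difference_quotient_tendsto:
  fixes F :: "'a::euclidean_space \<Rightarrow> real" and v w :: 'a
  assumes S: "open S" and F: "smooth_on S F" and u: "u \<in> S"
  defines "D \<equiv> \<lambda>h. F (u + h *\<^sub>R v + h *\<^sub>R w) - F (u + h *\<^sub>R v) - F (u + h *\<^sub>R w) + F u"
  shows "((\<lambda>h. D h / h\<^sup>2) \<longlongrightarrow> frechet_derivative (\<lambda>x. frechet_derivative F (at x) v) (at u) w)
    (at_right 0)"
proof (rule tendstoI)
  fix e :: real
  assume e: "e > 0"
  define A where "A x = frechet_derivative F (at x) v" for x
  define B where "B x = frechet_derivative A (at x) w" for x
  have A: "smooth_on S A"
    unfolding A_def by (intro smooth_on_frechet_derivative S F smooth_on_const)
  have B: "smooth_on S B"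
    unfolding B_def by (intro smooth_on_frechet_derivative S A smooth_on_const)
  obtain r1 where r1: "r1 > 0" "ball u r1 \<subseteq> S"
    using S u openE by blast
  obtain r2 where r2: "r2 > 0" "\<And>x. dist x u < r2 \<Longrightarrow> dist (B x) (B u) < e"
    using smooth_on_isCont[OF B S u] e unfolding continuous_at_eps_delta by blast
  define r where "r = min r1 r2"
  have r: "r > 0" "ball u r \<subseteq> S" "\<And>x. x \<in> ball u r \<Longrightarrow> dist (B x) (B u) < e"
    using r1 r2 by (auto simp: r_def dist_commute)
  define d where "d = r / (1 + norm v + norm w)"
  have d: "d > 0" using r by (simp add: d_def add_pos_nonneg)
  have inb: "u + s *\<^sub>R v + t *\<^sub>R w \<in> ball u r" if "0 \<le> s" "s < d" "0 \<le> t" "t < d" for s t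
  proof -
    have "norm (s *\<^sub>R v + t *\<^sub>R w) \<le> s * norm v + t * norm w"
      using that norm_triangle_ineq[of "s *\<^sub>R v" "t *\<^sub>R w"] by simp
    also have "\<dots> \<le> d * norm v + d * norm w"
      using that by (intro add_mono mult_right_mono) auto
    also have "\<dots> < d * (1 + norm v + norm w)"
      using d by (simp add: algebra_simps)
    also have "\<dots> = r" unfolding d_def using add_pos_nonneg[of 1 "norm v + norm w"] by (simp add: add.assoc)
    finally show ?thesis using norm_minus_cancel[of "s *\<^sub>R v + t *\<^sub>R w"] by (simp add: dist_norm algebra_simps)
  qed
  have "dist (D h / h\<^sup>2) (B u) < e" if h: "0 < h" "h < d" for h
  proof -
    have dF: "((\<lambda>s. F (u + s *\<^sub>R v + t *\<^sub>R w)) has_real_derivative A (u + s *\<^sub>R v + t *\<^sub>R w)) (at s)"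
      if st: "0 \<le> s" "s < d" "0 \<le> t" "t < d" for s t
      using smooth_on_compose_has_vector_derivative[OF F _ affine_has_vector_derivative, of "u + t *\<^sub>R w" s v]
        inb[OF st] r(2)
      by (simp add: has_real_derivative_iff_has_vector_derivative A_def add_ac subset_iff)
    have dA: "((\<lambda>t. A (u + s *\<^sub>R v + t *\<^sub>R w)) has_real_derivative B (u + s *\<^sub>R v + t *\<^sub>R w)) (at t)"
      if st: "0 \<le> s" "s < d" "0 \<le> t" "t < d" for s t
      using smooth_on_compose_has_vector_derivative[OF A _ affine_has_vector_derivative, of "u + s *\<^sub>R v" t w]
        inb[OF st] r(2)
      by (simp add: has_real_derivative_iff_has_vector_derivative B_def add_ac subset_iff)
    have "\<exists>s. 0 < s \<and> s < h \<and>
      (F (u + h *\<^sub>R v + h *\<^sub>R w) - F (u + h *\<^sub>R v + 0 *\<^sub>R w)) - (F (u + 0 *\<^sub>R v + h *\<^sub>R w) - F (u + 0 *\<^sub>R v + 0 *\<^sub>R w))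
        = (h - 0) * (A (u + s *\<^sub>R v + h *\<^sub>R w) - A (u + s *\<^sub>R v + 0 *\<^sub>R w))"
      using h by (intro MVT2 DERIV_diff dF) auto
    then obtain s where s: "0 < s" "s < h" and
      1: "D h = h * (A (u + s *\<^sub>R v + h *\<^sub>R w) - A (u + s *\<^sub>R v + 0 *\<^sub>R w))"
      by (auto simp: D_def)
    have "\<exists>t. 0 < t \<and> t < h \<and>
      A (u + s *\<^sub>R v + h *\<^sub>R w) - A (u + s *\<^sub>R v + 0 *\<^sub>R w) = (h - 0) * B (u + s *\<^sub>R v + t *\<^sub>R w)"
      using h s by (intro MVT2 dA) auto
    then obtain t where t: "0 < t" "t < h" and
      2: "A (u + s *\<^sub>R v + h *\<^sub>R w) - A (u + s *\<^sub>R v + 0 *\<^sub>R w) = h * B (u + s *\<^sub>R v + t *\<^sub>R w)"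
      by auto
    have "D h = h * (h * B (u + s *\<^sub>R v + t *\<^sub>R w))"
      using 1 2 by simp
    then have "D h / h\<^sup>2 = B (u + s *\<^sub>R v + t *\<^sub>R w)"
      using h by (simp add: power2_eq_square)
    then show ?thesis using inb[of s t] r(3) s t h by simp
  qed
  then show "\<forall>\<^sub>F h in at_right 0. dist (D h / h\<^sup>2)
      (frechet_derivative (\<lambda>x. frechet_derivative F (at x) v) (at u) w) < e"
    unfolding B_def A_def using d by (auto simp: eventually_at_right_field)
qed

lemma second_derivative_symmetric:
  fixes F :: "'a::euclidean_space \<Rightarrow> 'b::euclidean_space"
  assumes S: "open S" and F: "smooth_on S F" and u: "u \<in> S"
  shows "frechet_derivative (\<lambda>x. frechet_derivative F (at x) v) (at u) w =
    frechet_derivative (\<lambda>x. frechet_derivative F (at x) w) (at u) v"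
proof (rule euclidean_eqI)
  fix b :: 'b
  define f where "f x = F x \<bullet> b" for x
  have f: "smooth_on S f"
    unfolding f_def by (intro smooth_on_bounded_linear[OF bounded_linear_inner_left] S F)
  have c: "frechet_derivative (\<lambda>x. frechet_derivative F (at x) v) (at u) w \<bullet> b =
      frechet_derivative (\<lambda>x. frechet_derivative f (at x) v) (at u) w" for v w
  proof -
    have D: "smooth_on S (\<lambda>x. frechet_derivative F (at x) v)"
      by (intro smooth_on_frechet_derivative S F smooth_on_const)
    have 1: "frechet_derivative F (at x) v \<bullet> b = frechet_derivative f (at x) v" if "x \<in> S" for x
      using frechet_derivative_at[OF has_derivative_inner_left[OF smooth_on_has_derivative[OF F that], of b]]
      unfolding f_def by metis
    have "frechet_derivative (\<lambda>x. frechet_derivative F (at x) v) (at u) w \<bullet> b =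
        frechet_derivative (\<lambda>x. frechet_derivative F (at x) v \<bullet> b) (at u) w"
      using frechet_derivative_at[OF has_derivative_inner_left[OF smooth_on_has_derivative[OF D u], of b]]
      by metis
    also have "\<dots> = frechet_derivative (\<lambda>x. frechet_derivative f (at x) v) (at u) w"
      by (rule fun_cong[OF frechet_derivative_cong_open[OF S u 1]])
    finally show ?thesis .
  qed
  have "frechet_derivative (\<lambda>x. frechet_derivative f (at x) v) (at u) w =
      frechet_derivative (\<lambda>x. frechet_derivative f (at x) w) (at u) v"
  proof (rule tendsto_unique[OF _ second_difference_quotient_tendsto[OF S f u]])
    have "f (u + h *\<^sub>R v + h *\<^sub>R w) - f (u + h *\<^sub>R v) - f (u + h *\<^sub>R w) + f u =
        f (u + h *\<^sub>R w + h *\<^sub>R v) - f (u + h *\<^sub>R w) - f (u + h *\<^sub>R v) + f u" for h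
      by (simp add: algebra_simps)
    then show "((\<lambda>h. (f (u + h *\<^sub>R v + h *\<^sub>R w) - f (u + h *\<^sub>R v) - f (u + h *\<^sub>R w) + f u) / h\<^sup>2)
      \<longlongrightarrow> frechet_derivative (\<lambda>x. frechet_derivative f (at x) w) (at u) v) (at_right 0)"
      by (simp only:) (rule second_difference_quotient_tendsto[OF S f u])
  qed simp
  then show "frechet_derivative (\<lambda>x. frechet_derivative F (at x) v) (at u) w \<bullet> b =
    frechet_derivative (\<lambda>x. frechet_derivative F (at x) w) (at u) v \<bullet> b"
    by (simp add: c)
qed


section \<open>Regular curves in zero sets\<close>

lemma parallel_if_orthogonal_to_same:
  fixes k n x :: "real ^ 2"
  assumes "k \<noteq> 0" "n \<noteq> 0" "n \<bullet> k = 0" "x \<bullet> k = 0"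
  shows "\<exists>c. x = c *\<^sub>R n"
proof -
  have k: "k $ 1 \<noteq> 0 \<or> k $ 2 \<noteq> 0" and n: "n $ 1 \<noteq> 0 \<or> n $ 2 \<noteq> 0"
    using assms by (auto simp: vec_eq_iff forall_2)
  have eq: "n $ 1 * k $ 1 + n $ 2 * k $ 2 = 0" "x $ 1 * k $ 1 + x $ 2 * k $ 2 = 0"
    using assms by (simp_all add: inner_vec_def sum_2)
  then have "k $ 1 * (x $ 1 * n $ 2 - x $ 2 * n $ 1) = 0" "k $ 2 * (x $ 1 * n $ 2 - x $ 2 * n $ 1) = 0"
    by algebra+
  then have x: "x $ 1 * n $ 2 = x $ 2 * n $ 1" using k by auto
  show ?thesis
  proof (cases "n $ 1 = 0")
    case True
    then show ?thesis using x n by (intro exI[of _ "x $ 2 / n $ 2"]) (auto simp: vec_eq_iff forall_2)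
  next
    case False
    then show ?thesis using x by (intro exI[of _ "x $ 1 / n $ 1"]) (auto simp: vec_eq_iff forall_2 field_simps)
  qed
qed

text \<open>Near a regular zero \<open>y t0\<close> of \<open>F\<close>, the function \<open>F\<close> is strictly monotonic in the direction normal to
  the curve, while the curve is strictly monotonic in its tangential direction. Hence in a small box
  every zero of \<open>F\<close> is the only one on its normal line, and the curve meets that line. This
  determines \<open>Z\<close> near \<open>y t0\<close> although \<open>y\<close> need not be injective and \<open>Z\<close> is not known to consist of all
  zeros of \<open>F\<close>.\<close>

lemma zero_set_locally_arc:
  fixes F :: "real ^ 2 \<Rightarrow> real" and y :: "real \<Rightarrow> real ^ 2"
  assumes U: "open U" and F: "smooth_on U F" and F0: "\<And>u. u \<in> Z \<inter> U \<Longrightarrow> F u = 0"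
    and y: "smooth_on {a<..<b} y" and yZ: "y ` {a<..<b} \<subseteq> Z \<inter> U" and t0: "t0 \<in> {a<..<b}"
    and y': "vector_derivative y (at t0) \<noteq> 0"
    and F': "frechet_derivative F (at (y t0)) w \<noteq> 0" and e: "e > 0"
  shows "\<exists>t1 t2 W. a < t1 \<and> t0 - e < t1 \<and> t1 < t0 \<and> t0 < t2 \<and> t2 < t0 + e \<and> t2 < b \<and>
    open W \<and> W \<subseteq> U \<and> y t0 \<in> W \<and> Z \<inter> W = y ` {t1<..<t2}"
proof -
  let ?DF = "\<lambda>u. frechet_derivative F (at u)"
  define k where "k = vector_derivative y (at t0)"
  have yt0: "y t0 \<in> U" "y t0 \<in> Z" using yZ t0 by auto
  have dy: "(y has_vector_derivative vector_derivative y (at t)) (at t)" if "t \<in> {a<..<b}" for t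
    using smooth_on_has_vector_derivative[OF y that] .
  have dF: "(F has_derivative ?DF u) (at u)" if "u \<in> U" for u
    using smooth_on_has_derivative[OF F that] .
  have lin: "linear (?DF u)" if "u \<in> U" for u
    using dF[OF that] by (rule has_derivative_linear)
  have DFk: "?DF (y t0) k = 0"
  proof -
    have "((\<lambda>t. F (y t)) has_vector_derivative ?DF (y t0) k) (at t0)"
      using smooth_on_compose_has_vector_derivative[where c=y, OF F yt0(1) dy[OF t0]] by (simp add: k_def)
    moreover have "((\<lambda>t. F (y t)) has_vector_derivative 0) (at t0)"
      by (rule has_vector_derivative_transform_within_open[OF has_vector_derivative_const[of 0]
            open_greaterThanLessThan t0]) (use yZ F0 in force)
    ultimately show ?thesis using vector_derivative_unique_at by blast
  qed
  \<comment> \<open>The normal direction \<open>n\<close> is the part of \<open>w\<close> orthogonal to the velocity, oriented such that \<open>F\<close> increases along it.\<close>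
  define n0 where "n0 = w - ((w \<bullet> k) / (k \<bullet> k)) *\<^sub>R k"
  define n where "n = sgn (?DF (y t0) w) *\<^sub>R n0"
  have k0: "k \<noteq> 0" using y' k_def by simp
  have nk: "n \<bullet> k = 0" using k0 by (simp add: n_def n0_def inner_diff_left)
  have DFn: "?DF (y t0) n > 0"
    using DFk F' lin[OF yt0(1)]
    by (auto simp: n_def n0_def linear_cmul linear_diff sgn_if)
  have n0: "n \<noteq> 0" using DFn linear_0[OF lin[OF yt0(1)]] by auto
  have "isCont (\<lambda>u. ?DF u n) (y t0)"
    using smooth_on_isCont[OF smooth_on_frechet_derivative[OF U F smooth_on_const] U yt0(1)] .
  then obtain r1 where r1: "r1 > 0" "\<And>u. dist u (y t0) < r1 \<Longrightarrow> dist (?DF u n) (?DF (y t0) n) < ?DF (y t0) n"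
    using DFn unfolding continuous_at_eps_delta by blast
  obtain r2 where r2: "r2 > 0" "ball (y t0) r2 \<subseteq> U" using U yt0 openE by blast
  define B where "B = ball (y t0) (min r1 r2)"
  have B: "open B" "convex B" "B \<subseteq> U" "y t0 \<in> B" using r1 r2 by (auto simp: B_def)
  have Bpos: "?DF u n > 0" if "u \<in> B" for u
    using r1(2)[of u] that by (auto simp: B_def dist_commute dist_real_def)
  have "isCont y t0" using smooth_on_isCont[OF y _ t0] by simp
  then have "\<forall>\<^sub>F t in at t0. y t \<in> B"
    using B by (auto simp: isCont_def elim: topological_tendstoD)
  moreover have "isCont (\<lambda>t. vector_derivative y (at t) \<bullet> k) t0"
    using smooth_on_isCont[OF smooth_on_vector_derivative[OF _ y] _ t0] by (auto intro!: continuous_intros)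
  then have "\<forall>\<^sub>F t in at t0. vector_derivative y (at t) \<bullet> k > 0"
    using k0 by (intro order_tendstoD(1)[of _ "k \<bullet> k"]) (auto simp: isCont_def k_def)
  ultimately have "\<forall>\<^sub>F t in at t0. y t \<in> B \<and> vector_derivative y (at t) \<bullet> k > 0"
    by (rule eventually_conj)
  then obtain d1 where d1: "d1 > 0" "\<And>t. t \<noteq> t0 \<Longrightarrow> dist t t0 < d1 \<Longrightarrow> y t \<in> B \<and> vector_derivative y (at t) \<bullet> k > 0"
    unfolding eventually_at by blast
  \<comment> \<open>Halving keeps the closed interval from \<open>t1\<close> to \<open>t2\<close> inside the range of validity.\<close>
  define d where "d = Min {d1, e, t0 - a, b - t0} / 2"
  have d: "d > 0" "d < d1" "d < e" "d < t0 - a" "d < b - t0"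
    using d1 e t0 by (auto simp: d_def min_def)
  define t1 where "t1 = t0 - d"
  define t2 where "t2 = t0 + d"
  have t12: "a < t1" "t0 - e < t1" "t1 < t0" "t0 < t2" "t2 < t0 + e" "t2 < b"
    using d by (auto simp: t1_def t2_def)
  have near: "y t \<in> B" "vector_derivative y (at t) \<bullet> k > 0" if "t1 \<le> t" "t \<le> t2" for t
  proof -
    have "dist t t0 < d1" using that d by (auto simp: t1_def t2_def dist_real_def)
    then show "y t \<in> B" "vector_derivative y (at t) \<bullet> k > 0"
      using d1(2)[of t] B(4) k0 by (cases "t = t0"; simp add: k_def)+
  qed
  have dl: "((\<lambda>t. y t \<bullet> k) has_real_derivative vector_derivative y (at t) \<bullet> k) (at t)"
    if "t1 \<le> t" "t \<le> t2" for t
    using bounded_linear.has_vector_derivative[OF bounded_linear_inner_left dy, of t k] that t12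
    by (simp add: has_real_derivative_iff_has_vector_derivative)
  have mono: "y s \<bullet> k < y t \<bullet> k" if "t1 \<le> s" "s < t" "t \<le> t2" for s t
  proof (rule DERIV_pos_imp_increasing[OF that(2)])
    fix x assume "s \<le> x" "x \<le> t"
    then have "t1 \<le> x" "x \<le> t2" using that by auto
    then show "\<exists>z. ((\<lambda>t. y t \<bullet> k) has_real_derivative z) (at x) \<and> 0 < z" using dl near(2) by blast
  qed
  \<comment> \<open>The strip between the two normal lines through the end points of the arc.\<close>
  define W where "W = {u \<in> B. y t1 \<bullet> k < u \<bullet> k \<and> u \<bullet> k < y t2 \<bullet> k}"
  have W: "open W"
  proof -
    have "W = B \<inter> {u. y t1 \<bullet> k < u \<bullet> k} \<inter> {u. u \<bullet> k < y t2 \<bullet> k}" by (auto simp: W_def)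
    then show ?thesis using B(1)
      by (auto intro!: open_Int open_Collect_less continuous_intros)
  qed
  have yZ': "y t \<in> Z \<inter> U" if "t \<in> {t1<..<t2}" for t
  proof -
    have "t \<in> {a<..<b}" using that t12 by simp
    then show ?thesis using yZ by blast
  qed
  have "Z \<inter> W = y ` {t1<..<t2}"
  proof
    show "y ` {t1<..<t2} \<subseteq> Z \<inter> W"
    proof
      fix u assume "u \<in> y ` {t1<..<t2}"
      then obtain t where t: "u = y t" "t1 < t" "t < t2" by auto
      then show "u \<in> Z \<inter> W"
        using yZ'[of t] near(1)[of t] mono[of t1 t] mono[of t t2] by (simp add: W_def)
    qed
    show "Z \<inter> W \<subseteq> y ` {t1<..<t2}"
    proof
      fix u
      assume u: "u \<in> Z \<inter> W"
      have "\<exists>t\<ge>t1. t \<le> t2 \<and> y t \<bullet> k = u \<bullet> k"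
        using u t12 dl by (intro IVT) (auto simp: W_def intro: DERIV_isCont)
      then obtain t where t: "t1 \<le> t" "t \<le> t2" "y t \<bullet> k = u \<bullet> k" by blast
      then have t': "t \<in> {t1<..<t2}" using u by (cases "t = t1"; cases "t = t2") (auto simp: W_def)
      have uB: "u \<in> B" "y t \<in> B" using u near t by (auto simp: W_def)
      have "(u - y t) \<bullet> k = 0" using t by (simp add: inner_diff_left)
      then obtain c where c: "u - y t = c *\<^sub>R n"
        using parallel_if_orthogonal_to_same[OF k0 n0 nk] by blast
      have "\<exists>s. 0 < s \<and> s < 1 \<and> F (y t + 1 *\<^sub>R (u - y t)) - F (y t + 0 *\<^sub>R (u - y t)) =
          (1 - 0) * ?DF (y t + s *\<^sub>R (u - y t)) (u - y t)"
      proof (rule MVT2)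
        fix s :: real
        assume s: "0 \<le> s" "s \<le> 1"
        have "y t + s *\<^sub>R (u - y t) = (1 - s) *\<^sub>R y t + s *\<^sub>R u" by (simp add: algebra_simps)
        then have i: "y t + s *\<^sub>R (u - y t) \<in> U"
          using convexD[OF B(2) uB(2,1), of "1 - s" s] s B(3) by auto
        show "((\<lambda>s. F (y t + s *\<^sub>R (u - y t))) has_real_derivative ?DF (y t + s *\<^sub>R (u - y t)) (u - y t)) (at s)"
          using smooth_on_compose_has_vector_derivative[OF F i affine_has_vector_derivative]
          by (simp add: has_real_derivative_iff_has_vector_derivative)
      qed simp
      then obtain s where s: "0 < s" "s < 1" "F u - F (y t) = ?DF (y t + s *\<^sub>R (u - y t)) (u - y t)"
        by auto
      have "y t + s *\<^sub>R (u - y t) = (1 - s) *\<^sub>R y t + s *\<^sub>R u" by (simp add: algebra_simps)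
      then have i: "y t + s *\<^sub>R (u - y t) \<in> B"
        using convexD[OF B(2) uB(2,1), of "1 - s" s] s by auto
      have "F u = 0" "F (y t) = 0"
        using u uB B(3) F0 yZ' t' by auto
      then have "c * ?DF (y t + s *\<^sub>R (u - y t)) n = 0"
        using s(3) lin[of "y t + s *\<^sub>R (u - y t)"] i B(3) unfolding c by (simp add: linear_cmul subset_iff)
      then have "c = 0" using Bpos[OF i] by simp
      then show "u \<in> y ` {t1<..<t2}" using c t' by auto
    qed
  qed
  moreover have "y t0 \<in> W" using mono[of t1 t0] mono[of t0 t2] t12 B(4) by (simp add: W_def)
  moreover have "W \<subseteq> U" using B(3) by (auto simp: W_def)
  ultimately show ?thesis using t12 W by blast
qed


section \<open>Arc length\<close>

lemma arc_length_parameter: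
  fixes \<rho> :: "real \<Rightarrow> real"
  assumes J: "smooth_on J \<rho>" "open J" and t: "t1 < t0" "t0 < t2" "{t1..t2} \<subseteq> J"
    and pos: "\<And>t. t \<in> {t1..t2} \<Longrightarrow> \<rho> t > 0"
  shows "\<exists>a b \<tau>. a < 0 \<and> 0 < b \<and> \<tau> 0 = t0 \<and> \<tau> ` {a<..<b} = {t1<..<t2} \<and> smooth_on {a<..<b} \<tau> \<and>
    (\<forall>s\<in>{a<..<b}. (\<tau> has_vector_derivative inverse (\<rho> (\<tau> s))) (at s))"
proof -
  have "continuous_on {t1..t2} \<rho>"
    using smooth_on_continuous_on[OF J(1)] t(3) continuous_on_subset by blast
  from antiderivative_continuous[OF this] obtain l0 where
    l0: "\<And>x. x \<in> {t1..t2} \<Longrightarrow> (l0 has_vector_derivative \<rho> x) (at x within {t1..t2})" by blast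
  define l where "l x = l0 x - l0 t0" for x
  have l: "(l has_real_derivative \<rho> x) (at x within {t1..t2})" if "x \<in> {t1..t2}" for x
    using l0[OF that] unfolding l_def has_real_derivative_iff_has_vector_derivative
    by (auto intro!: derivative_eq_intros)
  have l': "(l has_real_derivative \<rho> x) (at x)" if "x \<in> {t1<..<t2}" for x
    using l[of x] that at_within_interior[of x "{t1..t2}"] by auto
  have cont: "continuous_on {t1..t2} l"
    using l DERIV_continuous by (fastforce simp: continuous_on_eq_continuous_within)
  have mono: "l s < l t" if "t1 \<le> s" "s < t" "t \<le> t2" for s t
  proof (rule DERIV_pos_imp_increasing_open[OF that(2)])
    show "\<exists>y. DERIV l x :> y \<and> y > 0" if "s < x" "x < t" for x
      using l'[of x] pos[of x] that \<open>t1 \<le> s\<close> \<open>t \<le> t2\<close> by force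
    show "continuous_on {s..t} l" using cont that by (auto intro: continuous_on_subset)
  qed
  have inj: "inj_on l {t1..t2}"
    using mono by (auto simp: inj_on_def) (metis linorder_neqE_linordered_idom less_irrefl)
  define \<tau> where "\<tau> = inv_into {t1..t2} l"
  have \<tau>l: "\<tau> (l t) = t" if "t \<in> {t1..t2}" for t
    using inj that by (simp add: \<tau>_def)
  have l\<tau>: "\<tau> s \<in> {t1<..<t2} \<and> l (\<tau> s) = s" if s: "s \<in> {l t1<..<l t2}" for s
  proof -
    have "\<exists>x\<ge>t1. x \<le> t2 \<and> l x = s" using s t cont by (intro IVT') auto
    then obtain x where x: "t1 \<le> x" "x \<le> t2" "l x = s" by blast
    then have "x \<in> {t1<..<t2}" using s by (cases "x = t1"; cases "x = t2") auto
    then show ?thesis using x \<tau>l[of x] by auto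
  qed
  have img: "\<tau> ` {l t1<..<l t2} = {t1<..<t2}"
  proof
    show "{t1<..<t2} \<subseteq> \<tau> ` {l t1<..<l t2}"
    proof
      fix x assume x: "x \<in> {t1<..<t2}"
      then have "l x \<in> {l t1<..<l t2}" using mono[of t1 x] mono[of x t2] by auto
      then show "x \<in> \<tau> ` {l t1<..<l t2}" using \<tau>l[of x] x by force
    qed
  qed (use l\<tau> in auto)
  have d: "(\<tau> has_real_derivative inverse (\<rho> (\<tau> s))) (at s)" if s: "s \<in> {l t1<..<l t2}" for s
  proof -
    obtain x1 x2 where x: "t1 < x1" "x1 < \<tau> s" "\<tau> s < x2" "x2 < t2"
      using l\<tau>[OF s] dense[of t1 "\<tau> s"] dense[of "\<tau> s" t2] by auto
    have "isCont \<tau> (l (\<tau> s))"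
    proof (rule isCont_inverse_function2[OF x(2,3)])
      show "\<tau> (l z) = z" "isCont l z" if "x1 \<le> z" "z \<le> x2" for z
        using \<tau>l[of z] l'[of z] that x by (auto intro: DERIV_isCont)
    qed
    moreover have "\<rho> (\<tau> s) \<noteq> 0" using pos[of "\<tau> s"] l\<tau>[OF s] by auto
    ultimately show ?thesis
      using l'[of "\<tau> s"] l\<tau> s
      by (intro DERIV_inverse_function[of l _ _ _ "l t1" "l t2"]) auto
  qed
  have sm: "smooth_on {l t1<..<l t2} \<tau>"
  proof (rule smooth_on_autonomous_solution[of _ "{t1<..<t2}" _ "\<lambda>t. inverse (\<rho> t)"])
    have "smooth_on {t1<..<t2} (\<lambda>t. 1 / \<rho> t)"
      using smooth_on_subset[OF J(1), of "{t1<..<t2}"] t(3)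
      by (intro smooth_on_divide smooth_on_const) (auto simp: subset_iff less_imp_neq[OF pos, symmetric])
    then show "smooth_on {t1<..<t2} (\<lambda>t. inverse (\<rho> t))" by (simp add: inverse_eq_divide)
    show "(\<tau> has_vector_derivative inverse (\<rho> (\<tau> s))) (at s)" if "s \<in> {l t1<..<l t2}" for s
      using d[OF that] by (simp add: has_real_derivative_iff_has_vector_derivative)
  qed (use img in auto)
  have "l t1 < 0" "0 < l t2" using mono[of t1 t0] mono[of t0 t2] t by (auto simp: l_def)
  moreover have "\<tau> 0 = t0" using \<tau>l[of t0] t by (simp add: l_def)
  ultimately show ?thesis
    using sm img d by (intro exI[of _ "l t1"] exI[of _ "l t2"] exI[of _ \<tau>])
      (auto simp: has_real_derivative_iff_has_vector_derivative)
qed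


section \<open>The oriented plane\<close>

text \<open>The inner product \<open>v \<bullet> rot w\<close> is the determinant of \<open>v\<close> and \<open>w\<close>, so it detects linear dependence.\<close>

definition rot :: "real ^ 2 \<Rightarrow> real ^ 2" where
  "rot v = vector [v $ 2, - v $ 1]"

lemma rot_orthogonal [simp]: "v \<bullet> rot v = 0" "rot v \<bullet> v = 0"
  by (simp_all add: rot_def inner_vec_def sum_2)

lemma rot_norm [simp]: "rot v \<bullet> rot v = v \<bullet> v"
  by (simp add: rot_def inner_vec_def sum_2)

lemma bounded_linear_rot: "bounded_linear rot"
  unfolding linear_conv_bounded_linear[symmetric]
  by (simp add: linear_iff rot_def vec_eq_iff forall_2)

lemma rot_decomposition:
  assumes "v \<noteq> 0"
  shows "w = ((w \<bullet> rot v) / (v \<bullet> v)) *\<^sub>R rot v + ((w \<bullet> v) / (v \<bullet> v)) *\<^sub>R v"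
proof -
  define x y where "x = v $ 1" "y = v $ 2"
  have vv: "v \<bullet> v = x * x + y * y" by (simp add: x_y_def inner_vec_def sum_2)
  then have nz: "x * x + y * y \<noteq> 0" using assms by (metis inner_eq_zero_iff)
  have *: "p = (s / (x * x + y * y)) * q + (t / (x * x + y * y)) * q'"
    if "p * (x * x + y * y) = s * q + t * q'" for p q q' s t
    using that nz by (simp add: eq_divide_eq flip: add_divide_distrib)
  have "w $ 1 = ((w $ 1 * y - w $ 2 * x) / (x * x + y * y)) * y + ((w $ 1 * x + w $ 2 * y) / (x * x + y * y)) * x"
    "w $ 2 = ((w $ 1 * y - w $ 2 * x) / (x * x + y * y)) * (- x) + ((w $ 1 * x + w $ 2 * y) / (x * x + y * y)) * y"
    by (rule *, simp add: algebra_simps)+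
  then show ?thesis
    unfolding vec_eq_iff forall_2 vv by (simp add: rot_def inner_vec_def sum_2 flip: x_y_def)
qed

lemma parallel_if_rot_orthogonal:
  assumes "w \<noteq> 0" "v \<bullet> rot w = 0"
  shows "\<exists>c. v = c *\<^sub>R w"
  using rot_decomposition[OF assms(1), of v] assms(2) by auto

lemma lin_dependent_rot: "lin_dependent v w \<Longrightarrow> v \<bullet> rot w = 0"
proof -
  assume "lin_dependent v w"
  then obtain a b where ab: "(a, b) \<noteq> (0, 0)" "a *\<^sub>R v + b *\<^sub>R w = 0" by (auto simp: lin_dependent_def)
  have "(a *\<^sub>R v + b *\<^sub>R w) \<bullet> rot w = 0" "(a *\<^sub>R v + b *\<^sub>R w) \<bullet> rot v = 0" by (simp_all add: ab(2))
  then have "a * (v \<bullet> rot w) = 0" "b * (w \<bullet> rot v) = 0" by (simp_all add: inner_simps)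
  moreover have "w \<bullet> rot v = - (v \<bullet> rot w)" by (simp add: rot_def inner_vec_def sum_2)
  ultimately show "v \<bullet> rot w = 0" using ab(1) by auto
qed

lemma functional_kernel_dependent:
  fixes l :: "real ^ 2 \<Rightarrow> real"
  assumes l: "linear l" and x: "l x \<noteq> 0" and v: "l v = 0" "l w = 0"
  shows "lin_dependent v w"
proof (cases "w = 0")
  case True
  then show ?thesis unfolding lin_dependent_def by (intro exI[of _ 0] exI[of _ 1]) simp
next
  case False
  have d: "l u = ((u \<bullet> rot w) / (w \<bullet> w)) * l (rot w)" for u
    by (subst rot_decomposition[OF False, of u]) (simp add: linear_add[OF l] linear_cmul[OF l] v)
  have "v \<bullet> rot w = 0" using d[of v] d[of x] x v False by auto
  then obtain c where "v = c *\<^sub>R w" using parallel_if_rot_orthogonal[OF False] by blast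
  then show ?thesis unfolding lin_dependent_def by (intro exI[of _ 1] exI[of _ "-c"]) simp
qed


section \<open>Lorentzian linear algebra\<close>

definition lorentzian_form :: "real ^ 3 ^ 3 \<Rightarrow> bool" where
  "lorentzian_form A \<longleftrightarrow> transpose A = A \<and> (\<exists>P :: real ^ 3 ^ 3. invertible P \<and>
     transpose P ** A ** P = (\<chi> i j. if i \<noteq> j then 0 else if i = 3 then -1 else 1))"

lemma lorentzian_form_sym:
  assumes "lorentzian_form A"
  shows "v \<bullet> (A *v w) = w \<bullet> (A *v v)"
proof -
  have "transpose A *v v = A *v v" using assms by (simp add: lorentzian_form_def)
  then have "v v* A = A *v v" by simp
  then have "(A *v v) \<bullet> w = v \<bullet> (A *v w)" using dot_lmul_matrix[of v A w] by simp
  then show ?thesis by (simp add: inner_commute)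
qed

lemma lorentzian_form_coordinates:
  assumes "lorentzian_form A"
  obtains P :: "real ^ 3 ^ 3" where "invertible P"
    "\<And>v w :: real ^ 3. (P *v v) \<bullet> (A *v (P *v w)) = v $ 1 * w $ 1 + v $ 2 * w $ 2 - v $ 3 * w $ 3"
proof -
  obtain P :: "real ^ 3 ^ 3" where P: "invertible P"
    "transpose P ** A ** P = (\<chi> i j. if i \<noteq> j then 0 else if i = 3 then -1 else 1)"
    using assms unfolding lorentzian_form_def by blast
  have "(P *v v) \<bullet> (A *v (P *v w)) = v $ 1 * w $ 1 + v $ 2 * w $ 2 - v $ 3 * w $ 3" for v w :: "real ^ 3"
    unfolding pairing_change[OF P(2), symmetric]
    by (simp add: inner_vec_def matrix_vector_mult_def sum_3)
  then show ?thesis using P(1) that by blast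
qed

text \<open>In coordinates that diagonalize the form, pairing with a basis vector reads off a coordinate up to sign.\<close>

lemma lorentzian_form_nondegenerate:
  assumes "lorentzian_form A" "v \<noteq> 0"
  shows "A *v v \<noteq> 0"
proof
  assume 0: "A *v v = 0"
  obtain P :: "real ^ 3 ^ 3" where P: "invertible P"
    "\<And>v w :: real ^ 3. (P *v v) \<bullet> (A *v (P *v w)) = v $ 1 * w $ 1 + v $ 2 * w $ 2 - v $ 3 * w $ 3"
    using lorentzian_form_coordinates[OF assms(1)] by blast
  obtain z :: "real ^ 3" where z: "v = P *v z" using P(1) by (metis invertible_def matrix_vector_mul_assoc matrix_vector_mul_lid)
  have "z $ i = 0" for i
    using P(2)[of "axis i 1" z] 0 exhaust_3[of i] by (auto simp: z axis_def)
  then have "z = 0" by (simp add: vec_eq_iff)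
  then show False using assms(2) z by simp
qed

text \<open>Diagonalize the form. With \<open>h1\<^sup>2 + h2\<^sup>2 = h3\<^sup>2\<close> and \<open>z1 h1 + z2 h2 = z3 h3\<close> Lagrange's identity gives
\<open>h3\<^sup>2 (z1\<^sup>2 + z2\<^sup>2 - z3\<^sup>2) = (z1 h2 - z2 h1)\<^sup>2\<close>, and the right-hand side vanishes only for \<open>z\<close> proportional to \<open>h\<close>.\<close>

lemma lorentzian_form_spacelike:
  assumes A: "lorentzian_form A" and h: "h \<noteq> 0" "h \<bullet> (A *v h) = 0" and z: "z \<bullet> (A *v h) = 0" "\<And>c. z \<noteq> c *\<^sub>R h"
  shows "z \<bullet> (A *v z) > 0"
proof -
  obtain P :: "real ^ 3 ^ 3" where P: "invertible P"
    "\<And>v w :: real ^ 3. (P *v v) \<bullet> (A *v (P *v w)) = v $ 1 * w $ 1 + v $ 2 * w $ 2 - v $ 3 * w $ 3"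
    using lorentzian_form_coordinates[OF A] by blast
  obtain h' z' :: "real ^ 3" where hz: "h = P *v h'" "z = P *v z'"
    using P(1) by (metis invertible_def matrix_vector_mul_assoc matrix_vector_mul_lid)
  define h1 h2 h3 where "h1 = h' $ 1" "h2 = h' $ 2" "h3 = h' $ 3"
  define z1 z2 z3 where "z1 = z' $ 1" "z2 = z' $ 2" "z3 = z' $ 3"
  note d = h1_h2_h3_def z1_z2_z3_def
  have eq: "h1 * h1 + h2 * h2 = h3 * h3" "z1 * h1 + z2 * h2 = z3 * h3"
    using h(2) z(1) P(2) unfolding hz d by auto
  have h3: "h3 \<noteq> 0"
  proof
    assume "h3 = 0"
    then have "h1 = 0" "h2 = 0" using eq(1) by (auto simp: sum_squares_eq_zero_iff)
    then have "h' = 0" using \<open>h3 = 0\<close> by (auto simp: vec_eq_iff forall_3 d)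
    then show False using h(1) hz by simp
  qed
  have "(z1 * h2 - z2 * h1) \<noteq> 0"
  proof
    assume a: "z1 * h2 - z2 * h1 = 0"
    have "h3 * (z1 * h3 - z3 * h1) = 0" "h3 * (z2 * h3 - z3 * h2) = 0"
      using eq a by algebra+
    then have "z1 = (z3 / h3) * h1" "z2 = (z3 / h3) * h2" "z3 = (z3 / h3) * h3"
      using h3 by (auto simp: field_simps)
    then have "z' = (z3 / h3) *\<^sub>R h'"
      unfolding d by (simp add: vec_eq_iff forall_3)
    then show False using z(2)[of "z3 / h3"] hz by (simp add: matrix_vector_mult_scaleR)
  qed
  moreover have "(h3 * h3) * (z1 * z1 + z2 * z2 - z3 * z3) = (z1 * h2 - z2 * h1) * (z1 * h2 - z2 * h1)"
    using eq by algebra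
  ultimately have "(h3 * h3) * (z1 * z1 + z2 * z2 - z3 * z3) > 0"
    using not_real_square_gt_zero by metis
  then have "z1 * z1 + z2 * z2 - z3 * z3 > 0"
    using h3 by (metis not_square_less_zero zero_less_mult_iff)
  then show ?thesis using P(2) unfolding hz d by simp
qed


section \<open>The Levi-Civita connection in coordinates\<close>

definition ip_at :: "(real ^ 3 \<Rightarrow> real ^ 3 ^ 3) \<Rightarrow> real ^ 3 \<Rightarrow> real ^ 3 \<Rightarrow> real ^ 3 \<Rightarrow> real" where
  "ip_at h x v w = v \<bullet> (h x *v w)"

text \<open>The Christoffel symbols of the first kind, contracted with three vectors. Working with them instead of the
symbols of the second kind avoids the inverse of the metric.\<close>

definition christoffel_first :: "(real ^ 3 \<Rightarrow> real ^ 3 ^ 3) \<Rightarrow> real ^ 3 \<Rightarrow> real ^ 3 \<Rightarrow> real ^ 3 \<Rightarrow> real ^ 3 \<Rightarrow> real" where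
  "christoffel_first h x W A B =
     (W \<bullet> (Dir h x A *v B) + W \<bullet> (Dir h x B *v A) - A \<bullet> (Dir h x W *v B)) / 2"

text \<open>The pairing of \<open>W\<close> with the covariant derivative of a field with value \<open>B\<close> and derivative \<open>B'\<close> along a curve
with velocity \<open>A\<close>.\<close>

definition cov_ip ::
  "(real ^ 3 \<Rightarrow> real ^ 3 ^ 3) \<Rightarrow> real ^ 3 \<Rightarrow> real ^ 3 \<Rightarrow> real ^ 3 \<Rightarrow> real ^ 3 \<Rightarrow> real ^ 3 \<Rightarrow> real" where
  "cov_ip h x W A B B' = ip_at h x W B' + christoffel_first h x W A B"

locale metric_in_coordinates =
  fixes h :: "real ^ 3 \<Rightarrow> real ^ 3 ^ 3" and V :: "(real ^ 3) set"
  assumes V: "open V" and h: "smooth_on V h" and lorentzian: "\<And>x. x \<in> V \<Longrightarrow> lorentzian_form (h x)"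
begin

lemma ip_at_sym: "x \<in> V \<Longrightarrow> ip_at h x v w = ip_at h x w v"
  unfolding ip_at_def by (rule lorentzian_form_sym[OF lorentzian])

lemma linear_Dir_h: "x \<in> V \<Longrightarrow> linear (frechet_derivative h (at x))"
  by (rule linear_frechet_derivative[OF C1_differentiable[OF h]])

lemma Dir_h_sym:
  assumes "x \<in> V"
  shows "v \<bullet> (Dir h x A *v w) = w \<bullet> (Dir h x A *v v)"
proof -
  have d: "((\<lambda>x. ip_at h x v w) has_derivative (\<lambda>A. v \<bullet> (Dir h x A *v w))) (at x)" for v w
    unfolding ip_at_def
    by (intro has_derivative_inner_right
        bounded_linear.has_derivative[OF bounded_bilinear.bounded_linear_left[OF bounded_bilinear_matrix_vector]]
        smooth_on_has_derivative[OF h assms])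
  have "((\<lambda>x. ip_at h x w v) has_derivative (\<lambda>A. v \<bullet> (Dir h x A *v w))) (at x)"
    by (rule has_derivative_transform_within_open[OF d V assms]) (rule ip_at_sym)
  from has_derivative_unique[OF this d] show ?thesis by metis
qed

lemma ip_at_linear:
  "ip_at h x (v + v') w = ip_at h x v w + ip_at h x v' w" "ip_at h x (c *\<^sub>R v) w = c * ip_at h x v w"
  "ip_at h x (v - v') w = ip_at h x v w - ip_at h x v' w"
  "ip_at h x v (w + w') = ip_at h x v w + ip_at h x v w'" "ip_at h x v (c *\<^sub>R w) = c * ip_at h x v w"
  "ip_at h x v (w - w') = ip_at h x v w - ip_at h x v w'"
  by (simp_all add: ip_at_def inner_simps matrix_vector_right_distrib matrix_vector_mult_diff_distrib
      matrix_vector_mult_scaleR)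

lemma christoffel_first_linear:
  assumes "x \<in> V"
  shows "christoffel_first h x (v + w) A B = christoffel_first h x v A B + christoffel_first h x w A B"
    "christoffel_first h x (v - w) A B = christoffel_first h x v A B - christoffel_first h x w A B"
    "christoffel_first h x (c *\<^sub>R v) A B = c * christoffel_first h x v A B"
    "christoffel_first h x v (c *\<^sub>R A) B = c * christoffel_first h x v A B"
    "christoffel_first h x v A (c *\<^sub>R B) = c * christoffel_first h x v A B"
  using linear_Dir_h[OF assms]
  by (simp_all add: christoffel_first_def linear_add linear_diff linear_cmul inner_simps
      matrix_vector_mult_add_rdistrib matrix_vector_mult_diff_rdistrib matrix_vector_mult_scaleR
      scaleR_matrix_vector_assoc[symmetric] algebra_simps add_divide_distrib diff_divide_distrib)

lemma cov_ip_linear: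
  assumes "x \<in> V"
  shows "cov_ip h x (v + w) A B B' = cov_ip h x v A B B' + cov_ip h x w A B B'"
    "cov_ip h x (v - w) A B B' = cov_ip h x v A B B' - cov_ip h x w A B B'"
    "cov_ip h x (c *\<^sub>R v) A B B' = c * cov_ip h x v A B B'"
    "cov_ip h x v (c *\<^sub>R A) B (c *\<^sub>R B') = c * cov_ip h x v A B B'"
    "cov_ip h x v A (c *\<^sub>R B) (c *\<^sub>R B' + d *\<^sub>R B) = c * cov_ip h x v A B B' + d * ip_at h x v B"
  by (simp_all add: cov_ip_def ip_at_linear christoffel_first_linear[OF assms] algebra_simps)

text \<open>Compatibility of the connection with the metric: the Christoffel terms add up to the derivative of the metric
along the curve.\<close>

lemma cov_ip_product_rule:
  assumes x: "x t \<in> V" "(x has_vector_derivative A) (at t)"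
    and B: "(B has_vector_derivative B') (at t)" and C: "(C has_vector_derivative C') (at t)"
  shows "((\<lambda>t. ip_at h (x t) (B t) (C t)) has_vector_derivative
    cov_ip h (x t) (C t) A (B t) B' + cov_ip h (x t) (B t) A (C t) C') (at t)"
proof -
  have hx: "((\<lambda>t. h (x t)) has_vector_derivative Dir h (x t) A) (at t)"
    by (rule smooth_on_compose_has_vector_derivative[OF h x])
  have "((\<lambda>t. B t \<bullet> (h (x t) *v C t)) has_vector_derivative
      B t \<bullet> (h (x t) *v C' + Dir h (x t) A *v C t) + B' \<bullet> (h (x t) *v C t)) (at t)"
    by (intro bounded_bilinear.has_vector_derivative[OF bounded_bilinear_inner]
        bounded_bilinear.has_vector_derivative[OF bounded_bilinear_matrix_vector] B C hx)
  moreover have "B t \<bullet> (h (x t) *v C' + Dir h (x t) A *v C t) + B' \<bullet> (h (x t) *v C t) =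
      cov_ip h (x t) (C t) A (B t) B' + cov_ip h (x t) (B t) A (C t) C'"
    using lorentzian_form_sym[OF lorentzian[OF x(1)], of B' "C t"]
      Dir_h_sym[OF x(1), of "B t" A "C t"] Dir_h_sym[OF x(1), of "C t" "B t" A]
      Dir_h_sym[OF x(1), of "B t" "C t" A]
    by (simp add: cov_ip_def ip_at_def christoffel_first_def inner_simps field_simps)
  ultimately show ?thesis unfolding ip_at_def by simp
qed

lemma smooth_on_ip_at:
  assumes "open S" "smooth_on S x" "x ` S \<subseteq> V" "smooth_on S v" "smooth_on S w"
  shows "smooth_on S (\<lambda>u. ip_at h (x u) (v u) (w u))"
  unfolding ip_at_def
  by (intro smooth_on_inner smooth_on_matrix_vector assms smooth_on_compose[OF assms(1) V assms(3) h])

lemma smooth_on_cov_ip: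
  assumes S: "open S" and x: "smooth_on S x" "x ` S \<subseteq> V"
    and s: "smooth_on S W" "smooth_on S A" "smooth_on S B" "smooth_on S B'"
  shows "smooth_on S (\<lambda>u. cov_ip h (x u) (W u) (A u) (B u) (B' u))"
proof -
  have D: "smooth_on S (\<lambda>u. Dir h (x u) (C u))" if "smooth_on S C" for C
    by (rule smooth_on_frechet_derivative_compose[OF S V x(2) h x(1) that])
  have "smooth_on S (\<lambda>u. ip_at h (x u) (W u) (B' u) +
      (W u \<bullet> (Dir h (x u) (A u) *v B u) + W u \<bullet> (Dir h (x u) (B u) *v A u) -
        A u \<bullet> (Dir h (x u) (W u) *v B u)) / 2)"
    by (intro smooth_on_add smooth_on_diff smooth_on_divide smooth_on_inner smooth_on_matrix_vector
        smooth_on_ip_at smooth_on_const D S x s) auto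
  then show ?thesis by (simp add: cov_ip_def christoffel_first_def)
qed

end


section \<open>A characteristic curve in coordinates\<close>

text \<open>The data of a surface near a piece of its characteristic curve, read in charts: \<open>h\<close> is the ambient metric, \<open>\<phi>\<close>
the immersion, \<open>Z\<close> the set of lightlike points, \<open>\<eta>\<close> a null field and \<open>y\<close> the curve.\<close>

locale characteristic_data = metric_in_coordinates h V
  for h :: "real ^ 3 \<Rightarrow> real ^ 3 ^ 3" and V :: "(real ^ 3) set" +
  fixes \<phi> :: "real ^ 2 \<Rightarrow> real ^ 3" and \<Omega> :: "(real ^ 2) set" and \<eta> :: "real ^ 2 \<Rightarrow> real ^ 2"
    and Z :: "(real ^ 2) set" and y :: "real \<Rightarrow> real ^ 2" and a0 b0 :: real
  assumes \<Omega>: "open \<Omega>" and \<phi>: "smooth_on \<Omega> \<phi>" "\<phi> ` \<Omega> \<subseteq> V"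
    and immersion: "\<And>u. u \<in> \<Omega> \<Longrightarrow> inj (frechet_derivative \<phi> (at u))"
    and \<eta>: "smooth_on \<Omega> \<eta>" "\<And>u. u \<in> Z \<inter> \<Omega> \<Longrightarrow> \<eta> u \<noteq> 0"
    and null: "\<And>u w. u \<in> Z \<inter> \<Omega> \<Longrightarrow> ip_at h (\<phi> u) (Dir \<phi> u (\<eta> u)) (Dir \<phi> u w) = 0"
    and y: "smooth_on {a0<..<b0} y" "y ` {a0<..<b0} \<subseteq> Z \<inter> \<Omega>"
      "\<And>t. t \<in> {a0<..<b0} \<Longrightarrow> vector_derivative y (at t) \<noteq> 0"
    and zero_mem: "a0 < 0" "0 < b0"
begin

text \<open>The fields \<open>Hf\<close> and \<open>Zf\<close> are the images of \<open>\<eta>\<close> and \<open>\<zeta>\<close> under the immersion, and \<open>P t W\<close> is the pairing of \<open>W\<close> with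
the covariant derivative of \<open>Hf\<close> along the curve. The constant vector \<open>K\<close> is transversal: at the parameter \<open>0\<close> its
pairing with \<open>Hf\<close> is the square of a Euclidean norm. The function \<open>Q\<close> is the value of the torsion at a point of
the first kind, up to sign and multiplied by \<open>ca\<close> and the speed of the curve.\<close>

definition "I = {a0<..<b0}"
definition "\<zeta> u = rot (\<eta> u)"
definition "Hf u = Dir \<phi> u (\<eta> u)"
definition "Zf u = Dir \<phi> u (\<zeta> u)"
definition "\<mu> u = ip_at h (\<phi> u) (Hf u) (Hf u)"
definition "\<theta> u = Dir \<mu> u (\<zeta> u)"
definition "\<beta> u = Dir \<mu> u (\<eta> u)"
definition "r u = ip_at h (\<phi> u) (Zf u) (Zf u)"
definition "y' t = vector_derivative y (at t)"
definition "ca t = (y' t \<bullet> \<zeta> (y t)) / (\<eta> (y t) \<bullet> \<eta> (y t))"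
definition "cb t = (y' t \<bullet> \<eta> (y t)) / (\<eta> (y t) \<bullet> \<eta> (y t))"
definition "x' t = Dir \<phi> (y t) (y' t)"
definition "H' t = Dir Hf (y t) (y' t)"
definition "P t W = cov_ip h (\<phi> (y t)) W (x' t) (Hf (y t)) (H' t)"
definition "K = h (\<phi> (y 0)) *v Hf (y 0)"
definition "KH t = ip_at h (\<phi> (y t)) K (Hf (y t))"
definition "KZ t = ip_at h (\<phi> (y t)) K (Zf (y t))"
definition "Q t = ca t * P t K / KH t
  - (ca t * KZ t / KH t + cb t) * P t (Zf (y t)) / r (y t)
  - vector_derivative ca (at t) / 3
  - ca t * vector_derivative (\<lambda>t. \<theta> (y t)) (at t) / (3 * \<theta> (y t))
  + ca t * vector_derivative cb (at t) / (3 * cb t)"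

lemma open_I [simp]: "open I" by (simp add: I_def)
lemma zero_I [simp]: "0 \<in> I" using zero_mem by (simp add: I_def)
lemma y_in: "t \<in> I \<Longrightarrow> y t \<in> Z \<inter> \<Omega>" using y(2) by (auto simp: I_def)
lemma y_\<Omega>: "y ` I \<subseteq> \<Omega>" using y_in by auto
lemma y_smooth: "smooth_on I y" using y(1) by (simp add: I_def)
lemma \<phi>_V: "u \<in> \<Omega> \<Longrightarrow> \<phi> u \<in> V" using \<phi>(2) by auto
lemma \<phi>y_V: "t \<in> I \<Longrightarrow> \<phi> (y t) \<in> V" using y_in \<phi>_V by auto

lemma linear_D\<phi>: "u \<in> \<Omega> \<Longrightarrow> linear (frechet_derivative \<phi> (at u))"
  by (rule linear_frechet_derivative[OF C1_differentiable[OF \<phi>(1)]])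

lemma smooth_\<zeta>: "smooth_on \<Omega> \<zeta>"
  unfolding \<zeta>_def by (rule smooth_on_bounded_linear[OF bounded_linear_rot \<Omega> \<eta>(1)])
lemma smooth_Hf: "smooth_on \<Omega> Hf"
  unfolding Hf_def by (rule smooth_on_frechet_derivative[OF \<Omega> \<phi>(1) \<eta>(1)])
lemma smooth_Zf: "smooth_on \<Omega> Zf"
  unfolding Zf_def by (rule smooth_on_frechet_derivative[OF \<Omega> \<phi>(1) smooth_\<zeta>])
lemma smooth_\<mu>: "smooth_on \<Omega> \<mu>"
  unfolding \<mu>_def by (intro smooth_on_ip_at \<Omega> \<phi> smooth_Hf)
lemma smooth_r: "smooth_on \<Omega> r"
  unfolding r_def by (intro smooth_on_ip_at \<Omega> \<phi> smooth_Zf)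
lemma smooth_\<theta>: "smooth_on \<Omega> \<theta>"
  unfolding \<theta>_def by (intro smooth_on_frechet_derivative \<Omega> smooth_\<mu> smooth_\<zeta>)
lemma smooth_\<beta>: "smooth_on \<Omega> \<beta>"
  unfolding \<beta>_def by (intro smooth_on_frechet_derivative \<Omega> smooth_\<mu> \<eta>(1))

lemma smooth_along:
  "smooth_on \<Omega> F \<Longrightarrow> smooth_on I (\<lambda>t. F (y t))"
  by (rule smooth_on_compose[OF open_I \<Omega> y_\<Omega> _ y_smooth])

lemma smooth_y': "smooth_on I y'"
  unfolding y'_def by (rule smooth_on_vector_derivative[OF open_I y_smooth])

lemma smooth_ca: "smooth_on I ca" and smooth_cb: "smooth_on I cb"
  unfolding ca_def cb_def
  using \<eta>(2)[OF y_in]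
  by (intro smooth_on_divide smooth_on_inner smooth_along smooth_y' smooth_\<zeta> \<eta>(1) open_I; simp)+

lemma smooth_x': "smooth_on I x'" and smooth_H': "smooth_on I H'"
  unfolding x'_def H'_def
  by (rule smooth_on_frechet_derivative_compose[OF open_I \<Omega> y_\<Omega> _ y_smooth smooth_y'], rule \<phi> smooth_Hf)+

lemma \<phi>y_image: "(\<lambda>t. \<phi> (y t)) ` I \<subseteq> V" using \<phi>y_V by auto

lemma smooth_P: "smooth_on I W \<Longrightarrow> smooth_on I (\<lambda>t. P t (W t))"
  unfolding P_def
  by (intro smooth_on_cov_ip open_I smooth_along \<phi>(1) \<phi>y_image smooth_x' smooth_Hf smooth_H')

lemma smooth_KH: "smooth_on I KH" and smooth_KZ: "smooth_on I KZ"
  unfolding KH_def KZ_def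
  by (intro smooth_on_ip_at open_I smooth_along \<phi>(1) \<phi>y_image smooth_Hf smooth_Zf smooth_on_const)+

lemma y_deriv: "t \<in> I \<Longrightarrow> (y has_vector_derivative y' t) (at t)"
  unfolding y'_def by (rule smooth_on_has_vector_derivative[OF y_smooth])

lemma along_deriv:
  "smooth_on \<Omega> F \<Longrightarrow> t \<in> I \<Longrightarrow> ((\<lambda>t. F (y t)) has_vector_derivative Dir F (y t) (y' t)) (at t)"
  using y_in by (intro smooth_on_compose_has_vector_derivative[of \<Omega>] y_deriv) auto

lemma \<phi>y_deriv: "t \<in> I \<Longrightarrow> ((\<lambda>t. \<phi> (y t)) has_vector_derivative x' t) (at t)"
  unfolding x'_def by (rule along_deriv[OF \<phi>(1)])
lemma H_deriv: "t \<in> I \<Longrightarrow> ((\<lambda>t. Hf (y t)) has_vector_derivative H' t) (at t)"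
  unfolding H'_def by (rule along_deriv[OF smooth_Hf])

lemma y'_decomposition: "t \<in> I \<Longrightarrow> y' t = ca t *\<^sub>R \<zeta> (y t) + cb t *\<^sub>R \<eta> (y t)"
  unfolding ca_def cb_def \<zeta>_def using \<eta>(2)[OF y_in] by (intro rot_decomposition)

lemma x'_decomposition: "t \<in> I \<Longrightarrow> x' t = ca t *\<^sub>R Zf (y t) + cb t *\<^sub>R Hf (y t)"
  using linear_D\<phi>[of "y t"] y_in[of t]
  by (simp add: x'_def y'_decomposition Zf_def Hf_def linear_add linear_cmul)

lemma H_null: "u \<in> Z \<inter> \<Omega> \<Longrightarrow> ip_at h (\<phi> u) (Hf u) (Hf u) = 0"
  "u \<in> Z \<inter> \<Omega> \<Longrightarrow> ip_at h (\<phi> u) (Hf u) (Zf u) = 0"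
  "u \<in> Z \<inter> \<Omega> \<Longrightarrow> ip_at h (\<phi> u) (Zf u) (Hf u) = 0"
proof -
  assume u: "u \<in> Z \<inter> \<Omega>"
  show "ip_at h (\<phi> u) (Hf u) (Hf u) = 0" "ip_at h (\<phi> u) (Hf u) (Zf u) = 0"
    using null[OF u] by (simp_all add: Hf_def Zf_def)
  then show "ip_at h (\<phi> u) (Zf u) (Hf u) = 0" using ip_at_sym[OF \<phi>_V, of u] u by simp
qed

lemma H_nonzero: "u \<in> Z \<inter> \<Omega> \<Longrightarrow> Hf u \<noteq> 0"
  using immersion[of u] \<eta>(2)[of u] linear_D\<phi>[of u] unfolding Hf_def
  by (auto simp: linear_injective_0)

text \<open>The vectors \<open>Hf u\<close> and \<open>Zf u\<close> are independent since \<open>\<phi>\<close> is an immersion, and orthogonal since \<open>\<eta> u\<close> is null;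
as \<open>Hf u\<close> is moreover lightlike, \<open>Zf u\<close> is spacelike.\<close>

lemma r_pos:
  assumes u: "u \<in> Z \<inter> \<Omega>"
  shows "r u > 0"
proof -
  have "Zf u \<noteq> c *\<^sub>R Hf u" for c
  proof
    assume "Zf u = c *\<^sub>R Hf u"
    then have "Dir \<phi> u (\<zeta> u) = Dir \<phi> u (c *\<^sub>R \<eta> u)"
      using linear_D\<phi>[of u] u by (simp add: Zf_def Hf_def linear_cmul)
    then have "\<zeta> u = c *\<^sub>R \<eta> u" using immersion[of u] u by (auto simp: inj_def)
    then have "\<zeta> u \<bullet> \<zeta> u = c * (\<zeta> u \<bullet> \<eta> u)" by simp
    then have "\<eta> u \<bullet> \<eta> u = 0" by (simp add: \<zeta>_def)
    then show False using \<eta>(2)[OF u] by simp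
  qed
  then show ?thesis
    using lorentzian_form_spacelike[OF lorentzian[OF \<phi>_V], of u "Hf u" "Zf u"] H_null[OF u] H_nonzero[OF u] u
    by (simp add: r_def ip_at_def)
qed

lemma \<mu>_zero: "u \<in> Z \<inter> \<Omega> \<Longrightarrow> \<mu> u = 0"
  using H_null by (simp add: \<mu>_def)

lemma zero_along_deriv:
  assumes F: "smooth_on \<Omega> F" and 0: "\<And>u. u \<in> Z \<inter> \<Omega> \<Longrightarrow> F u = 0" and t: "t \<in> I"
  shows "Dir F (y t) (y' t) = 0"
proof -
  have "((\<lambda>t. F (y t)) has_vector_derivative 0) (at t)"
    by (rule locally_constant_has_vector_derivative[OF open_I t]) (rule 0[OF y_in])
  then show ?thesis using along_deriv[OF F t] vector_derivative_unique_at by blast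
qed

lemma linear_Dir: "smooth_on \<Omega> F \<Longrightarrow> u \<in> \<Omega> \<Longrightarrow> linear (frechet_derivative F (at u))"
  by (rule linear_frechet_derivative[OF C1_differentiable])

text \<open>The function \<open>\<mu>\<close> is constant along the curve.\<close>

lemma cb_\<beta>: "t \<in> I \<Longrightarrow> cb t * \<beta> (y t) = - ca t * \<theta> (y t)"
  using zero_along_deriv[OF smooth_\<mu> \<mu>_zero, of t] linear_Dir[OF smooth_\<mu>, of "y t"] y_in[of t]
  by (simp add: y'_decomposition linear_add linear_cmul \<beta>_def \<theta>_def)

lemma P_H: "t \<in> I \<Longrightarrow> P t (Hf (y t)) = 0"
proof -
  assume t: "t \<in> I"
  have "((\<lambda>t. ip_at h (\<phi> (y t)) (Hf (y t)) (Hf (y t))) has_vector_derivative P t (Hf (y t)) + P t (Hf (y t))) (at t)"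
    unfolding P_def using t by (intro cov_ip_product_rule \<phi>y_V \<phi>y_deriv H_deriv)
  moreover have "((\<lambda>t. ip_at h (\<phi> (y t)) (Hf (y t)) (Hf (y t))) has_vector_derivative 0) (at t)"
    by (rule locally_constant_has_vector_derivative[OF open_I t]) (rule H_null(1)[OF y_in])
  ultimately have "P t (Hf (y t)) + P t (Hf (y t)) = 0" by (rule vector_derivative_unique_at)
  then show ?thesis by simp
qed

lemma P_linear: "t \<in> I \<Longrightarrow> P t (v + w) = P t v + P t w" "t \<in> I \<Longrightarrow> P t (v - w) = P t v - P t w"
  "t \<in> I \<Longrightarrow> P t (c *\<^sub>R v) = c * P t v"
  unfolding P_def by (rule cov_ip_linear[OF \<phi>y_V]; assumption)+

text \<open>Where the velocity is \<open>cb \<eta>\<close>, the derivative of \<open><Hf,Zf> = 0\<close> along the curve moves the covariant derivative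
from \<open>Hf\<close> to \<open>Zf\<close>; by symmetry of the connection, the derivative of \<open>Zf\<close> along \<open>\<eta>\<close> and that of \<open>Hf\<close> along \<open>\<zeta>\<close> have the
same pairing with \<open>Hf\<close>, as they differ by a vector tangent to the surface; and twice the latter pairing is \<open>\<zeta><Hf,Hf> = \<theta>\<close>.\<close>

lemma P_Z_at_second_kind:
  assumes t: "t \<in> I" and ca: "ca t = 0"
  shows "P t (Zf (y t)) = - cb t * \<theta> (y t) / 2"
proof -
  define u where "u = y t"
  have u: "u \<in> Z \<inter> \<Omega>" "u \<in> \<Omega>" using y_in[OF t] by (auto simp: u_def)
  define D2 where "D2 v w = Dir (\<lambda>x. Dir \<phi> x v) u w" for v w
  have b0: "cb t \<noteq> 0"
    using y(3)[of t] t y'_decomposition[OF t] ca by (auto simp: I_def y'_def)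
  have y': "y' t = cb t *\<^sub>R \<eta> u" using y'_decomposition[OF t] ca by (simp add: u_def)
  have x': "x' t = cb t *\<^sub>R Hf u" using x'_decomposition[OF t] ca by (simp add: u_def)
  have H': "H' t = cb t *\<^sub>R Dir Hf u (\<eta> u)"
    using linear_cmul[OF linear_Dir[OF smooth_Hf u(2)]] by (simp add: H'_def y' flip: u_def)
  have dH: "Dir Hf u w = D2 (\<eta> u) w + Dir \<phi> u (Dir \<eta> u w)" for w
    unfolding Hf_def[abs_def] D2_def
    by (rule fun_cong[OF frechet_derivative_at[OF has_derivative_directional[OF \<Omega> \<phi>(1) \<eta>(1) u(2)], symmetric]])
  have dZ: "Dir Zf u w = D2 (\<zeta> u) w + Dir \<phi> u (Dir \<zeta> u w)" for w
    unfolding Zf_def[abs_def] D2_def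
    by (rule fun_cong[OF frechet_derivative_at[OF has_derivative_directional[OF \<Omega> \<phi>(1) smooth_\<zeta> u(2)], symmetric]])
  have sym: "D2 (\<zeta> u) (\<eta> u) = D2 (\<eta> u) (\<zeta> u)"
    unfolding D2_def by (rule second_derivative_symmetric[OF \<Omega> \<phi>(1) u(2)])
  have d: "((\<lambda>s. ip_at h (\<phi> (u + s *\<^sub>R w)) (F (u + s *\<^sub>R w)) (G (u + s *\<^sub>R w))) has_vector_derivative
      cov_ip h (\<phi> u) (G u) (Dir \<phi> u w) (F u) (Dir F u w) + cov_ip h (\<phi> u) (F u) (Dir \<phi> u w) (G u) (Dir G u w)) (at 0)"
    if "smooth_on \<Omega> F" "smooth_on \<Omega> G" for F G w
  proof -
    have a: "((\<lambda>s. f (u + s *\<^sub>R w)) has_vector_derivative Dir f u w) (at 0)" if "smooth_on \<Omega> f" for f :: "real ^ 2 \<Rightarrow> real ^ 3"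
      using smooth_on_compose_has_vector_derivative[OF that _ affine_has_vector_derivative, of u 0 w] u by simp
    show ?thesis
      using cov_ip_product_rule[OF _ a[OF \<phi>(1)] a[OF that(1)] a[OF that(2)]] \<phi>_V[OF u(2)] by simp
  qed
  have dd: "((\<lambda>s. m (u + s *\<^sub>R w)) has_vector_derivative Dir m u w) (at 0)" if "smooth_on \<Omega> m" for m :: "real ^ 2 \<Rightarrow> real" and w
    using smooth_on_compose_has_vector_derivative[OF that _ affine_has_vector_derivative, of u 0 w] u by simp
  let ?m = "\<lambda>u. ip_at h (\<phi> u) (Hf u) (Zf u)"
  have sm: "smooth_on \<Omega> ?m" by (intro smooth_on_ip_at \<Omega> \<phi> smooth_Hf smooth_Zf)
  have "cb t * Dir ?m u (\<eta> u) = 0"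
    using zero_along_deriv[OF sm H_null(2) t] linear_cmul[OF linear_Dir[OF sm u(2)]]
    by (simp add: y' flip: u_def)
  then have 1: "Dir ?m u (\<eta> u) = 0" using b0 by simp
  have 2: "cov_ip h (\<phi> u) (Zf u) (Hf u) (Hf u) (Dir Hf u (\<eta> u)) + cov_ip h (\<phi> u) (Hf u) (Hf u) (Zf u) (Dir Zf u (\<eta> u)) = 0"
    using vector_derivative_unique_at[OF dd[OF sm] d[OF smooth_Hf smooth_Zf], of "\<eta> u"] 1
    by (simp flip: Hf_def)
  have 3: "\<theta> u = 2 * cov_ip h (\<phi> u) (Hf u) (Zf u) (Hf u) (Dir Hf u (\<zeta> u))"
    using vector_derivative_unique_at[OF dd[OF smooth_\<mu>, unfolded \<mu>_def] d[OF smooth_Hf smooth_Hf], of "\<zeta> u"]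
    by (simp add: \<theta>_def flip: Zf_def \<mu>_def)
  \<comment> \<open>Here the second derivatives of \<open>\<phi>\<close> cancel by symmetry, and those of \<open>\<eta>\<close> and \<open>\<zeta>\<close> contribute only tangent vectors.\<close>
  have 4: "cov_ip h (\<phi> u) (Hf u) (Hf u) (Zf u) (Dir Zf u (\<eta> u)) = cov_ip h (\<phi> u) (Hf u) (Zf u) (Hf u) (Dir Hf u (\<zeta> u))"
    using null[OF u(1)]
    by (simp add: cov_ip_def christoffel_first_def dZ dH sym ip_at_linear Hf_def[symmetric] add.commute)
       (use Dir_h_sym[OF \<phi>_V[OF u(2)], of "Hf u" "Hf u" "Zf u"] in simp)
  have "P t (Zf u) = cb t * cov_ip h (\<phi> u) (Zf u) (Hf u) (Hf u) (Dir Hf u (\<eta> u))"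
    unfolding P_def u_def[symmetric] x' H' cov_ip_linear(4)[OF \<phi>_V[OF u(2)]] ..
  also have "cov_ip h (\<phi> u) (Zf u) (Hf u) (Hf u) (Dir Hf u (\<eta> u)) = - \<theta> u / 2" using 2 3 4 by linarith
  finally show ?thesis by (simp add: u_def)
qed

lemma KH_nonzero: "KH 0 \<noteq> 0"
proof -
  have "h (\<phi> (y 0)) *v Hf (y 0) \<noteq> 0"
    using lorentzian_form_nondegenerate[OF lorentzian[OF \<phi>y_V[OF zero_I]]] H_nonzero[OF y_in[OF zero_I]] by blast
  then show ?thesis by (simp add: KH_def ip_at_def K_def)
qed

lemma cb_nonzero: "t \<in> I \<Longrightarrow> ca t = 0 \<Longrightarrow> cb t \<noteq> 0"
  using y(3)[of t] y'_decomposition[of t] by (auto simp: I_def y'_def)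

text \<open>At \<open>0\<close> every summand of \<open>Q\<close> but one contains \<open>ca\<close> or its derivative; the remaining one is
\<open>cb\<^sup>2 \<theta> / (2r)\<close>.\<close>

lemma Q_limit:
  assumes ca: "ca 0 = 0" "vector_derivative ca (at 0) = 0" and \<theta>: "\<theta> (y 0) \<noteq> 0"
  shows "isCont Q 0" "Q 0 \<noteq> 0"
proof -
  have c: "isCont F 0" if "smooth_on I F" for F :: "real \<Rightarrow> real"
    using smooth_on_isCont[OF that open_I zero_I] .
  have r: "r (y 0) \<noteq> 0" using r_pos[OF y_in[OF zero_I]] by simp
  show "isCont Q 0"
    unfolding Q_def[abs_def] using KH_nonzero \<theta> r cb_nonzero[OF zero_I ca(1)]
    by (intro continuous_intros c smooth_ca smooth_cb smooth_KH smooth_KZ smooth_P smooth_along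
        smooth_on_const smooth_Zf smooth_r smooth_\<theta> smooth_on_vector_derivative open_I) auto
  show "Q 0 \<noteq> 0"
    unfolding Q_def using ca P_Z_at_second_kind[OF zero_I ca(1)] \<theta> r cb_nonzero[OF zero_I ca(1)] by simp
qed


lemma x'_norm: "t \<in> I \<Longrightarrow> ip_at h (\<phi> (y t)) (x' t) (x' t) = (ca t)\<^sup>2 * r (y t)"
  using H_null[OF y_in[of t]]
  by (simp add: x'_decomposition ip_at_linear r_def power2_eq_square)

lemma x'_H: "t \<in> I \<Longrightarrow> ip_at h (\<phi> (y t)) (x' t) (Hf (y t)) = 0"
  using H_null[OF y_in[of t]] by (simp add: x'_decomposition ip_at_linear)

lemma K_x': "t \<in> I \<Longrightarrow> ip_at h (\<phi> (y t)) K (x' t) = ca t * KZ t + cb t * KH t"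
  by (simp add: x'_decomposition ip_at_linear KZ_def KH_def)

lemma P_x': "t \<in> I \<Longrightarrow> P t (x' t) = ca t * P t (Zf (y t))"
  using P_H[of t] by (simp add: x'_decomposition P_linear)

text \<open>The logarithmic derivative of \<open>\<beta> = - ca \<theta> / cb\<close>. Multiplied by \<open>ca\<close> it stays bounded near zeros of \<open>ca\<close>.\<close>

lemma \<beta>_log_deriv:
  assumes t: "t \<in> I" and nz: "ca t \<noteq> 0" "cb t \<noteq> 0" "\<theta> (y t) \<noteq> 0"
  shows "ca t * Dir \<beta> (y t) (y' t) / \<beta> (y t) = vector_derivative ca (at t)
    + ca t * vector_derivative (\<lambda>t. \<theta> (y t)) (at t) / \<theta> (y t)
    - ca t * vector_derivative cb (at t) / cb t"
proof -
  note d = smooth_on_has_vector_derivative[OF _ t]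
  let ?\<theta>' = "vector_derivative (\<lambda>t. \<theta> (y t)) (at t)"
  have "((\<lambda>t. cb t * \<beta> (y t) + ca t * \<theta> (y t)) has_vector_derivative
      (cb t * Dir \<beta> (y t) (y' t) + vector_derivative cb (at t) * \<beta> (y t)) +
      (ca t * ?\<theta>' + vector_derivative ca (at t) * \<theta> (y t))) (at t)"
    by (intro has_vector_derivative_add has_vector_derivative_mult d smooth_ca smooth_cb
        smooth_along smooth_\<theta> along_deriv[OF smooth_\<beta> t])
  moreover have "((\<lambda>t. cb t * \<beta> (y t) + ca t * \<theta> (y t)) has_vector_derivative 0) (at t)"
    by (rule locally_constant_has_vector_derivative[OF open_I t, where c = 0]) (simp add: cb_\<beta>)
  ultimately have "(cb t * Dir \<beta> (y t) (y' t) + vector_derivative cb (at t) * \<beta> (y t)) +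
      (ca t * ?\<theta>' + vector_derivative ca (at t) * \<theta> (y t)) = 0"
    by (rule vector_derivative_unique_at)
  then have 1: "cb t * Dir \<beta> (y t) (y' t) = - (vector_derivative cb (at t) * \<beta> (y t))
      - (ca t * ?\<theta>' + vector_derivative ca (at t) * \<theta> (y t))" by linarith
  have \<beta>: "\<beta> (y t) = - ca t * \<theta> (y t) / cb t"
    using cb_\<beta>[OF t] nz by (simp add: field_simps)
  have D: "Dir \<beta> (y t) (y' t) = (- (vector_derivative cb (at t) * \<beta> (y t))
      - (ca t * ?\<theta>' + vector_derivative ca (at t) * \<theta> (y t))) / cb t"
    unfolding 1[symmetric] using nz by simp
  show ?thesis unfolding D \<beta> using nz by (simp add: field_simps)
qed

text \<open>The normalized null field is \<open>\<nu> \<eta>\<close> with \<open>\<nu>\<^sup>3 \<beta> = 1\<close>; the sign \<open>\<sigma>\<close> of \<open>\<beta>\<close> is split off because real powers want a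
positive base. The curve is reparametrized by arc length on an interval whose image is exactly the set of
lightlike points in \<open>W\<close>. The field \<open>N\<close> is the null vector in the plane spanned by \<open>L\<close> and the part \<open>m\<close> of \<open>K\<close> orthogonal
to the unit velocity, scaled to have pairing \<open>1\<close> with \<open>L\<close>.\<close>

lemma torsion_at_first_kind:
  assumes t0: "t0 \<in> I" and nz: "ca t0 \<noteq> 0" "cb t0 \<noteq> 0" "\<theta> (y t0) \<noteq> 0" "KH t0 \<noteq> 0"
  obtains a b yt U W \<eta>1 N \<kappa> where
    "a < 0" "0 < b" "yt 0 = y t0" "smooth_on {a<..<b} yt" "yt ` {a<..<b} \<subseteq> U"
    "\<And>s. s \<in> {a<..<b} \<Longrightarrow> vector_derivative yt (at s) \<noteq> 0"
    "open U" "U \<subseteq> \<Omega>" "open W" "W \<subseteq> U" "y t0 \<in> W" "Z \<inter> W = yt ` {a<..<b}"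
    "smooth_on U \<eta>1" "\<And>u. u \<in> U \<Longrightarrow> \<exists>c. c \<noteq> 0 \<and> \<eta>1 u = c *\<^sub>R \<eta> u"
    "\<And>u. u \<in> Z \<inter> U \<Longrightarrow> Dir (\<lambda>u. ip_at h (\<phi> u) (Dir \<phi> u (\<eta>1 u)) (Dir \<phi> u (\<eta>1 u))) u (\<eta>1 u) = 1"
    "smooth_on {a<..<b} N"
    "\<And>s. s \<in> {a<..<b} \<Longrightarrow> ip_at h (\<phi> (yt s)) (vector_derivative (\<lambda>s. \<phi> (yt s)) (at s)) (vector_derivative (\<lambda>s. \<phi> (yt s)) (at s)) = 1"
    "\<And>s. s \<in> {a<..<b} \<Longrightarrow> ip_at h (\<phi> (yt s)) (N s) (vector_derivative (\<lambda>s. \<phi> (yt s)) (at s)) = 0"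
    "\<And>s. s \<in> {a<..<b} \<Longrightarrow> ip_at h (\<phi> (yt s)) (N s) (N s) = 0"
    "\<And>s. s \<in> {a<..<b} \<Longrightarrow> ip_at h (\<phi> (yt s)) (N s) (Dir \<phi> (yt s) (\<eta>1 (yt s))) = 1"
    "\<kappa> = cov_ip h (\<phi> (yt 0)) (Dir \<phi> (yt 0) (\<eta>1 (yt 0))) (vector_derivative (\<lambda>s. \<phi> (yt s)) (at 0))
        (N 0) (vector_derivative N (at 0))"
    "\<kappa> * (ca t0 * sqrt ((ca t0)\<^sup>2 * r (y t0))) = - Q t0"
proof -
  have yt0: "y t0 \<in> Z \<inter> \<Omega>" using y_in[OF t0] .
  have \<beta>0: "\<beta> (y t0) \<noteq> 0" using cb_\<beta>[OF t0] nz by auto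
  define \<sigma> where "\<sigma> = sgn (\<beta> (y t0))"
  have \<sigma>: "\<sigma> * \<sigma> = 1" "\<sigma> * \<beta> (y t0) > 0" using \<beta>0 by (auto simp: \<sigma>_def sgn_if)
  define U where "U = {u \<in> \<Omega>. \<sigma> * \<beta> u > 0}"
  have U\<Omega>: "U \<subseteq> \<Omega>" by (auto simp: U_def)
  have U: "open U"
  proof -
    have "U = \<Omega> \<inter> (\<lambda>u. \<sigma> * \<beta> u) -` {0<..}" by (auto simp: U_def)
    then show ?thesis
      using continuous_open_preimage[OF _ \<Omega> open_greaterThan, of "\<lambda>u. \<sigma> * \<beta> u" 0]
        smooth_on_continuous_on[OF smooth_\<beta>] by (simp add: continuous_on_mult)
  qed
  define \<nu> where "\<nu> u = \<sigma> * (\<sigma> * \<beta> u) powr (-1/3)" for u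
  have \<nu>: "smooth_on U \<nu>"
    unfolding \<nu>_def
    by (intro smooth_on_mult smooth_on_powr_compose smooth_on_const U smooth_on_subset[OF smooth_\<beta> U\<Omega>])
      (auto simp: U_def)
  have \<nu>3: "\<nu> u * \<nu> u * \<nu> u * \<beta> u = 1" if "u \<in> U" for u
  proof -
    define s where "s = \<sigma> * \<beta> u"
    have s: "s > 0" using that by (simp add: U_def s_def)
    have "s powr (-1/3) * s powr (-1/3) * s powr (-1/3) = s powr (-1/3 + -1/3 + -1/3)"
      by (simp only: powr_add)
    also have "\<dots> = 1 / s" using s by (simp add: powr_minus_divide)
    finally have p: "s powr (-1/3) * s powr (-1/3) * s powr (-1/3) = 1 / s" .
    have eq: "\<nu> u * \<nu> u * \<nu> u * \<beta> u = (\<sigma> * \<sigma>) * (\<sigma> * \<beta> u) * (s powr (-1/3) * s powr (-1/3) * s powr (-1/3))"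
      by (simp add: \<nu>_def s_def mult_ac)
    show ?thesis unfolding eq p \<sigma>(1) s_def[symmetric] using s by simp
  qed
  have \<nu>nz: "\<nu> u \<noteq> 0" if "u \<in> U" for u using \<nu>3[OF that] by auto
  define \<eta>1 where "\<eta>1 u = \<nu> u *\<^sub>R \<eta> u" for u
  have L: "Dir \<phi> u (\<eta>1 u) = \<nu> u *\<^sub>R Hf u" if "u \<in> U" for u
    using linear_D\<phi>[of u] that U\<Omega> by (auto simp: \<eta>1_def Hf_def linear_cmul)
  have normalized: "Dir (\<lambda>u. ip_at h (\<phi> u) (Dir \<phi> u (\<eta>1 u)) (Dir \<phi> u (\<eta>1 u))) u (\<eta>1 u) = 1"
    if u: "u \<in> Z \<inter> U" for u
  proof -
    have u\<Omega>: "u \<in> Z \<inter> \<Omega>" using u U\<Omega> by auto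
    have "((\<lambda>u. \<nu> u * \<nu> u * \<mu> u) has_derivative
        (\<lambda>w. (\<nu> u * \<nu> u) * Dir \<mu> u w + (\<nu> u * Dir \<nu> u w + Dir \<nu> u w * \<nu> u) * \<mu> u)) (at u)"
      using u u\<Omega> by (intro has_derivative_mult smooth_on_has_derivative[OF \<nu>] smooth_on_has_derivative[OF smooth_\<mu>]) auto
    then have "((\<lambda>u. ip_at h (\<phi> u) (Dir \<phi> u (\<eta>1 u)) (Dir \<phi> u (\<eta>1 u))) has_derivative
        (\<lambda>w. (\<nu> u * \<nu> u) * Dir \<mu> u w + (\<nu> u * Dir \<nu> u w + Dir \<nu> u w * \<nu> u) * \<mu> u)) (at u)"
      by (rule has_derivative_transform_within_open[OF _ U]) (use u in \<open>auto simp: L ip_at_linear \<mu>_def\<close>)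
    from fun_cong[OF frechet_derivative_at[OF this], of "\<eta>1 u"]
    have "Dir (\<lambda>u. ip_at h (\<phi> u) (Dir \<phi> u (\<eta>1 u)) (Dir \<phi> u (\<eta>1 u))) u (\<eta>1 u) = \<nu> u * \<nu> u * Dir \<mu> u (\<eta>1 u)"
      using \<mu>_zero[OF u\<Omega>] by simp
    also have "\<dots> = \<nu> u * \<nu> u * \<nu> u * \<beta> u"
      using linear_cmul[OF linear_Dir[OF smooth_\<mu>, of u]] u\<Omega> by (simp add: \<eta>1_def \<beta>_def)
    finally show ?thesis using \<nu>3 u by simp
  qed
  have "\<forall>\<^sub>F t in at t0. t \<in> I \<and> y t \<in> U \<and> ca t \<noteq> 0 \<and> KH t \<noteq> 0"
  proof (intro eventually_conj)
    show "\<forall>\<^sub>F t in at t0. t \<in> I" using t0 eventually_at_topological open_I by blast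
    have "y t0 \<in> U" using yt0 \<sigma> by (simp add: U_def)
    then show "\<forall>\<^sub>F t in at t0. y t \<in> U"
      using smooth_on_isCont[OF y_smooth open_I t0] U by (auto simp: isCont_def elim: topological_tendstoD)
    show "\<forall>\<^sub>F t in at t0. ca t \<noteq> 0" "\<forall>\<^sub>F t in at t0. KH t \<noteq> 0"
      using smooth_on_isCont[OF smooth_ca open_I t0] smooth_on_isCont[OF smooth_KH open_I t0] nz
      by (auto simp: isCont_def intro: tendsto_imp_eventually_ne)
  qed
  then obtain d where d: "d > 0" "\<And>t. t \<noteq> t0 \<Longrightarrow> dist t t0 < d \<Longrightarrow> t \<in> I \<and> y t \<in> U \<and> ca t \<noteq> 0 \<and> KH t \<noteq> 0"
    unfolding eventually_at by blast
  define J where "J = {t0 - d<..<t0 + d}"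
  have J: "t \<in> I" "y t \<in> U" "ca t \<noteq> 0" "KH t \<noteq> 0" if "t \<in> J" for t
    using d(2)[of t] that t0 yt0 \<sigma> nz by (cases "t = t0"; auto simp: J_def dist_real_def U_def)+
  have oJ: "open J" "t0 \<in> J" using d by (auto simp: J_def)
  have JI: "J \<subseteq> I" using J by auto
  have "\<exists>t1 t2 W. t0 - d < t1 \<and> t0 - 1 < t1 \<and> t1 < t0 \<and> t0 < t2 \<and> t2 < t0 + 1 \<and> t2 < t0 + d \<and>
    open W \<and> W \<subseteq> U \<and> y t0 \<in> W \<and> Z \<inter> W = y ` {t1<..<t2}"
  proof (rule zero_set_locally_arc[OF U smooth_on_subset[OF smooth_\<mu> U\<Omega>]])
    show "smooth_on {t0 - d<..<t0 + d} y" using smooth_on_subset[OF y_smooth JI] by (simp add: J_def)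
    show "y ` {t0 - d<..<t0 + d} \<subseteq> Z \<inter> U" using J(1,2) y_in by (auto simp: J_def)
    show "vector_derivative y (at t0) \<noteq> 0" using y(3)[of t0] t0 by (simp add: I_def)
    show "Dir \<mu> (y t0) (\<zeta> (y t0)) \<noteq> 0" using nz(3) by (simp add: \<theta>_def)
  qed (use \<mu>_zero U\<Omega> d in auto)
  then obtain t1 t2 W where t: "t0 - d < t1" "t1 < t0" "t0 < t2" "t2 < t0 + d"
    and W: "open W" "W \<subseteq> U" "y t0 \<in> W" "Z \<inter> W = y ` {t1<..<t2}" by blast
  have tJ: "{t1..t2} \<subseteq> J" using t by (auto simp: J_def)
  \<comment> \<open>The speed of the image of the curve; a power with real exponent is smooth where the base is positive.\<close>
  define \<rho> where "\<rho> t = ((ca t)\<^sup>2 * r (y t)) powr (1/2)" for t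
  have pos: "(ca t)\<^sup>2 * r (y t) > 0" if "t \<in> J" for t
    using J[OF that] r_pos[OF y_in[of t]] by simp
  have \<rho>_pos: "\<rho> t > 0" if "t \<in> J" for t
    unfolding \<rho>_def powr_gt_zero using pos[OF that] by (rule less_imp_neq[THEN not_sym])
  have \<rho>2: "\<rho> t * \<rho> t = (ca t)\<^sup>2 * r (y t)" if "t \<in> J" for t
    using pos[OF that] by (simp add: \<rho>_def powr_half_sqrt)
  have \<rho>: "smooth_on J \<rho>"
    unfolding \<rho>_def power2_eq_square
    by (intro smooth_on_powr_compose smooth_on_mult oJ smooth_on_subset[OF smooth_ca JI]
        smooth_on_subset[OF smooth_along[OF smooth_r] JI]) (use pos in \<open>simp add: power2_eq_square\<close>)
  obtain a b \<tau> where ab: "a < 0" "0 < b" and \<tau>: "\<tau> 0 = t0" "\<tau> ` {a<..<b} = {t1<..<t2}" "smooth_on {a<..<b} \<tau>"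
    and \<tau>': "\<And>s. s \<in> {a<..<b} \<Longrightarrow> (\<tau> has_vector_derivative inverse (\<rho> (\<tau> s))) (at s)"
    using arc_length_parameter[OF \<rho> oJ(1) t(2,3) tJ] \<rho>_pos tJ by blast
  have \<tau>J: "\<tau> s \<in> J" if "s \<in> {a<..<b}" for s
    using \<tau>(2) tJ that by (metis greaterThanLessThan_subseteq_atLeastAtMost_iff image_subset_iff order_refl subsetD)
  have oab: "open {a<..<b}" "0 \<in> {a<..<b}" using ab by auto
  have along: "smooth_on {a<..<b} (\<lambda>s. F (\<tau> s))" if "smooth_on I F" for F :: "real \<Rightarrow> 'b::euclidean_space"
    by (rule smooth_on_compose[OF oab(1) open_I _ that \<tau>(3)]) (use \<tau>J JI in auto)
  have along_d: "((\<lambda>s. F (\<tau> s)) has_vector_derivative inverse (\<rho> (\<tau> s)) *\<^sub>R F') (at s)"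
    if "s \<in> {a<..<b}" "(F has_vector_derivative F') (at (\<tau> s))" for F :: "real \<Rightarrow> 'b::real_normed_vector" and F' s
    using vector_diff_chain_at[OF \<tau>'[OF that(1)] that(2)] by (simp add: comp_def)
  define yt where "yt s = y (\<tau> s)" for s
  have yt: "smooth_on {a<..<b} yt" unfolding yt_def by (rule along[OF y_smooth])
  have yt': "vector_derivative yt (at s) = inverse (\<rho> (\<tau> s)) *\<^sub>R y' (\<tau> s)" if "s \<in> {a<..<b}" for s
    unfolding yt_def using that \<tau>J JI by (intro vector_derivative_at along_d y_deriv) auto
  have yt_U: "yt s \<in> U" if "s \<in> {a<..<b}" for s
    using J(2)[OF \<tau>J[OF that]] by (simp add: yt_def)
  define e where "e s = vector_derivative (\<lambda>s. \<phi> (yt s)) (at s)" for s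
  have e_d: "((\<lambda>s. \<phi> (yt s)) has_vector_derivative e s) (at s)" "e s = inverse (\<rho> (\<tau> s)) *\<^sub>R x' (\<tau> s)" if "s \<in> {a<..<b}" for s
  proof -
    have 1: "((\<lambda>s. \<phi> (yt s)) has_vector_derivative inverse (\<rho> (\<tau> s)) *\<^sub>R x' (\<tau> s)) (at s)"
      unfolding yt_def using that \<tau>J JI by (intro along_d \<phi>y_deriv) auto
    then show 2: "e s = inverse (\<rho> (\<tau> s)) *\<^sub>R x' (\<tau> s)" unfolding e_def by (rule vector_derivative_at)
    show "((\<lambda>s. \<phi> (yt s)) has_vector_derivative e s) (at s)" using 1 2 by simp
  qed
  have sxt: "smooth_on {a<..<b} (\<lambda>s. \<phi> (yt s))" unfolding yt_def by (rule along[OF smooth_along[OF \<phi>(1)]])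
  have se: "smooth_on {a<..<b} e" unfolding e_def by (rule smooth_on_vector_derivative[OF oab(1) sxt])
  define L where "L s = Dir \<phi> (yt s) (\<eta>1 (yt s))" for s
  have L_eq: "L s = \<nu> (yt s) *\<^sub>R Hf (yt s)" if "s \<in> {a<..<b}" for s
    unfolding L_def by (rule L[OF yt_U[OF that]])
  have sL: "smooth_on {a<..<b} L"
  proof -
    have "smooth_on {a<..<b} (\<lambda>s. \<nu> (yt s) *\<^sub>R Hf (yt s))"
      by (intro smooth_on_scaleR oab(1) smooth_on_compose[OF oab(1) U _ _ yt] \<nu> smooth_on_subset[OF smooth_Hf U\<Omega>])
        (use yt_U in auto)
    then show ?thesis by (subst smooth_on_cong[OF oab(1) L_eq]) auto
  qed
  let ?ip = "\<lambda>s. ip_at h (\<phi> (yt s))"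
  have V: "\<phi> (yt s) \<in> V" if "s \<in> {a<..<b}" for s using yt_U[OF that] U\<Omega> \<phi>_V by auto
  have ee: "?ip s (e s) (e s) = 1" if s: "s \<in> {a<..<b}" for s
    using x'_norm[of "\<tau> s"] \<rho>2[OF \<tau>J[OF s]] \<rho>_pos[OF \<tau>J[OF s]] \<tau>J[OF s] JI e_d(2)[OF s]
    by (auto simp: ip_at_linear yt_def field_simps subset_iff)
  have LL: "?ip s (L s) (L s) = 0" if s: "s \<in> {a<..<b}" for s
    using H_null(1)[OF y_in] \<tau>J[OF s] JI by (auto simp: L_eq[OF s] ip_at_linear yt_def)
  have eL: "?ip s (e s) (L s) = 0" "?ip s (L s) (e s) = 0" if s: "s \<in> {a<..<b}" for s
  proof -
    show "?ip s (e s) (L s) = 0"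
      using x'_H[of "\<tau> s"] \<tau>J[OF s] JI by (auto simp: L_eq[OF s] e_d(2)[OF s] ip_at_linear yt_def)
    then show "?ip s (L s) (e s) = 0" using ip_at_sym[OF V[OF s]] by simp
  qed
  define k where "k s = ?ip s K (L s)" for s
  have k_nz: "k s \<noteq> 0" if s: "s \<in> {a<..<b}" for s
    using J(4)[OF \<tau>J[OF s]] \<nu>nz[OF yt_U[OF s]] by (simp add: k_def L_eq[OF s] ip_at_linear yt_def KH_def)
  define m where "m s = K - ?ip s K (e s) *\<^sub>R e s" for s
  define N where "N s = (1 / k s) *\<^sub>R (m s - (?ip s (m s) (m s) / (2 * k s)) *\<^sub>R L s)" for s
  have xtV: "(\<lambda>s. \<phi> (yt s)) ` {a<..<b} \<subseteq> V" using V by auto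
  have sm: "smooth_on {a<..<b} m"
    unfolding m_def by (intro smooth_on_diff smooth_on_scaleR smooth_on_ip_at smooth_on_const oab(1) sxt xtV se)
  have sk: "smooth_on {a<..<b} k"
    unfolding k_def by (intro smooth_on_ip_at smooth_on_const oab(1) sxt xtV sL)
  have sN: "smooth_on {a<..<b} N"
    unfolding N_def using k_nz
    by (intro smooth_on_diff smooth_on_scaleR smooth_on_divide smooth_on_mult smooth_on_ip_at smooth_on_const oab(1) sxt xtV sm sk sL) auto
  have mL: "?ip s (m s) (L s) = k s" "?ip s (L s) (m s) = k s" if s: "s \<in> {a<..<b}" for s
    using eL[OF s] ip_at_sym[OF V[OF s], of "L s" K] by (simp_all add: m_def ip_at_linear k_def)
  have me: "?ip s (m s) (e s) = 0" if s: "s \<in> {a<..<b}" for s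
    using ee[OF s] by (simp add: m_def ip_at_linear)
  have NL: "?ip s (N s) (L s) = 1" if s: "s \<in> {a<..<b}" for s
    using mL[OF s] LL[OF s] k_nz[OF s] by (simp add: N_def ip_at_linear)
  have Ne: "?ip s (N s) (e s) = 0" if s: "s \<in> {a<..<b}" for s
    using me[OF s] eL[OF s] by (simp add: N_def ip_at_linear)
  have NN: "?ip s (N s) (N s) = 0" if s: "s \<in> {a<..<b}" for s
    using mL[OF s] LL[OF s] k_nz[OF s] by (simp add: N_def ip_at_linear)
  define \<kappa> where "\<kappa> = cov_ip h (\<phi> (yt 0)) (L 0) (e 0) (N 0) (vector_derivative N (at 0))"
  note 0 = oab(2)
  define \<nu>' where "\<nu>' = Dir \<nu> (y t0) (y' t0)"
  have L': "(L has_vector_derivative inverse (\<rho> t0) *\<^sub>R (\<nu> (y t0) *\<^sub>R H' t0 + \<nu>' *\<^sub>R Hf (y t0))) (at 0)"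
  proof -
    have "((\<lambda>t. \<nu> (y t)) has_vector_derivative \<nu>') (at t0)"
      unfolding \<nu>'_def using smooth_on_compose_has_vector_derivative[OF \<nu> _ y_deriv[OF t0]] J(2)[OF oJ(2)] by simp
    then have "((\<lambda>t. \<nu> (y t) *\<^sub>R Hf (y t)) has_vector_derivative \<nu> (y t0) *\<^sub>R H' t0 + \<nu>' *\<^sub>R Hf (y t0)) (at t0)"
      by (intro bounded_bilinear.has_vector_derivative[OF bounded_bilinear_scaleR] H_deriv t0)
    then have "((\<lambda>s. \<nu> (y (\<tau> s)) *\<^sub>R Hf (y (\<tau> s))) has_vector_derivative inverse (\<rho> t0) *\<^sub>R (\<nu> (y t0) *\<^sub>R H' t0 + \<nu>' *\<^sub>R Hf (y t0))) (at 0)"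
      using along_d[OF 0, of "\<lambda>t. \<nu> (y t) *\<^sub>R Hf (y t)"] \<tau>(1) by simp
    then show ?thesis
      by (rule has_vector_derivative_transform_within_open[OF _ oab]) (simp add: L_eq yt_def)
  qed
  have yt00: "yt 0 = y t0" by (simp add: yt_def \<tau>(1))
  have Vt0: "\<phi> (y t0) \<in> V" by (rule \<phi>y_V[OF t0])
  have "((\<lambda>s. ?ip s (L s) (N s)) has_vector_derivative
      cov_ip h (\<phi> (yt 0)) (N 0) (e 0) (L 0) (inverse (\<rho> t0) *\<^sub>R (\<nu> (y t0) *\<^sub>R H' t0 + \<nu>' *\<^sub>R Hf (y t0))) + \<kappa>) (at 0)"
    unfolding \<kappa>_def
    by (intro cov_ip_product_rule V[OF 0] e_d(1)[OF 0] L' smooth_on_has_vector_derivative[OF sN 0])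
  moreover have "((\<lambda>s. ?ip s (L s) (N s)) has_vector_derivative 0) (at 0)"
    by (rule locally_constant_has_vector_derivative[OF oab, where c = 1])
      (use NL ip_at_sym[OF V] in metis)
  ultimately have "cov_ip h (\<phi> (yt 0)) (N 0) (e 0) (L 0) (inverse (\<rho> t0) *\<^sub>R (\<nu> (y t0) *\<^sub>R H' t0 + \<nu>' *\<^sub>R Hf (y t0))) + \<kappa> = 0"
    by (rule vector_derivative_unique_at)
  moreover have "cov_ip h (\<phi> (yt 0)) (N 0) (e 0) (L 0) (inverse (\<rho> t0) *\<^sub>R (\<nu> (y t0) *\<^sub>R H' t0 + \<nu>' *\<^sub>R Hf (y t0)))
      = inverse (\<rho> t0) * (\<nu> (y t0) * P t0 (N 0) + \<nu>' * ?ip 0 (N 0) (Hf (y t0)))"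
    unfolding e_d(2)[OF 0] L_eq[OF 0] yt00 \<tau>(1) cov_ip_linear(4,5)[OF Vt0] P_def ..
  \<comment> \<open>Moving the derivative from \<open>N\<close> to \<open>L\<close> leaves only the value of \<open>N\<close> at the point.\<close>
  ultimately have \<kappa>1: "\<kappa> = - inverse (\<rho> t0) * (\<nu> (y t0) * P t0 (N 0) + \<nu>' * ?ip 0 (N 0) (Hf (y t0)))"
    by linarith
  define n where "n = \<nu> (y t0)"
  have n: "n \<noteq> 0" using \<nu>nz[OF yt_U[OF 0]] by (simp add: n_def yt00)
  have NH: "?ip 0 (N 0) (Hf (y t0)) = 1 / n"
    using NL[OF 0] n unfolding L_eq[OF 0] by (simp add: yt00 ip_at_linear n_def field_simps)
  have k0: "k 0 = n * KH t0" unfolding k_def L_eq[OF 0] by (simp add: yt00 ip_at_linear n_def KH_def)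
  have PL: "P t0 (L 0) = 0" unfolding L_eq[OF 0] yt00 by (simp add: P_linear[OF t0] P_H[OF t0])
  have PN: "P t0 (N 0) = (P t0 K - (ca t0 * KZ t0 + cb t0 * KH t0) * (ca t0 * P t0 (Zf (y t0))) / (\<rho> t0 * \<rho> t0)) / (n * KH t0)"
    unfolding N_def m_def
    by (simp add: P_linear[OF t0] PL e_d(2)[OF 0] k0 yt00 \<tau>(1) ip_at_linear K_x'[OF t0] P_x'[OF t0] divide_simps)
  have \<nu>'_eq: "\<nu>' / n = - Dir \<beta> (y t0) (y' t0) / (3 * \<beta> (y t0))"
  proof -
    have d\<nu>: "((\<lambda>t. \<nu> (y t)) has_vector_derivative \<nu>') (at t0)"
      unfolding \<nu>'_def using smooth_on_compose_has_vector_derivative[OF \<nu> _ y_deriv[OF t0]] J(2)[OF oJ(2)] by simp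
    have "((\<lambda>t. \<nu> (y t) * \<nu> (y t) * \<nu> (y t) * \<beta> (y t)) has_vector_derivative
        (n * n * n) * Dir \<beta> (y t0) (y' t0) + ((n * n) * \<nu>' + (n * \<nu>' + \<nu>' * n) * n) * \<beta> (y t0)) (at t0)"
      unfolding n_def by (intro has_vector_derivative_mult d\<nu> along_deriv[OF smooth_\<beta> t0])
    moreover have "((\<lambda>t. \<nu> (y t) * \<nu> (y t) * \<nu> (y t) * \<beta> (y t)) has_vector_derivative 0) (at t0)"
      by (rule locally_constant_has_vector_derivative[OF oJ]) (rule \<nu>3[OF J(2)])
    ultimately have "(n * n * n) * Dir \<beta> (y t0) (y' t0) + ((n * n) * \<nu>' + (n * \<nu>' + \<nu>' * n) * n) * \<beta> (y t0) = 0"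
      by (rule vector_derivative_unique_at)
    then have "(n * n) * (n * Dir \<beta> (y t0) (y' t0) + 3 * \<nu>' * \<beta> (y t0)) = 0" by (simp add: algebra_simps)
    then have "n * Dir \<beta> (y t0) (y' t0) + 3 * \<nu>' * \<beta> (y t0) = 0" using n by simp
    then show ?thesis using n \<beta>0 by (simp add: field_simps)
  qed
  have R: "r (y t0) \<noteq> 0" using r_pos[OF yt0] by simp
  have \<rho>0: "\<rho> t0 \<noteq> 0" using \<rho>_pos[OF oJ(2)] by simp
  have "\<kappa> * (ca t0 * \<rho> t0) = - (ca t0 * (n * P t0 (N 0)) + ca t0 * (\<nu>' / n))"
    unfolding \<kappa>1 NH n_def[symmetric] using \<rho>0 by (simp add: field_simps)
  also have "ca t0 * (\<nu>' / n) = - (ca t0 * Dir \<beta> (y t0) (y' t0) / \<beta> (y t0)) / 3"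
    unfolding \<nu>'_eq by simp
  also have "ca t0 * (n * P t0 (N 0)) = ca t0 * P t0 K / KH t0
      - (ca t0 * KZ t0 / KH t0 + cb t0) * P t0 (Zf (y t0)) / r (y t0)"
    unfolding PN \<rho>2[OF oJ(2)] using n nz R by (simp add: field_simps power2_eq_square)
  finally have "\<kappa> * (ca t0 * \<rho> t0) = - Q t0"
    unfolding \<beta>_log_deriv[OF t0 nz(1-3)] Q_def by (simp add: field_simps)
  then have \<kappa>2: "\<kappa> * (ca t0 * sqrt ((ca t0)\<^sup>2 * r (y t0))) = - Q t0"
    using pos[OF oJ(2)] by (simp add: \<rho>_def powr_half_sqrt)
  show ?thesis
  proof (rule that[of a b yt U W \<eta>1 N \<kappa>])
    show "a < 0" "0 < b" "yt 0 = y t0" "smooth_on {a<..<b} yt" by fact+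
    show "yt ` {a<..<b} \<subseteq> U" using yt_U by auto
    show "vector_derivative yt (at s) \<noteq> 0" if "s \<in> {a<..<b}" for s
      using yt'[OF that] \<rho>_pos[OF \<tau>J[OF that]] y(3)[of "\<tau> s"] \<tau>J[OF that] JI by (auto simp: y'_def I_def)
    show "open U" "U \<subseteq> \<Omega>" "open W" "W \<subseteq> U" "y t0 \<in> W" by fact+
    show "Z \<inter> W = yt ` {a<..<b}" unfolding W(4) \<tau>(2)[symmetric] yt_def by (simp add: image_image)
    show "smooth_on U \<eta>1" unfolding \<eta>1_def by (intro smooth_on_scaleR U \<nu> smooth_on_subset[OF \<eta>(1) U\<Omega>])
    show "\<exists>c. c \<noteq> 0 \<and> \<eta>1 u = c *\<^sub>R \<eta> u" if "u \<in> U" for u using \<nu>nz[OF that] by (auto simp: \<eta>1_def)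
    show "\<kappa> = cov_ip h (\<phi> (yt 0)) (Dir \<phi> (yt 0) (\<eta>1 (yt 0))) (vector_derivative (\<lambda>s. \<phi> (yt s)) (at 0))
        (N 0) (vector_derivative N (at 0))" unfolding \<kappa>_def L_def e_def ..
    show "ip_at h (\<phi> (yt s)) (vector_derivative (\<lambda>s. \<phi> (yt s)) (at s)) (vector_derivative (\<lambda>s. \<phi> (yt s)) (at s)) = 1"
      "ip_at h (\<phi> (yt s)) (N s) (vector_derivative (\<lambda>s. \<phi> (yt s)) (at s)) = 0"
      "ip_at h (\<phi> (yt s)) (N s) (N s) = 0"
      "ip_at h (\<phi> (yt s)) (N s) (Dir \<phi> (yt s) (\<eta>1 (yt s))) = 1" if "s \<in> {a<..<b}" for s
      using ee[OF that] Ne[OF that] NN[OF that] NL[OF that] unfolding e_def L_def by simp_all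
  qed (use normalized sN \<kappa>2 in auto)
qed

text \<open>The factor of \<open>\<kappa>\<close> in \<open>torsion_at_first_kind\<close> tends to \<open>0\<close>, while \<open>Q\<close> does not.\<close>

lemma torsion_large_near_second_kind:
  assumes ca: "ca 0 = 0" "vector_derivative ca (at 0) = 0" and \<theta>: "\<theta> (y 0) \<noteq> 0"
  shows "\<exists>\<epsilon>>0. \<forall>t. \<bar>t\<bar> < \<epsilon> \<longrightarrow> t \<in> I \<and> cb t \<noteq> 0 \<and> KH t \<noteq> 0 \<and> \<theta> (y t) \<noteq> 0 \<and>
    B * \<bar>ca t * sqrt ((ca t)\<^sup>2 * r (y t))\<bar> < \<bar>Q t\<bar>"
proof -
  have c: "isCont F 0" if "smooth_on I F" for F :: "real \<Rightarrow> real"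
    using smooth_on_isCont[OF that open_I zero_I] .
  have "isCont (\<lambda>t. B * \<bar>ca t * sqrt ((ca t)\<^sup>2 * r (y t))\<bar>) 0"
    by (intro continuous_intros c smooth_ca smooth_along smooth_r)
  then have 1: "isCont (\<lambda>t. \<bar>Q t\<bar> - B * \<bar>ca t * sqrt ((ca t)\<^sup>2 * r (y t))\<bar>) 0"
    using Q_limit(1)[OF assms] by (intro continuous_diff continuous_rabs)
  have pos: "(F \<longlongrightarrow> F 0) (nhds 0)" if "isCont F 0" for F :: "real \<Rightarrow> real"
    using that unfolding isCont_def tendsto_at_iff_tendsto_nhds .
  have ne: "\<forall>\<^sub>F t in nhds 0. F t \<noteq> 0" if "isCont F 0" "F 0 \<noteq> 0" for F :: "real \<Rightarrow> real"
    using tendsto_imp_eventually_ne[OF pos[OF that(1)] that(2)] .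
  have "\<forall>\<^sub>F t in nhds 0. t \<in> I" using open_I zero_I eventually_nhds by blast
  moreover have "\<forall>\<^sub>F t in nhds 0. cb t \<noteq> 0" "\<forall>\<^sub>F t in nhds 0. KH t \<noteq> 0" "\<forall>\<^sub>F t in nhds 0. \<theta> (y t) \<noteq> 0"
    using ne[OF c[OF smooth_cb] cb_nonzero[OF zero_I ca(1)]] ne[OF c[OF smooth_KH] KH_nonzero]
      ne[OF c[OF smooth_along[OF smooth_\<theta>]] \<theta>]
    by simp_all
  moreover have "\<forall>\<^sub>F t in nhds 0. \<bar>Q t\<bar> - B * \<bar>ca t * sqrt ((ca t)\<^sup>2 * r (y t))\<bar> > 0"
    using order_tendstoD(1)[OF pos[OF 1], of 0] Q_limit(2)[OF assms] ca(1) by simp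
  ultimately have "\<forall>\<^sub>F t in nhds 0. t \<in> I \<and> cb t \<noteq> 0 \<and> KH t \<noteq> 0 \<and> \<theta> (y t) \<noteq> 0 \<and>
    \<bar>Q t\<bar> - B * \<bar>ca t * sqrt ((ca t)\<^sup>2 * r (y t))\<bar> > 0"
    by (intro eventually_conj)
  then show ?thesis
    by (auto simp: eventually_nhds_metric dist_real_def)
qed

end


section \<open>Charts\<close>

lemma
  assumes X: "smooth_manifold X" and c: "c \<in> atlas X"
  shows coord_inj: "inj_on (coord c) (dom_of c)"
    and dom_openin: "openin (top_of X) (dom_of c)"
    and coord_open: "openin (top_of X) A \<Longrightarrow> A \<subseteq> dom_of c \<Longrightarrow> open (coord c ` A)"
    and param_open: "open B \<Longrightarrow> B \<subseteq> coord c ` dom_of c \<Longrightarrow> openin (top_of X) (param c ` B)"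
    and param_coord: "q \<in> dom_of c \<Longrightarrow> param c (coord c q) = q"
    and param_dom: "u \<in> coord c ` dom_of c \<Longrightarrow> param c u \<in> dom_of c"
proof -
  have hom: "homeomorphic_map (subtopology (top_of X) (dom_of c)) (top_of_set (coord c ` dom_of c)) (coord c)"
    and op: "openin (top_of X) (dom_of c)" and oi: "open (coord c ` dom_of c)"
    using X c by (auto simp: smooth_manifold_def)
  show inj: "inj_on (coord c) (dom_of c)"
    using homeomorphic_imp_injective_map[OF hom] openin_subset[OF op] by (simp add: inf.absorb2)
  show "openin (top_of X) (dom_of c)" by (rule op)
  show pc: "param c (coord c q) = q" if "q \<in> dom_of c" for q
    using inj that by (simp add: param_def)
  have cp: "coord c (param c u) = u" "param c u \<in> dom_of c" if "u \<in> coord c ` dom_of c" for u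
    using that by (auto simp: pc)
  then show "param c u \<in> dom_of c" if "u \<in> coord c ` dom_of c" using that by blast
  have ts: "topspace (subtopology (top_of X) (dom_of c)) = dom_of c"
    using openin_subset[OF op] by auto
  have eq: "openin (top_of_set (coord c ` dom_of c)) (coord c ` A) \<longleftrightarrow> openin (subtopology (top_of X) (dom_of c)) A"
    if "A \<subseteq> dom_of c" for A
    using homeomorphic_map_openness[OF hom, of A] that subset_trans[OF that openin_subset[OF op]]
    by (simp add: ts)
  show "open (coord c ` A)" if "openin (top_of X) A" "A \<subseteq> dom_of c" for A
    using eq[OF that(2)] that oi op by (metis openin_open_eq openin_open_subtopology)
  show "openin (top_of X) (param c ` B)" if "open B" "B \<subseteq> coord c ` dom_of c" for B
  proof -
    have s: "param c ` B \<subseteq> dom_of c" using that cp by auto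
    have "coord c ` param c ` B = B" using that cp by (force simp: image_image)
    then have "openin (subtopology (top_of X) (dom_of c)) (param c ` B)"
      using eq[OF s] that oi by (simp add: openin_open_eq)
    then show ?thesis using op openin_trans_full by blast
  qed
qed

lemma transition_smooth:
  assumes X: "smooth_manifold X" and c: "c \<in> atlas X" "c' \<in> atlas X"
  shows "open (coord c' ` (dom_of c' \<inter> dom_of c))" "smooth_on (coord c' ` (dom_of c' \<inter> dom_of c)) (coord c \<circ> param c')"
  using assms coord_open[OF X c(2), of "dom_of c' \<inter> dom_of c"] dom_openin[OF X]
  by (auto simp: smooth_manifold_def openin_Int)

lemma surface_preimage_open:
  assumes "lorentzian_3_manifold M g" "surface S M f" "openin (top_of S) A" "d \<in> atlas M"
  shows "openin (top_of S) {q \<in> A. f q \<in> dom_of d}"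
proof -
  have "openin (top_of S) {q \<in> topspace (top_of S). f q \<in> dom_of d}"
    using assms dom_openin[of M d]
    by (auto simp: surface_def smooth_immersion_def lorentzian_3_manifold_def intro: openin_continuous_map_preimage)
  then have "openin (top_of S) (A \<inter> {q \<in> topspace (top_of S). f q \<in> dom_of d})"
    using assms(3) by (rule openin_Int[rotated])
  moreover have "A \<inter> {q \<in> topspace (top_of S). f q \<in> dom_of d} = {q \<in> A. f q \<in> dom_of d}"
    using openin_subset[OF assms(3)] by auto
  ultimately show ?thesis by simp
qed

lemma surface_chart_exists:
  assumes "lorentzian_3_manifold M g" "surface S M f" "chart_at S q c"
  obtains d where "chart_at M (f q) d"
proof -
  have "q \<in> topspace (top_of S)"
    using assms by (auto simp: surface_def smooth_manifold_def chart_at_def)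
  then have "f q \<in> topspace (top_of M)"
    using assms(2) by (auto simp: surface_def smooth_immersion_def continuous_map_def)
  then show ?thesis
    using assms(1) that by (auto simp: lorentzian_3_manifold_def smooth_manifold_def chart_at_def)
qed

lemma lorentzian_metric_form:
  assumes "lorentzian_3_manifold M g" "d \<in> atlas M" "m \<in> dom_of d"
  shows "lorentzian_form (g d m)"
  using assms unfolding lorentzian_3_manifold_def lorentzian_metric_def lorentzian_form_def by blast

lemma differential_change_chart:
  assumes L: "lorentzian_3_manifold M g" and F: "surface S M f"
    and c: "chart_at S q c" "chart_at S q c'" and d: "chart_at M (f q) d"
  shows "differential f c' d q = differential f c d q \<circ> frechet_derivative (coord c \<circ> param c') (at (coord c' q))"
proof -
  have S: "smooth_manifold S" and I: "smooth_immersion S M f" using F by (auto simp: surface_def)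
  have A: "c \<in> atlas S" "c' \<in> atlas S" "d \<in> atlas M" "q \<in> dom_of c" "q \<in> dom_of c'" "f q \<in> dom_of d"
    using c d by (auto simp: chart_at_def)
  define T where "T = coord c' ` {q \<in> dom_of c' \<inter> dom_of c. f q \<in> dom_of d}"
  have oT: "open T"
    unfolding T_def using A
    by (intro coord_open[OF S A(2)] surface_preimage_open[OF L F] openin_Int dom_openin[OF S]) auto
  have qT: "coord c' q \<in> T" using A by (auto simp: T_def)
  have 1: "(coord c \<circ> param c') differentiable (at (coord c' q))"
    using transition_smooth(2)[OF S A(1,2)] A by (auto intro: C1_differentiable)
  have 2: "(coord d \<circ> f \<circ> param c) differentiable (at ((coord c \<circ> param c') (coord c' q)))"
    using I A param_coord[OF S A(2)] by (auto simp: smooth_immersion_def intro!: C1_differentiable)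
  have "differential f c' d q = frechet_derivative ((coord d \<circ> f \<circ> param c) \<circ> (coord c \<circ> param c')) (at (coord c' q))"
    unfolding differential_def
    by (rule frechet_derivative_cong_open[OF oT qT])
      (auto simp: T_def param_coord[OF S A(1)] param_coord[OF S A(2)])
  also have "\<dots> = differential f c d q \<circ> frechet_derivative (coord c \<circ> param c') (at (coord c' q))"
    using frechet_derivative_compose[OF 1 2] A param_coord[OF S A(2)]
    by (simp add: differential_def comp_def)
  finally show ?thesis .
qed

lemma ds2_change_chart:
  assumes "lorentzian_3_manifold M g" "surface S M f" "chart_at S q c" "chart_at S q c'"
  shows "ds2 M g f c' q v w = ds2 M g f c q (Dir (coord c \<circ> param c') (coord c' q) v) (Dir (coord c \<circ> param c') (coord c' q) w)"
proof -
  obtain d where d: "chart_at M (f q) d" using surface_chart_exists[OF assms(1-3)] .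
  show ?thesis
    using ds2_chart_independent[OF assms(1,2) _ d] differential_change_chart[OF assms d] assms(3,4)
    by (simp add: comp_def)
qed

text \<open>Injectivity comes from that of the differential of the immersion in the chart \<open>c'\<close>, which factors through
the transition.\<close>

lemma transition_linear_bij:
  assumes "lorentzian_3_manifold M g" "surface S M f" "chart_at S q c" "chart_at S q c'"
  shows "linear (frechet_derivative (coord c \<circ> param c') (at (coord c' q)))"
    "inj (frechet_derivative (coord c \<circ> param c') (at (coord c' q)))"
    "surj (frechet_derivative (coord c \<circ> param c') (at (coord c' q)))"
proof -
  obtain d where d: "chart_at M (f q) d" using surface_chart_exists[OF assms(1-3)] .
  let ?J = "frechet_derivative (coord c \<circ> param c') (at (coord c' q))"
  have S: "smooth_manifold S" using assms by (simp add: surface_def)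
  show l: "linear ?J"
    using transition_smooth(2)[OF S, of c c'] assms(3,4)
    by (auto simp: chart_at_def intro!: linear_frechet_derivative C1_differentiable)
  have "inj (differential f c' d q)"
    using assms d by (auto simp: surface_def smooth_immersion_def chart_at_def)
  then show i: "inj ?J"
    using differential_change_chart[OF assms d] by (metis inj_on_imageI2)
  show "surj ?J" using l i by (rule linear_injective_imp_surjective) simp
qed


lemma null_vector_change_chart:
  assumes "lorentzian_3_manifold M g" "surface S M f" "chart_at S q c" "chart_at S q c'"
    and v: "null_vector M g f c' q v"
  shows "null_vector M g f c q (Dir (coord c \<circ> param c') (coord c' q) v)"
proof -
  note J = transition_linear_bij[OF assms(1-4)]
  have "ds2 M g f c q (Dir (coord c \<circ> param c') (coord c' q) v) w = 0" for w
  proof -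
    obtain w' where "w = Dir (coord c \<circ> param c') (coord c' q) w'" using J(3) by (metis surjD)
    then show ?thesis using v ds2_change_chart[OF assms(1-4)] by (simp add: null_vector_def)
  qed
  moreover have "Dir (coord c \<circ> param c') (coord c' q) v \<noteq> 0"
    using J v by (auto simp: linear_injective_0 null_vector_def)
  ultimately show ?thesis by (simp add: null_vector_def)
qed

lemma lightlike_null_vector:
  assumes "lorentzian_3_manifold M g" "surface S M f" "q \<in> lightlike_points S M g f" "chart_at S q c"
  shows "\<exists>v. null_vector M g f c q v"
  using assms null_vector_change_chart[OF assms(1,2,4)] by (auto simp: lightlike_points_def)

lemma ds2_bilinear:
  assumes L: "lorentzian_3_manifold M g" and F: "surface S M f" and c: "chart_at S q c"
  shows "ds2 M g f c q (a *\<^sub>R v + b *\<^sub>R v') w = a * ds2 M g f c q v w + b * ds2 M g f c q v' w"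
    "ds2 M g f c q v w = ds2 M g f c q w v"
proof -
  obtain d where d: "chart_at M (f q) d" using surface_chart_exists[OF assms] .
  have lin: "linear (differential f c d q)"
    unfolding differential_def using F c d
    by (intro linear_frechet_derivative C1_differentiable[of "coord c ` {q \<in> dom_of c. f q \<in> dom_of d}"])
      (auto simp: surface_def smooth_immersion_def chart_at_def)
  have lf: "lorentzian_form (g d (f q))"
    using lorentzian_metric_form[OF L] d by (simp add: chart_at_def)
  show "ds2 M g f c q (a *\<^sub>R v + b *\<^sub>R v') w = a * ds2 M g f c q v w + b * ds2 M g f c q v' w"
    unfolding ds2_chart_independent[OF L F c d] pairing_def
    using lin by (simp add: linear_add linear_cmul inner_simps)
  show "ds2 M g f c q v w = ds2 M g f c q w v"
    unfolding ds2_chart_independent[OF L F c d] pairing_def by (rule lorentzian_form_sym[OF lf])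
qed

text \<open>The discriminants in two charts, and the Gram determinant of \<open>\<zeta>\<close> and \<open>\<eta>\<close>, are compared through this identity.\<close>

lemma gram_discriminant:
  assumes "lorentzian_3_manifold M g" "surface S M f" "chart_at S q c"
  shows "ds2 M g f c q v v * ds2 M g f c q w w - (ds2 M g f c q v w)\<^sup>2 =
    discriminant M g f c q * (v \<bullet> rot w)\<^sup>2"
proof -
  have e: "v = v $ 1 *\<^sub>R axis 1 1 + v $ 2 *\<^sub>R axis 2 1" for v :: "real ^ 2"
    by (simp add: vec_eq_iff forall_2 axis_def)
  note b = ds2_bilinear[OF assms]
  define E F G where "E = ds2 M g f c q (axis 1 1) (axis 1 1)" "F = ds2 M g f c q (axis 1 1) (axis 2 1)"
    "G = ds2 M g f c q (axis 2 1) (axis 2 1)"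
  have x: "ds2 M g f c q v w = v $ 1 * w $ 1 * E + (v $ 1 * w $ 2 + v $ 2 * w $ 1) * F + v $ 2 * w $ 2 * G" for v w
  proof -
    have left: "ds2 M g f c q v u = v $ 1 * ds2 M g f c q (axis 1 1) u + v $ 2 * ds2 M g f c q (axis 2 1) u" for v u
      by (subst e[of v]) (rule b(1))
    show ?thesis
      unfolding left[of v w] b(2)[of "axis 1 1" w] b(2)[of "axis 2 1" w] left[of w] E_F_G_def
      by (simp add: b(2)[of "axis 2 1" "axis 1 1"] algebra_simps)
  qed
  have disc: "discriminant M g f c q = E * G - F\<^sup>2" by (simp add: discriminant_def E_F_G_def)
  show ?thesis
    unfolding x disc
    by (simp add: rot_def inner_vec_def sum_2 power2_eq_square algebra_simps)
qed

text \<open>A null vector and its rotation have vanishing Gram determinant but nonvanishing determinant.\<close>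

lemma discriminant_lightlike:
  assumes "lorentzian_3_manifold M g" "surface S M f" "q \<in> lightlike_points S M g f" "chart_at S q c"
  shows "discriminant M g f c q = 0"
proof -
  obtain v where v: "null_vector M g f c q v" using lightlike_null_vector[OF assms] by blast
  have "0 = discriminant M g f c q * (v \<bullet> rot (rot v))\<^sup>2"
    using gram_discriminant[OF assms(1,2,4), of v "rot v"] v by (simp add: null_vector_def)
  moreover have "v \<bullet> rot (rot v) = - (v \<bullet> v)" by (simp add: rot_def inner_vec_def sum_2)
  ultimately show ?thesis using v by (simp add: null_vector_def)
qed

section \<open>The connection in a chart\<close>

text \<open>Lowering an index turns the Christoffel symbols into those of the first kind, which are combinations of the
directional derivatives of the metric.\<close>

lemma cov_deriv_cov_ip:
  assumes L: "lorentzian_3_manifold M g" and d: "d \<in> atlas M" and m: "\<sigma> t \<in> dom_of d"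
  shows "pairing g d (\<sigma> t) W (cov_deriv g d \<sigma> V t) =
    cov_ip (g d \<circ> param d) (coord d (\<sigma> t)) W (vector_derivative (coord d \<circ> \<sigma>) (at t)) (V t) (vector_derivative V (at t))"
proof -
  have M: "smooth_manifold M" using L by (simp add: lorentzian_3_manifold_def)
  let ?x = "coord d (\<sigma> t)" and ?h = "g d \<circ> param d"
  define A B V' where "A = vector_derivative (coord d \<circ> \<sigma>) (at t)" "B = V t" "V' = vector_derivative V (at t)"
  have hs: "smooth_on (coord d ` dom_of d) ?h"
    using L d by (simp add: lorentzian_3_manifold_def lorentzian_metric_def)
  have dh: "(?h has_derivative frechet_derivative ?h (at ?x)) (at ?x)"
    using smooth_on_has_derivative[OF hs] m by blast
  have lin: "linear (frechet_derivative ?h (at ?x))" using dh by (rule has_derivative_linear)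
  have md: "metric_deriv g d (\<sigma> t) l i j = Dir ?h ?x (axis l 1) $ i $ j" for l i j
  proof -
    have "((\<lambda>x. ?h x $ i $ j) has_derivative (\<lambda>v. Dir ?h ?x v $ i $ j)) (at ?x)"
      using bounded_linear.has_derivative[OF bounded_linear_vec_nth
          bounded_linear.has_derivative[OF bounded_linear_vec_nth dh]] .
    from fun_cong[OF frechet_derivative_at[OF this], of "axis l 1"] show ?thesis
      by (simp add: metric_deriv_def)
  qed
  define T where "T l i j = Dir ?h ?x (axis l 1) $ i $ j" for l i j
  have Tsym: "T l i j = T l j i" for l i j
    using metric_deriv_sym[OF L d m, of l i j] by (simp add: md T_def)
  have DT: "Dir ?h ?x C $ i $ j = (\<Sum>l\<in>UNIV. C $ l * T l i j)" for C i j
  proof -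
    have "C = (\<Sum>l\<in>UNIV. C $ l *\<^sub>R axis l 1)" by (simp add: vec_eq_iff axis_def if_distrib[of "\<lambda>x. _ * x"] cong: if_cong)
    then have "Dir ?h ?x C = (\<Sum>l\<in>UNIV. C $ l *\<^sub>R Dir ?h ?x (axis l 1))"
      using linear_sum[OF lin] linear_cmul[OF lin] by (metis (no_types, lifting) sum.cong)
    then show ?thesis by (simp add: T_def)
  qed
  define \<Gamma> where "\<Gamma> = (\<chi> k. \<Sum>i\<in>UNIV. \<Sum>j\<in>UNIV. christoffel g d (\<sigma> t) k i j * A $ i * B $ j)"
  have "cov_deriv g d \<sigma> V t = V' + \<Gamma>"
    by (simp add: cov_deriv_def \<Gamma>_def A_B_V'_def vec_eq_iff)
  then have "pairing g d (\<sigma> t) W (cov_deriv g d \<sigma> V t) = W \<bullet> (g d (\<sigma> t) *v V') + W \<bullet> (g d (\<sigma> t) *v \<Gamma>)"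
    by (simp add: pairing_def matrix_vector_right_distrib inner_right_distrib)
  moreover have "W \<bullet> (g d (\<sigma> t) *v \<Gamma>) = christoffel_first ?h ?x W A B"
  proof -
    have "(g d (\<sigma> t) *v \<Gamma>) $ r = (\<Sum>i\<in>UNIV. \<Sum>j\<in>UNIV. (T i j r + T j i r - T r i j) / 2 * (A $ i * B $ j))" for r
    proof -
      have "(g d (\<sigma> t) *v \<Gamma>) $ r = (\<Sum>k\<in>UNIV. \<Sum>i\<in>UNIV. \<Sum>j\<in>UNIV. g d (\<sigma> t) $ r $ k * christoffel g d (\<sigma> t) k i j * (A $ i * B $ j))"
        by (simp add: matrix_vector_mult_def \<Gamma>_def sum_distrib_left mult.assoc)
      also have "\<dots> = (\<Sum>i\<in>UNIV. \<Sum>k\<in>UNIV. \<Sum>j\<in>UNIV. g d (\<sigma> t) $ r $ k * christoffel g d (\<sigma> t) k i j * (A $ i * B $ j))"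
        by (rule sum.swap)
      also have "\<dots> = (\<Sum>i\<in>UNIV. \<Sum>j\<in>UNIV. \<Sum>k\<in>UNIV. g d (\<sigma> t) $ r $ k * christoffel g d (\<sigma> t) k i j * (A $ i * B $ j))"
        by (rule sum.cong[OF refl], rule sum.swap)
      also have "\<dots> = (\<Sum>i\<in>UNIV. \<Sum>j\<in>UNIV. (T i j r + T j i r - T r i j) / 2 * (A $ i * B $ j))"
        unfolding sum_distrib_right[symmetric] christoffel_lower[OF L d m] md T_def ..
      finally show ?thesis .
    qed
    then have "W \<bullet> (g d (\<sigma> t) *v \<Gamma>) = (\<Sum>r\<in>UNIV. W $ r * (\<Sum>i\<in>UNIV. \<Sum>j\<in>UNIV. (T i j r + T j i r - T r i j) / 2 * (A $ i * B $ j)))"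
      by (simp add: inner_vec_def)
    also have "\<dots> = christoffel_first ?h ?x W A B"
      by (simp add: christoffel_first_def inner_vec_def matrix_vector_mult_def DT sum_3
        Tsym[of _ 2 1] Tsym[of _ 3 1] Tsym[of _ 3 2] field_simps)
    finally show ?thesis .
  qed
  moreover have "?h ?x = g d (\<sigma> t)" using param_coord[OF M d m] by simp
  ultimately show ?thesis by (simp add: cov_ip_def ip_at_def flip: A_B_V'_def)
qed


section \<open>Surfaces near a characteristic curve\<close>

lemma char_delta_rot:
  "char_delta c \<gamma> \<eta> t = vector_derivative (coord c \<circ> \<gamma>) (at t) \<bullet> rot (\<eta> (\<gamma> t))"
  unfolding char_delta_def det_2 transpose_def
  by (simp add: rot_def inner_vec_def sum_2)

text \<open>A piece of a characteristic curve inside one chart \<open>c\<close> of the surface, with a null field around it and a chart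
\<open>d\<close> of the ambient manifold that covers the image.\<close>

locale characteristic_surface_data =
  fixes S :: "('s, 2) mfd" and M :: "('m, 3) mfd" and g :: "'m tensor2" and f :: "'s \<Rightarrow> 'm"
    and c :: "('s, 2) chart" and d :: "('m, 3) chart" and U :: "'s set" and \<eta> :: "'s \<Rightarrow> real ^ 2"
    and \<gamma> :: "real \<Rightarrow> 's" and e :: real
  assumes M: "lorentzian_3_manifold M g" and S: "surface S M f"
    and c: "c \<in> atlas S" and d: "d \<in> atlas M"
    and null_field: "null_vector_field S M g f c U \<eta>" and Ud: "f ` U \<subseteq> dom_of d"
    and e: "e > 0" and \<gamma>: "\<gamma> ` {-e<..<e} \<subseteq> lightlike_points S M g f \<inter> U"
    and \<gamma>_smooth: "smooth_on {-e<..<e} (coord c \<circ> \<gamma>)"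
    and \<gamma>_regular: "\<And>t. t \<in> {-e<..<e} \<Longrightarrow> vector_derivative (coord c \<circ> \<gamma>) (at t) \<noteq> 0"
begin

lemma S_manifold: "smooth_manifold S" using S by (simp add: surface_def)
lemma M_manifold: "smooth_manifold M" using M by (simp add: lorentzian_3_manifold_def)
lemma U_open: "openin (top_of S) U" and U_dom: "U \<subseteq> dom_of c"
  using null_field by (auto simp: null_vector_field_def)
lemma U_chart: "q \<in> U \<Longrightarrow> chart_at S q c" using U_dom c by (auto simp: chart_at_def)
lemma U_chart_d: "q \<in> U \<Longrightarrow> chart_at M (f q) d" using Ud d by (auto simp: chart_at_def)
lemma param_coord_U: "q \<in> U \<Longrightarrow> param c (coord c q) = q"
  using param_coord[OF S_manifold c] U_dom by auto
lemma coord_param_U: "u \<in> coord c ` U \<Longrightarrow> coord c (param c u) = u"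
  using param_coord_U by auto
lemma param_U: "u \<in> coord c ` U \<Longrightarrow> param c u \<in> U"
  using param_coord_U by auto
abbreviation "\<Phi> \<equiv> coord d \<circ> f \<circ> param c"

lemma ds2_eq:
  assumes "q \<in> U"
  shows "ds2 M g f c q v w = ip_at (g d \<circ> param d) (\<Phi> (coord c q)) (Dir \<Phi> (coord c q) v) (Dir \<Phi> (coord c q) w)"
proof -
  have "(g d \<circ> param d) (\<Phi> (coord c q)) = g d (f q)"
    using param_coord[OF M_manifold d, of "f q"] param_coord_U[OF assms] Ud assms by auto
  then show ?thesis
    using ds2_chart_independent[OF M S U_chart[OF assms] U_chart_d[OF assms]]
    by (simp add: pairing_def ip_at_def differential_def)
qed

sublocale characteristic_data "g d \<circ> param d" "coord d ` dom_of d" \<Phi> "coord c ` U" "\<eta> \<circ> param c"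
  "coord c ` (lightlike_points S M g f \<inter> U)" "coord c \<circ> \<gamma>" "- e" e
proof unfold_locales
  show "open (coord d ` dom_of d)"
    using coord_open[OF M_manifold d dom_openin[OF M_manifold d]] by simp
  show "smooth_on (coord d ` dom_of d) (g d \<circ> param d)"
    using M d by (simp add: lorentzian_3_manifold_def lorentzian_metric_def)
  show "lorentzian_form ((g d \<circ> param d) x)" if x: "x \<in> coord d ` dom_of d" for x
  proof -
    have "param d x \<in> dom_of d" using param_dom[OF M_manifold d x] .
    then show ?thesis by (simp add: lorentzian_metric_form[OF M d])
  qed
  show "open (coord c ` U)" by (rule coord_open[OF S_manifold c U_open U_dom])
  have "coord c ` U \<subseteq> coord c ` {q \<in> dom_of c. f q \<in> dom_of d}" using U_dom Ud by auto
  then show "smooth_on (coord c ` U) \<Phi>"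
    using S c d smooth_on_subset unfolding surface_def smooth_immersion_def by blast
  show "\<Phi> ` coord c ` U \<subseteq> coord d ` dom_of d" using param_coord_U Ud by auto
  show "inj (frechet_derivative \<Phi> (at u))" if u: "u \<in> coord c ` U" for u
  proof -
    obtain q where q: "u = coord c q" "q \<in> U" using u by auto
    have "inj (differential f c d q)"
      using S c d q U_dom Ud unfolding surface_def smooth_immersion_def by blast
    then show ?thesis by (simp add: differential_def q)
  qed
  show "smooth_on (coord c ` U) (\<eta> \<circ> param c)" using null_field by (simp add: null_vector_field_def)
  have n: "null_vector M g f c q (\<eta> q)" if "q \<in> lightlike_points S M g f \<inter> U" for q
    using null_field that by (simp add: null_vector_field_def)
  show "(\<eta> \<circ> param c) u \<noteq> 0" if u: "u \<in> coord c ` (lightlike_points S M g f \<inter> U) \<inter> coord c ` U" for u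
  proof -
    obtain q where q: "u = coord c q" "q \<in> lightlike_points S M g f \<inter> U" using u by auto
    then show ?thesis using n[OF q(2)] param_coord_U[of q] by (simp add: null_vector_def)
  qed
  show "ip_at (g d \<circ> param d) (\<Phi> u) (Dir \<Phi> u ((\<eta> \<circ> param c) u)) (Dir \<Phi> u w) = 0"
    if u: "u \<in> coord c ` (lightlike_points S M g f \<inter> U) \<inter> coord c ` U" for u w
  proof -
    obtain q where q: "u = coord c q" "q \<in> lightlike_points S M g f \<inter> U" using u by auto
    then show ?thesis using n[OF q(2)] param_coord_U[of q] ds2_eq[of q "\<eta> q" w] by (simp add: null_vector_def)
  qed
  show "(coord c \<circ> \<gamma>) ` {- e<..<e} \<subseteq> coord c ` (lightlike_points S M g f \<inter> U) \<inter> coord c ` U"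
    using \<gamma> by auto
qed (use e \<gamma>_smooth \<gamma>_regular in auto)

lemma \<gamma>_in: "t \<in> I \<Longrightarrow> \<gamma> t \<in> lightlike_points S M g f \<inter> U"
  using \<gamma> by (auto simp: I_def)

text \<open>The Gram determinant of \<open>\<zeta>\<close> and \<open>\<eta>\<close>, computed in the chart \<open>c\<close>, is \<open>r \<mu> - m\<^sup>2\<close> with \<open>m\<close> the pairing of \<open>Zf\<close> and \<open>Hf\<close>;
computed in \<open>c'\<close>, it is the discriminant times the square \<open>D\<close> of a nonvanishing determinant. At a lightlike point
\<open>\<mu>\<close> and \<open>m\<close> vanish, so the derivative of the former is \<open>r d\<mu>\<close>. The equation also shows that the discriminant in \<open>c'\<close> is
differentiable.\<close>

lemma discriminant_derivative:
  assumes q: "q \<in> lightlike_points S M g f \<inter> U" and c': "chart_at S q c'"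
  defines "\<Lambda> \<equiv> \<lambda>x. discriminant M g f c' (param c' x)"
  shows "\<exists>k\<noteq>0. (\<Lambda> has_derivative (\<lambda>w. k * Dir \<mu> (coord c q) (Dir (coord c \<circ> param c') (coord c' q) w))) (at (coord c' q))"
proof -
  have c'A: "c' \<in> atlas S" "q \<in> dom_of c'" using c' by (auto simp: chart_at_def)
  have qU: "q \<in> U" using q by simp
  define u where "u = coord c q"
  have uZ: "u \<in> coord c ` (lightlike_points S M g f \<inter> U) \<inter> coord c ` U" using q by (auto simp: u_def)
  define B where "B = coord c' ` (dom_of c' \<inter> U)"
  have B: "open B" "coord c' q \<in> B"
    unfolding B_def using q c'A
    by (auto intro!: coord_open[OF S_manifold c'A(1)] openin_Int dom_openin[OF S_manifold] U_open)
  define T where "T = coord c ` (dom_of c \<inter> dom_of c')"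
  define \<psi> where "\<psi> = coord c \<circ> param c'"
  define \<psi>' where "\<psi>' = coord c' \<circ> param c"
  have T: "open T" "smooth_on T \<psi>'"
    using transition_smooth[OF S_manifold c'A(1) c] by (simp_all add: T_def \<psi>'_def)
  \<comment> \<open>Both the transition and the null field are defined here.\<close>
  define O2 where "O2 = T \<inter> coord c ` U"
  have O2: "open O2" "O2 \<subseteq> T" "O2 \<subseteq> coord c ` U" using T \<Omega> by (auto simp: O2_def)
  have "B \<subseteq> coord c' ` (dom_of c' \<inter> dom_of c)" using U_dom by (auto simp: B_def)
  then have \<psi>: "smooth_on B \<psi>"
    using transition_smooth(2)[OF S_manifold c c'A(1)] smooth_on_subset by (auto simp: \<psi>_def)
  have \<psi>B: "\<psi> ` B \<subseteq> O2"
    using U_dom by (auto simp: \<psi>_def B_def O2_def T_def param_coord[OF S_manifold c'A(1)])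
  have \<psi>q: "\<psi> (coord c' q) = u"
    by (simp add: \<psi>_def u_def param_coord[OF S_manifold c'A(1,2)])
  define m where "m u = ip_at (g d \<circ> param d) (\<Phi> u) (Hf u) (Zf u)" for u
  have sm: "smooth_on (coord c ` U) m" unfolding m_def by (intro smooth_on_ip_at \<Omega> \<phi> smooth_Hf smooth_Zf)
  define n where "n u = r u * \<mu> u - (m u)\<^sup>2" for u
  define v1 where "v1 u = Dir \<psi>' u (\<zeta> u)" for u
  define v2 where "v2 u = Dir \<psi>' u ((\<eta> \<circ> param c) u)" for u
  define D where "D u = (v1 u \<bullet> rot (v2 u))\<^sup>2" for u
  have sv: "smooth_on O2 v1" "smooth_on O2 v2"
    unfolding v1_def v2_def
    by (rule smooth_on_frechet_derivative[OF O2(1) smooth_on_subset[OF T(2) O2(2)]],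
        rule smooth_on_subset[OF _ O2(3)], rule smooth_\<zeta> \<eta>(1))+
  have sD: "smooth_on O2 D"
    unfolding D_def power2_eq_square
    by (intro smooth_on_mult smooth_on_inner O2(1) sv smooth_on_bounded_linear[OF bounded_linear_rot])
  have gram: "n (\<psi> x) = \<Lambda> x * D (\<psi> x)" if x: "x \<in> B" for x
  proof -
    obtain p where p: "x = coord c' p" "p \<in> dom_of c'" "p \<in> U" using x by (auto simp: B_def)
    have pp: "param c' x = p" "\<psi> x = coord c p"
      using p param_coord[OF S_manifold c'A(1)] by (simp_all add: \<psi>_def)
    have ch: "chart_at S p c'" "chart_at S p c" using p c'A U_chart by (auto simp: chart_at_def)
    let ?J = "frechet_derivative \<psi>' (at (coord c p))"
    have ds: "ds2 M g f c' p (?J v) (?J w) = ip_at (g d \<circ> param d) (\<Phi> (coord c p)) (Dir \<Phi> (coord c p) v) (Dir \<Phi> (coord c p) w)" for v w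
      using ds2_change_chart[OF M S ch] ds2_eq[OF p(3)] by (simp add: \<psi>'_def)
    show ?thesis
      using gram_discriminant[OF M S ch(1), of "v1 (coord c p)" "v2 (coord c p)"]
        ip_at_sym[OF \<phi>_V, of "coord c p" "Hf (coord c p)" "Zf (coord c p)"] p(3)
      unfolding n_def m_def pp \<Lambda>_def D_def v1_def v2_def ds r_def \<mu>_def Hf_def Zf_def by simp
  qed
  have Dnz: "D u \<noteq> 0"
  proof
    assume "D u = 0"
    then have z: "v1 u \<bullet> rot (v2 u) = 0" by (simp add: D_def)
    have ch: "chart_at S q c'" "chart_at S q c" using c' U_chart qU by auto
    note J = transition_linear_bij[OF M S ch, folded \<psi>'_def u_def]
    have eta: "(\<eta> \<circ> param c) u \<noteq> 0" by (rule \<eta>(2)[OF uZ])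
    then have "v2 u \<noteq> 0" using J by (auto simp: v2_def linear_injective_0)
    then obtain k where "v1 u = k *\<^sub>R v2 u" using parallel_if_rot_orthogonal z by blast
    then have "Dir \<psi>' u (\<zeta> u) = Dir \<psi>' u (k *\<^sub>R (\<eta> \<circ> param c) u)"
      by (simp add: v1_def v2_def linear_cmul[OF J(1)])
    then have "\<zeta> u = k *\<^sub>R (\<eta> \<circ> param c) u" using J(2) by (meson injD)
    then have "\<zeta> u \<bullet> \<zeta> u = k * ((\<eta> \<circ> param c) u \<bullet> \<zeta> u)" by simp
    then show False using eta by (simp add: \<zeta>_def)
  qed
  have n0: "n u = 0" "m u = 0" using H_null[OF uZ] by (simp_all add: n_def m_def \<mu>_def)
  have uO: "u \<in> O2" "u \<in> coord c ` U" using \<psi>B B \<psi>q qU by (auto simp: u_def)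
  have dn: "(n has_derivative (\<lambda>w. r u * Dir \<mu> u w)) (at u)"
  proof -
    have "((\<lambda>u. r u * \<mu> u - m u * m u) has_derivative
        (\<lambda>w. (r u * Dir \<mu> u w + Dir r u w * \<mu> u) - (m u * Dir m u w + Dir m u w * m u))) (at u)"
      by (intro has_derivative_diff has_derivative_mult smooth_on_has_derivative[OF smooth_r]
          smooth_on_has_derivative[OF smooth_\<mu>] smooth_on_has_derivative[OF sm] uO)
    then show ?thesis using n0 \<mu>_zero[OF uZ] by (simp add: n_def[abs_def] power2_eq_square)
  qed
  have d\<psi>: "(\<psi> has_derivative frechet_derivative \<psi> (at (coord c' q))) (at (coord c' q))"
    by (rule smooth_on_has_derivative[OF \<psi> B(2)])
  have d1: "((\<lambda>x. n (\<psi> x)) has_derivative (\<lambda>w. r u * Dir \<mu> u (Dir \<psi> (coord c' q) w))) (at (coord c' q))"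
    using diff_chain_at[OF d\<psi>, of n "\<lambda>w. r u * Dir \<mu> u w"] dn \<psi>q by (simp add: comp_def)
  have sD\<psi>: "smooth_on B (\<lambda>x. D (\<psi> x))" by (rule smooth_on_compose[OF B(1) O2(1) \<psi>B sD \<psi>])
  define B' where "B' = B \<inter> (\<lambda>x. D (\<psi> x)) -` (- {0})"
  \<comment> \<open>On \<open>B'\<close> the discriminant is a quotient of smooth functions.\<close>
  have B': "open B'" "coord c' q \<in> B'"
    using continuous_open_preimage[OF smooth_on_continuous_on[OF sD\<psi>] B(1), of "- {0}"] B(2) Dnz \<psi>q
    by (auto simp: B'_def)
  have d2: "((\<lambda>x. n (\<psi> x) / D (\<psi> x)) has_derivative
      (\<lambda>w. r u / D u * Dir \<mu> u (Dir \<psi> (coord c' q) w))) (at (coord c' q))"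
    using has_derivative_divide'[OF d1 smooth_on_has_derivative[OF sD\<psi> B(2)]] Dnz n0
    by (simp add: \<psi>q)
  have "(\<Lambda> has_derivative (\<lambda>w. r u / D u * Dir \<mu> u (Dir \<psi> (coord c' q) w))) (at (coord c' q))"
    by (rule has_derivative_transform_within_open[OF d2 B']) (auto simp: gram B'_def)
  moreover have "r u / D u \<noteq> 0" using r_pos[OF uZ] Dnz by simp
  ultimately show ?thesis unfolding u_def \<psi>_def by blast
qed

lemma nondegenerate_Dir_\<mu>:
  assumes q: "q \<in> U" and nd: "nondegenerate_lightlike_point S M g f q"
  shows "\<exists>w. Dir \<mu> (coord c q) w \<noteq> 0"
proof -
  obtain c' where c': "chart_at S q c'" and
    n: "frechet_derivative (\<lambda>x. discriminant M g f c' (param c' x)) (at (coord c' q)) \<noteq> (\<lambda>v. 0)"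
    using nd by (auto simp: nondegenerate_lightlike_point_def)
  have "q \<in> lightlike_points S M g f \<inter> U" using q nd by (simp add: nondegenerate_lightlike_point_def)
  from discriminant_derivative[OF this c'] obtain k where
    k: "((\<lambda>x. discriminant M g f c' (param c' x)) has_derivative
      (\<lambda>w. k * Dir \<mu> (coord c q) (Dir (coord c \<circ> param c') (coord c' q) w))) (at (coord c' q))" by blast
  show ?thesis
  proof (rule ccontr)
    assume "\<nexists>w. Dir \<mu> (coord c q) w \<noteq> 0"
    then have "(\<lambda>w. k * Dir \<mu> (coord c q) (Dir (coord c \<circ> param c') (coord c' q) w)) = (\<lambda>v. 0)" by simp
    then show False using frechet_derivative_at[OF k] n by simp
  qed
qed

text \<open>The kind of \<open>q\<close> is witnessed by some other chart, curve and null field. If \<open>\<eta>\<mu>\<close> were zero, the nonzero functional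
\<open>d\<mu>\<close> would vanish both on that null vector, which is proportional to \<open>\<eta> q\<close> after a change of chart, and on the
velocity of that curve, along which the discriminant is zero; the two would be dependent.\<close>

lemma first_kind_\<beta>:
  assumes q: "q \<in> U" and fk: "first_kind S M g f q"
  shows "\<beta> (coord c q) \<noteq> 0"
proof
  assume \<beta>0: "\<beta> (coord c q) = 0"
  have nd: "nondegenerate_lightlike_point S M g f q" using fk by (simp add: first_kind_def)
  have qL: "q \<in> lightlike_points S M g f \<inter> U" using q nd by (simp add: nondegenerate_lightlike_point_def)
  obtain c' \<gamma>' \<eta>' where cd: "char_data S M g f q c' \<gamma>' \<eta>'"
    and ind: "\<not> lin_dependent (vector_derivative (coord c' \<circ> \<gamma>') (at 0)) (\<eta>' q)"
    using fk by (auto simp: first_kind_def)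
  have c': "chart_at S q c'" using cd by (simp add: char_data_def)
  obtain a b where cc: "characteristic_curve S M g f c' q a b \<gamma>'" using cd by (auto simp: char_data_def)
  have nv: "null_vector M g f c' q (\<eta>' q)"
    using cd qL by (auto simp: char_data_def null_vector_field_def)
  let ?J = "frechet_derivative (coord c \<circ> param c') (at (coord c' q))"
  define u where "u = coord c q"
  have uZ: "u \<in> coord c ` (lightlike_points S M g f \<inter> U) \<inter> coord c ` U" using qL by (auto simp: u_def)
  note J = transition_linear_bij[OF M S U_chart[OF q] c']
  obtain k where k: "k \<noteq> 0" and d\<Lambda>: "((\<lambda>x. discriminant M g f c' (param c' x)) has_derivative
      (\<lambda>w. k * Dir \<mu> u (?J w))) (at (coord c' q))"
    using discriminant_derivative[OF qL c'] unfolding u_def by blast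
  have lin\<mu>: "linear (frechet_derivative \<mu> (at u))" using linear_Dir[OF smooth_\<mu>] uZ by auto
  have "((\<lambda>x. discriminant M g f c' (param c' x)) \<circ> (coord c' \<circ> \<gamma>') has_vector_derivative
      k * Dir \<mu> u (?J (vector_derivative (coord c' \<circ> \<gamma>') (at 0)))) (at 0)"
  proof -
    have "((coord c' \<circ> \<gamma>') has_vector_derivative vector_derivative (coord c' \<circ> \<gamma>') (at 0)) (at 0)"
      using cc by (intro smooth_on_has_vector_derivative) (auto simp: characteristic_curve_def)
    moreover have "(coord c' \<circ> \<gamma>') 0 = coord c' q" using cc by (simp add: characteristic_curve_def)
    ultimately show ?thesis
      using vector_derivative_diff_chain_within[of "coord c' \<circ> \<gamma>'"] has_derivative_at_withinI[OF d\<Lambda>] by metis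
  qed
  moreover have "((\<lambda>x. discriminant M g f c' (param c' x)) \<circ> (coord c' \<circ> \<gamma>') has_vector_derivative 0) (at 0)"
  proof (rule locally_constant_has_vector_derivative[of "{a<..<b}" _ _ 0])
    show "((\<lambda>x. discriminant M g f c' (param c' x)) \<circ> (coord c' \<circ> \<gamma>')) t = 0" if t: "t \<in> {a<..<b}" for t
    proof -
      have "\<gamma>' t \<in> dom_of c'" "\<gamma>' t \<in> lightlike_points S M g f"
        using cc t by (auto simp: characteristic_curve_def)
      then show ?thesis
        using c' param_coord[OF S_manifold, of c' "\<gamma>' t"] discriminant_lightlike[OF M S, of "\<gamma>' t" c']
        by (simp add: chart_at_def)
    qed
  qed (use cc in \<open>auto simp: characteristic_curve_def\<close>)
  ultimately have "k * Dir \<mu> u (?J (vector_derivative (coord c' \<circ> \<gamma>') (at 0))) = 0"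
    by (rule vector_derivative_unique_at)
  then have 1: "Dir \<mu> u (?J (vector_derivative (coord c' \<circ> \<gamma>') (at 0))) = 0" using k by simp
  have "null_vector M g f c q (?J (\<eta>' q))"
    by (rule null_vector_change_chart[OF M S U_chart[OF q] c' nv])
  then have "ip_at (g d \<circ> param d) (\<Phi> u) (Dir \<Phi> u (?J (\<eta>' q))) (Zf u) = 0"
    using ds2_eq[OF q, of "?J (\<eta>' q)" "\<zeta> u"] by (simp add: null_vector_def Zf_def u_def)
  moreover obtain s t where st: "?J (\<eta>' q) = s *\<^sub>R \<zeta> u + t *\<^sub>R (\<eta> \<circ> param c) u"
    using rot_decomposition[OF \<eta>(2)[OF uZ]] unfolding \<zeta>_def by metis
  moreover have "Dir \<Phi> u (s *\<^sub>R \<zeta> u + t *\<^sub>R (\<eta> \<circ> param c) u) = s *\<^sub>R Zf u + t *\<^sub>R Hf u"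
    using linear_D\<phi>[of u] uZ by (simp add: linear_add linear_cmul Zf_def Hf_def)
  ultimately have "s * r u = 0" using H_null[OF uZ] by (simp add: ip_at_linear r_def)
  then have "s = 0" using r_pos[OF uZ] by simp
  then have 2: "Dir \<mu> u (?J (\<eta>' q)) = 0"
    using st \<beta>0 lin\<mu> by (simp add: linear_cmul \<beta>_def u_def)
  obtain w where "Dir \<mu> u w \<noteq> 0" using nondegenerate_Dir_\<mu>[OF q nd] by (auto simp: u_def)
  then obtain w' where 3: "Dir \<mu> u (?J w') \<noteq> 0" using J(3) by (metis surjD)
  have "linear (\<lambda>v. Dir \<mu> u (?J v))" using linear_compose[OF J(1) lin\<mu>] by (simp add: comp_def)
  from functional_kernel_dependent[OF this 3 1 2] ind show False by contradiction
qed

text \<open>At a point of the second kind \<open>\<eta>\<close> is tangent to the curve and thus annihilated by \<open>d\<mu>\<close>, so \<open>\<zeta>\<close> is not.\<close>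

lemma second_kind_\<theta>:
  assumes nd: "nondegenerate_lightlike_point S M g f (\<gamma> 0)" and ca: "ca 0 = 0"
  shows "\<theta> ((coord c \<circ> \<gamma>) 0) \<noteq> 0"
proof
  assume \<theta>0: "\<theta> ((coord c \<circ> \<gamma>) 0) = 0"
  define u where "u = (coord c \<circ> \<gamma>) 0"
  have uZ: "u \<in> coord c ` (lightlike_points S M g f \<inter> U) \<inter> coord c ` U"
    using y_in[OF zero_I] by (simp add: u_def)
  have "\<beta> u = 0" using cb_\<beta>[OF zero_I] ca cb_nonzero[OF zero_I ca] by (simp add: u_def)
  have lin: "linear (frechet_derivative \<mu> (at u))" using linear_Dir[OF smooth_\<mu>] uZ by auto
  obtain w where w: "Dir \<mu> u w \<noteq> 0" using nondegenerate_Dir_\<mu>[OF _ nd] \<gamma>_in[OF zero_I] by (auto simp: u_def)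
  obtain s t where "w = s *\<^sub>R \<zeta> u + t *\<^sub>R (\<eta> \<circ> param c) u"
    using rot_decomposition[OF \<eta>(2)[OF uZ]] unfolding \<zeta>_def by metis
  then have "Dir \<mu> u w = s * \<theta> u + t * \<beta> u" using lin by (simp add: linear_add linear_cmul \<theta>_def \<beta>_def)
  then show False using w \<theta>0 \<open>\<beta> u = 0\<close> by (simp add: u_def)
qed

text \<open>The objects found in coordinates are carried back to the manifolds.\<close>

lemma torsion_value:
  assumes t0: "t0 \<in> I" and nz: "ca t0 \<noteq> 0" "cb t0 \<noteq> 0" "\<theta> ((coord c \<circ> \<gamma>) t0) \<noteq> 0" "KH t0 \<noteq> 0"
    and fk: "first_kind S M g f (\<gamma> t0)"
  shows "\<exists>\<kappa>. lightlike_geodesic_torsion S M g f (\<gamma> t0) \<kappa> \<and>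
    \<kappa> * (ca t0 * sqrt ((ca t0)\<^sup>2 * r ((coord c \<circ> \<gamma>) t0))) = - Q t0"
proof (rule torsion_at_first_kind[OF t0 nz])
  fix a b yt U' W \<eta>1 N \<kappa>
  define q where "q = \<gamma> t0"
  have q: "q \<in> U" using \<gamma>_in[OF t0] by (simp add: q_def)
  assume
    ab: "a < 0" "0 < b" and yt: "yt 0 = (coord c \<circ> \<gamma>) t0" "smooth_on {a<..<b} yt" "yt ` {a<..<b} \<subseteq> U'"
    "\<And>s. s \<in> {a<..<b} \<Longrightarrow> vector_derivative yt (at s) \<noteq> 0"
    and U': "open U'" "U' \<subseteq> coord c ` U" and W: "open W" "W \<subseteq> U'" "(coord c \<circ> \<gamma>) t0 \<in> W"
    "coord c ` (lightlike_points S M g f \<inter> U) \<inter> W = yt ` {a<..<b}"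
    and \<eta>1: "smooth_on U' \<eta>1" "\<And>u. u \<in> U' \<Longrightarrow> \<exists>k. k \<noteq> 0 \<and> \<eta>1 u = k *\<^sub>R (\<eta> \<circ> param c) u"
    and norm: "\<And>u. u \<in> coord c ` (lightlike_points S M g f \<inter> U) \<inter> U' \<Longrightarrow>
      Dir (\<lambda>u. ip_at (g d \<circ> param d) (\<Phi> u) (Dir \<Phi> u (\<eta>1 u)) (Dir \<Phi> u (\<eta>1 u))) u (\<eta>1 u) = 1"
    and N: "smooth_on {a<..<b} N"
    "\<And>s. s \<in> {a<..<b} \<Longrightarrow> ip_at (g d \<circ> param d) (\<Phi> (yt s)) (vector_derivative (\<lambda>s. \<Phi> (yt s)) (at s)) (vector_derivative (\<lambda>s. \<Phi> (yt s)) (at s)) = 1"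
    "\<And>s. s \<in> {a<..<b} \<Longrightarrow> ip_at (g d \<circ> param d) (\<Phi> (yt s)) (N s) (vector_derivative (\<lambda>s. \<Phi> (yt s)) (at s)) = 0"
    "\<And>s. s \<in> {a<..<b} \<Longrightarrow> ip_at (g d \<circ> param d) (\<Phi> (yt s)) (N s) (N s) = 0"
    "\<And>s. s \<in> {a<..<b} \<Longrightarrow> ip_at (g d \<circ> param d) (\<Phi> (yt s)) (N s) (Dir \<Phi> (yt s) (\<eta>1 (yt s))) = 1"
    and \<kappa>: "\<kappa> = cov_ip (g d \<circ> param d) (\<Phi> (yt 0)) (Dir \<Phi> (yt 0) (\<eta>1 (yt 0))) (vector_derivative (\<lambda>s. \<Phi> (yt s)) (at 0))
        (N 0) (vector_derivative N (at 0))"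
    and \<kappa>Q: "\<kappa> * (ca t0 * sqrt ((ca t0)\<^sup>2 * r ((coord c \<circ> \<gamma>) t0))) = - Q t0"
  define \<gamma>t where "\<gamma>t = param c \<circ> yt"
  define Us where "Us = param c ` U'"
  define \<eta>s where "\<eta>s = \<eta>1 \<circ> coord c"
  have oab: "open {a<..<b}" "0 \<in> {a<..<b}" using ab by auto
  have sub: "U' \<subseteq> coord c ` dom_of c" "W \<subseteq> coord c ` dom_of c"
    using U'(2) W(2) image_mono[OF U_dom, of "coord c"] by blast+
  have Us: "openin (top_of S) Us" "Us \<subseteq> U" "coord c ` Us = U'"
  proof -
    show "openin (top_of S) Us" unfolding Us_def by (rule param_open[OF S_manifold c U'(1) sub(1)])
    show "Us \<subseteq> U" using U'(2) param_U by (auto simp: Us_def)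
    show "coord c ` Us = U'" using U'(2) coord_param_U by (force simp: Us_def image_image)
  qed
  have ytU: "yt s \<in> coord c ` U" "yt s \<in> U'" if "s \<in> {a<..<b}" for s using yt(3) U'(2) that by blast+
  have c\<gamma>: "coord c (\<gamma>t s) = yt s" "\<gamma>t s \<in> Us" "\<gamma>t s \<in> U" if "s \<in> {a<..<b}" for s
    using ytU[OF that] coord_param_U param_U by (auto simp: \<gamma>t_def Us_def)
  have \<gamma>t0: "\<gamma>t 0 = q" using q param_coord_U by (simp add: \<gamma>t_def yt(1) q_def)
  have cc: "characteristic_curve S M g f c q a b \<gamma>t"
    unfolding characteristic_curve_def
  proof (intro conjI)
    show "\<gamma>t ` {a<..<b} \<subseteq> dom_of c" using c\<gamma> U_dom by auto
    show "smooth_on {a<..<b} (coord c \<circ> \<gamma>t)"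
      using yt(2) by (subst smooth_on_cong[OF oab(1), of _ yt]) (auto simp: c\<gamma>)
    show "\<forall>s\<in>{a<..<b}. vector_derivative (coord c \<circ> \<gamma>t) (at s) \<noteq> 0"
    proof
      fix s assume s: "s \<in> {a<..<b}"
      have "((coord c \<circ> \<gamma>t) has_vector_derivative vector_derivative yt (at s)) (at s)"
        by (rule has_vector_derivative_transform_within_open[OF smooth_on_has_vector_derivative[OF yt(2) s] oab(1) s])
          (simp add: c\<gamma>)
      then show "vector_derivative (coord c \<circ> \<gamma>t) (at s) \<noteq> 0" using yt(4)[OF s] by (simp add: vector_derivative_at)
    qed
    have "lightlike_points S M g f \<inter> param c ` W = \<gamma>t ` {a<..<b}"
    proof (intro equalityI subsetI)
      fix x assume x: "x \<in> lightlike_points S M g f \<inter> param c ` W"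
      then obtain w where w: "x = param c w" "w \<in> W" by auto
      then have "w \<in> coord c ` U" using W(2) U'(2) by blast
      then have xU: "x \<in> U" "coord c x = w" using w param_U coord_param_U by auto
      then have "w \<in> coord c ` (lightlike_points S M g f \<inter> U) \<inter> W" using x w(2) by blast
      then show "x \<in> \<gamma>t ` {a<..<b}" unfolding W(4) using w by (auto simp: \<gamma>t_def)
    next
      fix x assume "x \<in> \<gamma>t ` {a<..<b}"
      then obtain s where s: "x = \<gamma>t s" "s \<in> {a<..<b}" by auto
      then have y: "yt s \<in> coord c ` (lightlike_points S M g f \<inter> U)" "yt s \<in> W" using W(4) by blast+
      then have "\<gamma>t s \<in> lightlike_points S M g f"
        using param_coord_U by (auto simp: \<gamma>t_def)
      then show "x \<in> lightlike_points S M g f \<inter> param c ` W" using s y by (auto simp: \<gamma>t_def)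
    qed
    moreover have "openin (top_of S) (param c ` W)" by (rule param_open[OF S_manifold c W(1) sub(2)])
    moreover have "q \<in> param c ` W"
      using W(3) param_coord_U[OF q] unfolding q_def comp_def by (metis imageI)
    ultimately show "\<exists>W. openin (top_of S) W \<and> q \<in> W \<and> lightlike_points S M g f \<inter> W = \<gamma>t ` {a<..<b}" by blast
  qed (use ab \<gamma>t0 in auto)
  have sq: "smooth_on (coord c ` Us) (\<eta>s \<circ> param c)"
    unfolding Us(3) using \<eta>1(1) U'(2)
    by (subst smooth_on_cong[OF U'(1), of _ \<eta>1]) (auto simp: \<eta>s_def coord_param_U subset_iff)
  have nvf: "normalized_null_vector_field S M g f c Us \<eta>s"
    unfolding normalized_null_vector_field_def null_vector_field_def
  proof (intro conjI ballI)
    show "openin (top_of S) Us" "Us \<subseteq> dom_of c" using Us U_dom by auto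
    show "smooth_on (coord c ` Us) (\<eta>s \<circ> param c)" by (rule sq)
    fix x assume x: "x \<in> lightlike_points S M g f \<inter> Us"
    then have xU: "x \<in> U" "coord c x \<in> U'" using Us by auto
    obtain k where k: "k \<noteq> 0" "\<eta>s x = k *\<^sub>R \<eta> x"
      using \<eta>1(2)[OF xU(2)] param_coord_U[OF xU(1)] by (auto simp: \<eta>s_def)
    have "null_vector M g f c x (\<eta> x)" using null_field x xU by (simp add: null_vector_field_def)
    then show "null_vector M g f c x (\<eta>s x)"
      using k ds2_bilinear(1)[OF M S U_chart[OF xU(1)], of k "\<eta> x" 0 0] by (simp add: null_vector_def)
    have "ds2 M g f c (param c v) (\<eta>s (param c v)) (\<eta>s (param c v)) =
      ip_at (g d \<circ> param d) (\<Phi> v) (Dir \<Phi> v (\<eta>1 v)) (Dir \<Phi> v (\<eta>1 v))" if "v \<in> U'" for v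
    proof -
      have v: "v \<in> coord c ` U" using that U'(2) by auto
      show ?thesis using ds2_eq[OF param_U[OF v]] coord_param_U[OF v] by (simp add: \<eta>s_def)
    qed
    then have "frechet_derivative (\<lambda>v. ds2 M g f c (param c v) (\<eta>s (param c v)) (\<eta>s (param c v))) (at (coord c x)) =
      frechet_derivative (\<lambda>v. ip_at (g d \<circ> param d) (\<Phi> v) (Dir \<Phi> v (\<eta>1 v)) (Dir \<Phi> v (\<eta>1 v))) (at (coord c x))"
      by (intro frechet_derivative_cong_open[OF U'(1) xU(2)])
    then show "Dir (\<lambda>v. ds2 M g f c (param c v) (\<eta>s (param c v)) (\<eta>s (param c v))) (coord c x) (\<eta>s x) = 1"
      using norm[of "coord c x"] x xU by (simp add: \<eta>s_def)
  qed
  have e_eq: "coord d \<circ> (f \<circ> \<gamma>t) = (\<lambda>s. \<Phi> (yt s))" by (auto simp: \<gamma>t_def)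
  have L_eq: "differential f c d (\<gamma>t s) (\<eta>s (\<gamma>t s)) = Dir \<Phi> (yt s) (\<eta>1 (yt s))" if "s \<in> {a<..<b}" for s
    using c\<gamma>(1)[OF that] by (simp add: differential_def \<eta>s_def)
  have ip_eq: "pairing g d (f (\<gamma>t s)) v w = ip_at (g d \<circ> param d) (\<Phi> (yt s)) v w" if "s \<in> {a<..<b}" for s v w
  proof -
    have "(g d \<circ> param d) (\<Phi> (yt s)) = g d (f (\<gamma>t s))"
      using param_coord[OF M_manifold d, of "f (\<gamma>t s)"] Ud c\<gamma>(3)[OF that] by (auto simp: \<gamma>t_def)
    then show ?thesis by (simp add: pairing_def ip_at_def)
  qed
  have k: "\<kappa> = pairing g d (f (\<gamma>t 0)) (differential f c d (\<gamma>t 0) (\<eta>s (\<gamma>t 0))) (cov_deriv g d (f \<circ> \<gamma>t) N 0)"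
  proof -
    have "(f \<circ> \<gamma>t) 0 \<in> dom_of d" using Ud c\<gamma>(3)[OF oab(2)] by auto
    from cov_deriv_cov_ip[where \<sigma> = "f \<circ> \<gamma>t" and t = 0, OF M d this] show ?thesis
      unfolding L_eq[OF oab(2)] \<kappa> e_eq by (simp add: \<gamma>t_def)
  qed
  have "lightlike_geodesic_torsion S M g f q \<kappa>"
    unfolding lightlike_geodesic_torsion_def Let_def
  proof (intro conjI exI)
    show "first_kind S M g f q" using fk by (simp add: q_def)
    show "chart_at S q c" "chart_at M (f q) d" using q U_chart U_chart_d by auto
    show "f ` Us \<subseteq> dom_of d" using Us Ud by auto
    show "characteristic_curve S M g f c q a b \<gamma>t" by (rule cc)
    show "\<gamma>t ` {a<..<b} \<subseteq> Us" using c\<gamma> by auto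
    show "normalized_null_vector_field S M g f c Us \<eta>s" by (rule nvf)
    show "smooth_on {a<..<b} N" by (rule N(1))
    show "\<forall>s\<in>{a<..<b}.
       pairing g d (f (\<gamma>t s)) (vector_derivative (coord d \<circ> (f \<circ> \<gamma>t)) (at s)) (vector_derivative (coord d \<circ> (f \<circ> \<gamma>t)) (at s)) = 1 \<and>
       pairing g d (f (\<gamma>t s)) (N s) (vector_derivative (coord d \<circ> (f \<circ> \<gamma>t)) (at s)) = 0 \<and>
       pairing g d (f (\<gamma>t s)) (N s) (N s) = 0 \<and>
       pairing g d (f (\<gamma>t s)) (N s) (differential f c d (\<gamma>t s) (\<eta>s (\<gamma>t s))) = 1"
      unfolding e_eq by (intro ballI conjI) (simp_all only: ip_eq L_eq N)
    show "\<kappa> = pairing g d (f (\<gamma>t 0)) (differential f c d (\<gamma>t 0) (\<eta>s (\<gamma>t 0))) (cov_deriv g d (f \<circ> \<gamma>t) N 0)"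
      by (rule k)
  qed
  then show ?thesis using \<kappa>Q by (auto simp: q_def)
qed

text \<open>Thus \<open>ca\<close> has the zeros of \<open>\<delta>\<close>, to the same order.\<close>

lemma ca_char_delta:
  assumes "t \<in> I"
  shows "char_delta c \<gamma> \<eta> t = ca t * (\<eta> (\<gamma> t) \<bullet> \<eta> (\<gamma> t))"
proof -
  have p: "param c (coord c (\<gamma> t)) = \<gamma> t" using \<gamma>_in[OF assms] param_coord_U by auto
  have "\<eta> (\<gamma> t) \<noteq> 0" using \<eta>(2)[OF y_in[OF assms]] by (simp add: p)
  then have "ca t * (\<eta> (\<gamma> t) \<bullet> \<eta> (\<gamma> t)) = y' t \<bullet> rot (\<eta> (\<gamma> t))"
    by (simp add: ca_def \<zeta>_def p)
  also have "\<dots> = char_delta c \<gamma> \<eta> t"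
    unfolding char_delta_rot y'_def ..
  finally show ?thesis by simp
qed

text \<open>The arc lemma at the parameter \<open>0\<close> ensures that lightlike points close to \<open>\<gamma> 0\<close> have parameters close to \<open>0\<close>;
admissibility supplies points of the first kind among them.\<close>

lemma torsion_unbounded:
  assumes adm: "admissible_second_kind S M g f (\<gamma> 0)"
    and \<delta>: "char_delta c \<gamma> \<eta> 0 = 0" "deriv (char_delta c \<gamma> \<eta>) 0 = 0"
  shows "torsion_unbounded_at S M g f (\<gamma> 0)"
  unfolding torsion_unbounded_at_def
proof (intro allI impI notI, elim conjE)
  fix W assume W: "openin (top_of S) W" "\<gamma> 0 \<in> W"
    and bd: "bounded {k. \<exists>q\<in>W. first_kind S M g f q \<and> lightlike_geodesic_torsion S M g f q k}"
  have \<gamma>0: "\<gamma> 0 \<in> lightlike_points S M g f \<inter> U" by (rule \<gamma>_in[OF zero_I])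
  have nd: "nondegenerate_lightlike_point S M g f (\<gamma> 0)"
    using adm by (simp add: admissible_second_kind_def second_kind_def)
  let ?n = "\<lambda>t. \<eta> (\<gamma> t) \<bullet> \<eta> (\<gamma> t)"
  have p: "param c (coord c (\<gamma> t)) = \<gamma> t" if "t \<in> I" for t using \<gamma>_in[OF that] param_coord_U by auto
  have n0: "?n 0 \<noteq> 0" using \<eta>(2)[OF y_in[OF zero_I]] by (simp add: p)
  have ca0: "ca 0 = 0" using ca_char_delta[OF zero_I] \<delta>(1) n0 by simp
  have ca1: "vector_derivative ca (at 0) = 0"
  proof -
    have "((\<lambda>t. ca t * ((\<eta> \<circ> param c) ((coord c \<circ> \<gamma>) t) \<bullet> (\<eta> \<circ> param c) ((coord c \<circ> \<gamma>) t))) has_vector_derivative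
      ca 0 * vector_derivative (\<lambda>t. (\<eta> \<circ> param c) ((coord c \<circ> \<gamma>) t) \<bullet> (\<eta> \<circ> param c) ((coord c \<circ> \<gamma>) t)) (at 0) +
      vector_derivative ca (at 0) * ((\<eta> \<circ> param c) ((coord c \<circ> \<gamma>) 0) \<bullet> (\<eta> \<circ> param c) ((coord c \<circ> \<gamma>) 0))) (at 0)"
      by (intro has_vector_derivative_mult smooth_on_has_vector_derivative[OF _ zero_I] smooth_ca
          smooth_on_inner smooth_along \<eta>(1) open_I)
    then have "((\<lambda>t. ca t * ((\<eta> \<circ> param c) ((coord c \<circ> \<gamma>) t) \<bullet> (\<eta> \<circ> param c) ((coord c \<circ> \<gamma>) t))) has_vector_derivative
      vector_derivative ca (at 0) * ?n 0) (at 0)"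
      using p[OF zero_I] by (simp add: ca0)
    then have "(char_delta c \<gamma> \<eta> has_vector_derivative vector_derivative ca (at 0) * ?n 0) (at 0)"
      by (rule has_vector_derivative_transform_within_open[OF _ open_I zero_I]) (simp add: ca_char_delta p)
    then have "deriv (char_delta c \<gamma> \<eta>) 0 = vector_derivative ca (at 0) * ?n 0"
      by (simp add: DERIV_imp_deriv has_real_derivative_iff_has_vector_derivative)
    then show ?thesis using \<delta>(2) n0 by simp
  qed
  have \<theta>0: "\<theta> ((coord c \<circ> \<gamma>) 0) \<noteq> 0" by (rule second_kind_\<theta>[OF nd ca0])
  obtain B where B: "\<And>k. k \<in> {k. \<exists>q\<in>W. first_kind S M g f q \<and> lightlike_geodesic_torsion S M g f q k} \<Longrightarrow> \<bar>k\<bar> \<le> B"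
    using bd by (auto simp: bounded_real)
  \<comment> \<open>The parameters below \<open>\<epsilon>\<close> give torsion larger than the supposed bound.\<close>
  obtain \<epsilon> where \<epsilon>: "\<epsilon> > 0" and large: "\<And>t. \<bar>t\<bar> < \<epsilon> \<Longrightarrow> t \<in> I \<and> cb t \<noteq> 0 \<and> KH t \<noteq> 0 \<and> \<theta> ((coord c \<circ> \<gamma>) t) \<noteq> 0 \<and>
    B * \<bar>ca t * sqrt ((ca t)\<^sup>2 * r ((coord c \<circ> \<gamma>) t))\<bar> < \<bar>Q t\<bar>"
    using torsion_large_near_second_kind[OF ca0 ca1 \<theta>0] by blast
  let ?Z = "coord c ` (lightlike_points S M g f \<inter> U)"
  have "\<exists>t1 t2 W. - e < t1 \<and> 0 - \<epsilon> < t1 \<and> t1 < 0 \<and> 0 < t2 \<and> t2 < 0 + \<epsilon> \<and> t2 < e \<and>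
    open W \<and> W \<subseteq> coord c ` U \<and> (coord c \<circ> \<gamma>) 0 \<in> W \<and> ?Z \<inter> W = (coord c \<circ> \<gamma>) ` {t1<..<t2}"
    by (rule zero_set_locally_arc[OF \<Omega> smooth_\<mu> \<mu>_zero y(1,2) _ y(3), of 0 "\<zeta> ((coord c \<circ> \<gamma>) 0)"])
      (use e \<epsilon> \<theta>0 in \<open>auto simp: \<theta>_def\<close>)
  then obtain t1 t2 W1 where t: "- \<epsilon> < t1" "t2 < \<epsilon>" and W1: "open W1" "W1 \<subseteq> coord c ` U"
    "(coord c \<circ> \<gamma>) 0 \<in> W1" "?Z \<inter> W1 = (coord c \<circ> \<gamma>) ` {t1<..<t2}" by auto
  have "openin (top_of S) (param c ` W1)"
    using W1(1,2) image_mono[OF U_dom, of "coord c"] by (intro param_open[OF S_manifold c]) blast+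
  then have "openin (top_of S) (W \<inter> param c ` W1)" using W by (intro openin_Int)
  moreover have "\<gamma> 0 \<in> W \<inter> param c ` W1"
    using W W1(3) p[OF zero_I] unfolding comp_def by (metis IntI imageI)
  ultimately obtain q where q: "q \<in> W" "q \<in> param c ` W1" and fk: "first_kind S M g f q"
    using adm unfolding admissible_second_kind_def by blast
  obtain u where u: "q = param c u" "u \<in> W1" using q by auto
  have qU: "q \<in> U" "coord c q = u" using u W1(2) param_U coord_param_U by auto
  have "q \<in> lightlike_points S M g f" using fk by (simp add: first_kind_def nondegenerate_lightlike_point_def)
  then have "u \<in> ?Z \<inter> W1" using u(2) qU by blast
  then obtain t0 where t0: "u = coord c (\<gamma> t0)" "t1 < t0" "t0 < t2" unfolding W1(4) by auto
  have "\<bar>t0\<bar> < \<epsilon>" using t t0 by auto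
  note l = large[OF this]
  then have t0I: "t0 \<in> I" by simp
  have q\<gamma>: "q = \<gamma> t0" using u t0 p[OF t0I] by simp
  \<comment> \<open>Points of the first kind have \<open>ca \<noteq> 0\<close>, so the torsion formula applies to them.\<close>
  have "\<beta> ((coord c \<circ> \<gamma>) t0) \<noteq> 0" using first_kind_\<beta>[OF qU(1) fk] by (simp add: q\<gamma>)
  then have ca: "ca t0 \<noteq> 0" using cb_\<beta>[OF t0I] l by auto
  obtain \<kappa> where \<kappa>: "lightlike_geodesic_torsion S M g f q \<kappa>"
    "\<kappa> * (ca t0 * sqrt ((ca t0)\<^sup>2 * r ((coord c \<circ> \<gamma>) t0))) = - Q t0"
    using torsion_value[OF t0I ca] l fk by (auto simp: q\<gamma>)
  have "\<bar>\<kappa>\<bar> \<le> B" using B \<kappa>(1) q(1) fk by blast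
  have "\<bar>Q t0\<bar> = \<bar>\<kappa>\<bar> * \<bar>ca t0 * sqrt ((ca t0)\<^sup>2 * r ((coord c \<circ> \<gamma>) t0))\<bar>"
    using arg_cong[OF \<kappa>(2), of abs] by (simp add: abs_mult)
  also have "\<dots> \<le> B * \<bar>ca t0 * sqrt ((ca t0)\<^sup>2 * r ((coord c \<circ> \<gamma>) t0))\<bar>"
    using \<open>\<bar>\<kappa>\<bar> \<le> B\<close> by (intro mult_right_mono) auto
  finally show False using l by simp
qed

end


section \<open>The torsion is unbounded\<close>

theorem theorem4p5:
  fixes S :: "('s, 2) mfd" and M :: "('m, 3) mfd"
    and g :: "'m tensor2" and f :: "'s \<Rightarrow> 'm" and p :: 's
  assumes "lorentzian_3_manifold M g"
    and "surface S M f"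
    and "mixed_type S M g f"
    and "admissible_second_kind S M g f p"
    and "\<not> L3_point S M g f p"
  shows "torsion_unbounded_at S M g f p"
proof -
  have "second_kind S M g f p" using assms(4) by (simp add: admissible_second_kind_def)
  then obtain c \<gamma> \<eta> where nd: "nondegenerate_lightlike_point S M g f p"
    and cd: "char_data S M g f p c \<gamma> \<eta>"
    and dep: "lin_dependent (vector_derivative (coord c \<circ> \<gamma>) (at 0)) (\<eta> p)"
    by (auto simp: second_kind_def)
  obtain a b where cc: "characteristic_curve S M g f c p a b \<gamma>" using cd by (auto simp: char_data_def)
  obtain U0 where U0: "p \<in> U0" "null_vector_field S M g f c U0 \<eta>" using cd by (auto simp: char_data_def)
  have c: "chart_at S p c" "c \<in> atlas S" using cd by (auto simp: char_data_def chart_at_def)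
  have S: "smooth_manifold S" using assms(2) by (simp add: surface_def)
  have \<gamma>0: "\<gamma> 0 = p" using cc by (simp add: characteristic_curve_def)
  obtain d where d: "chart_at M (f p) d" using surface_chart_exists[OF assms(1,2) c(1)] .
  define U where "U = {q \<in> U0. f q \<in> dom_of d}"
  have U: "openin (top_of S) U" "U \<subseteq> U0" "p \<in> U" "f ` U \<subseteq> dom_of d" "U \<subseteq> dom_of c"
    using surface_preimage_open[OF assms(1,2) _ , of U0 d] U0 d
    by (auto simp: U_def null_vector_field_def chart_at_def)
  have nf: "null_vector_field S M g f c U \<eta>"
    using U0(2) U smooth_on_subset[of "coord c ` U0" "\<eta> \<circ> param c" "coord c ` U"]
    by (auto simp: null_vector_field_def)
  have oU: "open (coord c ` U)" by (rule coord_open[OF S c(2) U(1,5)])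
  have sm: "smooth_on {a<..<b} (coord c \<circ> \<gamma>)" and ab: "a < 0" "0 < b"
    and \<gamma>c: "\<And>t. t \<in> {a<..<b} \<Longrightarrow> \<gamma> t \<in> dom_of c"
    and \<gamma>L: "\<And>t. t \<in> {a<..<b} \<Longrightarrow> \<gamma> t \<in> lightlike_points S M g f"
    and \<gamma>r: "\<And>t. t \<in> {a<..<b} \<Longrightarrow> vector_derivative (coord c \<circ> \<gamma>) (at t) \<noteq> 0"
    using cc by (auto simp: characteristic_curve_def)
  have "isCont (coord c \<circ> \<gamma>) 0" using smooth_on_isCont[OF sm] ab by simp
  then have "\<forall>\<^sub>F t in at 0. (coord c \<circ> \<gamma>) t \<in> coord c ` U"
    using topological_tendstoD[OF _ oU, of "coord c \<circ> \<gamma>"] U(3) \<gamma>0 by (simp add: isCont_def)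
  then obtain e0 where e0: "e0 > 0" "\<And>t. t \<noteq> 0 \<Longrightarrow> dist t 0 < e0 \<Longrightarrow> coord c (\<gamma> t) \<in> coord c ` U"
    by (auto simp: eventually_at)
  \<comment> \<open>Near the parameter \<open>0\<close> the curve stays in \<open>U\<close>.\<close>
  define e where "e = Min {e0, - a, b}"
  have e: "e > 0" "e \<le> e0" "a \<le> - e" "e \<le> b" using e0 ab by (auto simp: e_def)
  have sub: "{-e<..<e} \<subseteq> {a<..<b}" using e by auto
  have \<gamma>U: "\<gamma> t \<in> U" if t: "t \<in> {-e<..<e}" for t
  proof (cases "t = 0")
    case False
    then have "coord c (\<gamma> t) \<in> coord c ` U" using e0(2)[of t] t e by (auto simp: dist_real_def)
    then show ?thesis
      using coord_inj[OF S c(2)] \<gamma>c[of t] t sub U(5) by (meson inj_on_image_mem_iff subsetD)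
  qed (use \<gamma>0 U in simp)
  interpret characteristic_surface_data S M g f c d U \<eta> \<gamma> e
  proof
    show "d \<in> atlas M" using d by (simp add: chart_at_def)
    show "\<gamma> ` {-e<..<e} \<subseteq> lightlike_points S M g f \<inter> U" using \<gamma>U \<gamma>L sub by blast
    show "smooth_on {-e<..<e} (coord c \<circ> \<gamma>)" by (rule smooth_on_subset[OF sm sub])
    show "vector_derivative (coord c \<circ> \<gamma>) (at t) \<noteq> 0" if "t \<in> {-e<..<e}" for t
      using \<gamma>r sub that by blast
  qed (use assms c nf U e in auto)
  have "char_delta c \<gamma> \<eta> 0 = vector_derivative (coord c \<circ> \<gamma>) (at 0) \<bullet> rot (\<eta> p)"
    by (simp add: char_delta_rot \<gamma>0)
  then have \<delta>: "char_delta c \<gamma> \<eta> 0 = 0" using lin_dependent_rot[OF dep] by simp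
  have "deriv (char_delta c \<gamma> \<eta>) 0 = 0" using assms(5) nd cd \<delta> unfolding L3_point_def by blast
  then show ?thesis using torsion_unbounded \<delta> assms(4) by (simp add: \<gamma>0)
qed

end
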